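(* Let $\ell\ge1$ and $k\in[1,\ell-1]$. Applying the coking elimination operation with respect to the vertex $k$ (a coking of the induced subgraph $C_\ell^k[[k,\ell]]$, the vertices $1,\dots,k-1$ being isolated and their weights unchanged) to $(C_\ell^k,\psi_\ell^k)$ yields $(D_\ell^k,\phi_\ell^k)$, and applying the king elimination operation with respect to the vertex $k$ (a king of $D_\ell^k[[k,\ell]]$, the vertices $1,\dots,k-1$ being isolated and their weights unchanged) to $(D_\ell^k,\phi_\ell^k)$ yields $(C_\ell^{k+1},\psi_\ell^{k+1})$. These operations preserve both the characteristic polynomial of the $\psi$-digraphical arrangement and the freeness of its cone; thus the sequence starting from $(C_\ell^1,\psi_\ell^1)$ (for which $\mathcal{A}(C_\ell^1,\psi_\ell^1)\times\Phi_1$ is affinely equivalent to the Catalan arrangement $\mathrm{Cat}(\ell+1)$) ends with $(C_\ell^\ell,\psi_\ell^\ell)$, whose digraph is edgeless and whose arrangement has supersolvable cone. In particular, for every $n\ge 2$ the cone $\mathbf{c}\mathrm{Cat}(n)$ is free with exponents $\{0,1,n+1,n+2,\dots,2n-1\}$.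
   Context: $[a,b]=\{n\in\mathbb{Z}:a\le n\le b\}$. For $k\in[1,\ell]$, vertex-weighted digraphs on $[1,\ell]$: $E_{C_\ell^k}=\{(i,j):i,j\in[k,\ell],i\ne j\}$, $\psi_\ell^k(i)=[-\min\{i,k\},\min\{i,k\}]$; $E_{D_\ell^k}=\{(k,i):i\in[k+1,\ell]\}\cup\{(i,j):i,j\in[k+1,\ell],i\ne j\}$, $\phi_\ell^k(i)=[-\min\{i,k\},\min\{i,k\}]$ for $i\le k$ and $\phi_\ell^k(i)=[-\min\{i,k\}-1,\min\{i,k\}]$ for $i>k$. For a vertex-weighted digraph $(G,\psi)$ with $\psi(i)=[a_i,b_i]$, $\mathcal{A}(G,\psi)$ is the arrangement in $\mathbb{R}^\ell$ of $x_i-x_j=0$ ($i<j$), $x_i-x_j=1$ ($(i,j)\in E_G$), $x_i=c$ ($c\in\psi(i)$); its cone adds a coordinate $z$, consists of $z=0$ and the homogenized hyperplanes $x_i-x_j=0$, $x_i-x_j=z$, $x_i=cz$. A coking (king) $v$ has $(u,v)\in E_G$ (resp. $(v,u)\in E_G$) for all other $u$; coking elimination removes all $(i,v)$ and replaces $\psi(i)$ by $[a_i-1,b_i]$ for $i\ne v$; king elimination removes all $(v,i)$ and replaces $\psi(i)$ by $[a_i,b_i+1]$ for $i\ne v$. $\Phi_1$ is the empty arrangement in $\mathbb{R}$. $\mathrm{Cat}(n)$ is the arrangement in $\mathbb{R}^n$ of $x_i-x_j\in\{-1,0,1\}$, $1\le i<j\le n$. Characteristic polynomial $\chi_{\mathcal{A}}(t)=\sum_{X\in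 L(\mathcal{A})}\mu(X)t^{\dim X}$; a central arrangement is free with exponents $d_1,\dots,d_N$ if $D(\mathcal{A})=\{\theta\in\mathrm{Der}(S):\theta(\alpha_H)\in\alpha_HS\}$ is free over the polynomial ring $S$ with homogeneous basis of degrees $d_1,\dots,d_N$; supersolvable means the intersection lattice has a maximal chain of modular elements. *)

theory Defs
  imports "HOL-Analysis.Analysis" "HOL-Analysis.Finite_Function_Topology"
    "HOL-Computational_Algebra.Polynomial"
    "HOL-Library.Multiset" "HOL-Library.FuncSet"
begin

section \<open>Hyperplane arrangements\<close>

text \<open>
  For a finite set \<open>I\<close> of coordinates, the space \<open>\<real>\<^sup>I\<close> consists of the finitely supported
  functions whose support lies in \<open>I\<close>. An arrangement remembers its set of coordinates, since
  the ambient space cannot be recovered from the hyperplanes if there are none.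
\<close>

definition rspace :: "'v set \<Rightarrow> ('v \<Rightarrow>\<^sub>0 real) set" where
  "rspace I = {x. Poly_Mapping.keys x \<subseteq> I}"

record 'v arrangement =
  coords :: "'v set"
  hyps :: "('v \<Rightarrow>\<^sub>0 real) set set"

abbreviation ambient :: "'v arrangement \<Rightarrow> ('v \<Rightarrow>\<^sub>0 real) set" where
  "ambient A \<equiv> rspace (coords A)"

definition hyperplane :: "'v set \<Rightarrow> ('v \<Rightarrow>\<^sub>0 real) \<Rightarrow> real \<Rightarrow> ('v \<Rightarrow>\<^sub>0 real) set" where
  "hyperplane I a c =
     {x \<in> rspace I. (\<Sum>i\<in>I. Poly_Mapping.lookup a i * Poly_Mapping.lookup x i) = c}"

definition central :: "'v arrangement \<Rightarrow> bool" where
  "central A \<longleftrightarrow> (\<forall>H\<in>hyps A. 0 \<in> H)"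

text \<open>
  The new coordinate \<open>z\<close> of the cone is \<open>None\<close>. The equation of a hyperplane is unique up to a
  nonzero factor, so each hyperplane contributes exactly one homogenized hyperplane.
\<close>

definition cone_coords :: "'v set \<Rightarrow> 'v option set" where
  "cone_coords I = insert None (Some ` I)"

definition arr_cone :: "'v arrangement \<Rightarrow> 'v option arrangement" where
  "arr_cone A = \<lparr> coords = cone_coords (coords A),
     hyps = insert {y \<in> rspace (cone_coords (coords A)). Poly_Mapping.lookup y None = 0}
       {{y \<in> rspace (cone_coords (coords A)).
           (\<Sum>i\<in>coords A. Poly_Mapping.lookup a i * Poly_Mapping.lookup y (Some i))
             = c * Poly_Mapping.lookup y None}
        | a c. a \<in> ambient A \<and> a \<noteq> 0 \<and> hyperplane (coords A) a c \<in> hyps A} \<rparr>"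

definition arr_prod :: "'v arrangement \<Rightarrow> 'w arrangement \<Rightarrow> ('v + 'w) arrangement" where
  "arr_prod A B = \<lparr> coords = coords A <+> coords B,
     hyps = {{x \<in> rspace (coords A <+> coords B). Poly_Mapping.map_key Inl x \<in> H} | H. H \<in> hyps A}
          \<union> {{x \<in> rspace (coords A <+> coords B). Poly_Mapping.map_key Inr x \<in> H} | H. H \<in> hyps B} \<rparr>"

definition Phi1 :: "unit arrangement" where
  "Phi1 = \<lparr> coords = UNIV, hyps = {} \<rparr>"

definition affinely_equivalent :: "'v arrangement \<Rightarrow> 'w arrangement \<Rightarrow> bool" where
  "affinely_equivalent A B \<longleftrightarrow>
     (\<exists>f c. linear f \<and> bij_betw (\<lambda>x. f x + c) (ambient A) (ambient B)
        \<and> (\<lambda>H. (\<lambda>x. f x + c) ` H) ` hyps A = hyps B)"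

subsection \<open>Intersection poset and characteristic polynomial\<close>

text \<open>The intersection poset is ordered by reverse inclusion; its least element is the ambient space.\<close>

definition flats :: "'v arrangement \<Rightarrow> ('v \<Rightarrow>\<^sub>0 real) set set" where
  "flats A = {ambient A \<inter> \<Inter>B | B. B \<subseteq> hyps A} - {{}}"

definition flat_dim :: "('v \<Rightarrow>\<^sub>0 real) set \<Rightarrow> nat" where
  "flat_dim X = dim {x - y | x y. x \<in> X \<and> y \<in> X}"

text \<open>
  \<open>moebius L V X\<close> is the value \<open>\<mu>(V, X)\<close> of the Moebius function of a finite family \<open>L\<close> of sets
  ordered by reverse inclusion with least element \<open>V\<close>.
\<close>

function moebius :: "'a set set \<Rightarrow> 'a set \<Rightarrow> 'a set \<Rightarrow> int" where
  "moebius L V X =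
     (if \<not> finite L then 0
      else if X = V then 1
      else - (\<Sum>Y\<in>{Y \<in> L. X \<subset> Y}. moebius L V Y))"
  by pat_completeness auto
termination
proof (relation "Wellfounded.measure (\<lambda>(L, V, X). card {Y \<in> L. X \<subset> Y})")
  fix L :: "'a set set" and V X Y :: "'a set"
  assume "\<not> \<not> finite L" and Y: "Y \<in> {Y \<in> L. X \<subset> Y}"
  then have "finite {Y \<in> L. X \<subset> Y}" by simp
  moreover have "{Z \<in> L. Y \<subset> Z} \<subset> {Y \<in> L. X \<subset> Y}" using Y by blast
  ultimately show "((L, V, Y), (L, V, X)) \<in> Wellfounded.measure (\<lambda>(L, V, X). card {Y \<in> L. X \<subset> Y})"
    by (simp add: psubset_card_mono)
qed simp

declare moebius.simps [simp del]

definition arr_char_poly :: "'v arrangement \<Rightarrow> int poly" where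
  "arr_char_poly A = (\<Sum>X\<in>flats A. monom (moebius (flats A) (ambient A) X) (flat_dim X))"

subsection \<open>Supersolvability\<close>

text \<open>
  In the intersection lattice of a central arrangement the join of two flats is their intersection
  and their meet is the smallest flat containing both. A flat \<open>X\<close> is modular if
  \<open>Z \<or> (X \<and> Y) = (Z \<or> X) \<and> Y\<close> for all flats \<open>Z \<le> Y\<close>.
\<close>

definition flat_meet :: "'a set set \<Rightarrow> 'a set \<Rightarrow> 'a set \<Rightarrow> 'a set" where
  "flat_meet L X Y = \<Inter>{Z \<in> L. X \<union> Y \<subseteq> Z}"

definition modular_flat :: "'a set set \<Rightarrow> 'a set \<Rightarrow> bool" where
  "modular_flat L X \<longleftrightarrow> X \<in> L \<and>
     (\<forall>Y\<in>L. \<forall>Z\<in>L. Y \<subseteq> Z \<longrightarrow> Z \<inter> flat_meet L X Y = flat_meet L (Z \<inter> X) Y)"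

definition supersolvable :: "'v arrangement \<Rightarrow> bool" where
  "supersolvable A \<longleftrightarrow> central A \<and>
     (\<exists>C. subset.maxchain (flats A) C \<and> (\<forall>X\<in>C. modular_flat (flats A) X))"

subsection \<open>Logarithmic derivations and freeness\<close>

type_synonym 'v rpoly = "('v \<Rightarrow>\<^sub>0 nat) \<Rightarrow>\<^sub>0 real"

definition poly_ring :: "'v set \<Rightarrow> 'v rpoly set" where
  "poly_ring I = {p. \<forall>m\<in>Poly_Mapping.keys p. Poly_Mapping.keys m \<subseteq> I}"

definition poly_var :: "'v \<Rightarrow> 'v rpoly" where
  "poly_var i = Poly_Mapping.single (Poly_Mapping.single i 1) 1"

definition linear_form :: "'v set \<Rightarrow> ('v \<Rightarrow>\<^sub>0 real) \<Rightarrow> 'v rpoly" where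
  "linear_form I a = (\<Sum>i\<in>I. Poly_Mapping.lookup a i *\<^sub>R poly_var i)"

definition homogeneous_poly :: "nat \<Rightarrow> 'v rpoly \<Rightarrow> bool" where
  "homogeneous_poly d p \<longleftrightarrow>
     (\<forall>m\<in>Poly_Mapping.keys p. (\<Sum>i\<in>Poly_Mapping.keys m. Poly_Mapping.lookup m i) = d)"

text \<open>
  A derivation of \<open>S = poly_ring I\<close> is a map on \<open>S\<close>; outside \<open>S\<close> it is fixed to be zero so that equality
  of functions is equality of derivations.
\<close>

definition derivations :: "'v set \<Rightarrow> ('v rpoly \<Rightarrow> 'v rpoly) set" where
  "derivations I = {\<theta>.
     (\<forall>p\<in>poly_ring I. \<theta> p \<in> poly_ring I) \<and> (\<forall>p. p \<notin> poly_ring I \<longrightarrow> \<theta> p = 0) \<and>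
     (\<forall>p\<in>poly_ring I. \<forall>q\<in>poly_ring I. \<theta> (p + q) = \<theta> p + \<theta> q) \<and>
     (\<forall>c. \<forall>p\<in>poly_ring I. \<theta> (c *\<^sub>R p) = c *\<^sub>R \<theta> p) \<and>
     (\<forall>p\<in>poly_ring I. \<forall>q\<in>poly_ring I. \<theta> (p * q) = \<theta> p * q + p * \<theta> q)}"

definition log_derivations :: "'v arrangement \<Rightarrow> ('v rpoly \<Rightarrow> 'v rpoly) set" where
  "log_derivations A = {\<theta> \<in> derivations (coords A).
     \<forall>a. a \<in> ambient A \<and> a \<noteq> 0 \<and> hyperplane (coords A) a 0 \<in> hyps A \<longrightarrow>
       (\<exists>q\<in>poly_ring (coords A).
          \<theta> (linear_form (coords A) a) = linear_form (coords A) a * q)}"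

definition homogeneous_der :: "'v set \<Rightarrow> nat \<Rightarrow> ('v rpoly \<Rightarrow> 'v rpoly) \<Rightarrow> bool" where
  "homogeneous_der I d \<theta> \<longleftrightarrow> (\<forall>i\<in>I. homogeneous_poly d (\<theta> (poly_var i)))"

definition log_basis :: "'v arrangement \<Rightarrow> ('v rpoly \<Rightarrow> 'v rpoly) list \<Rightarrow> bool" where
  "log_basis A \<theta>s \<longleftrightarrow> set \<theta>s \<subseteq> log_derivations A \<and>
     (\<forall>\<theta>\<in>log_derivations A. \<exists>!fs. length fs = length \<theta>s \<and> set fs \<subseteq> poly_ring (coords A) \<and>
        \<theta> = (\<lambda>p. \<Sum>j<length \<theta>s. (fs ! j) * (\<theta>s ! j) p))"

definition free_with_exponents :: "'v arrangement \<Rightarrow> nat multiset \<Rightarrow> bool" where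
  "free_with_exponents A E \<longleftrightarrow> central A \<and>
     (\<exists>\<theta>s ds. log_basis A \<theta>s \<and> list_all2 (homogeneous_der (coords A)) ds \<theta>s \<and> mset ds = E)"

definition free_arrangement :: "'v arrangement \<Rightarrow> bool" where
  "free_arrangement A \<longleftrightarrow> (\<exists>E. free_with_exponents A E)"

section \<open>Vertex-weighted digraphs\<close>

text \<open>The pair \<open>weight G i = (a, b)\<close> stands for the integer interval \<open>[a, b]\<close>.\<close>

record 'v wdigraph =
  vertices :: "'v set"
  edges :: "('v \<times> 'v) set"
  weight :: "'v \<Rightarrow> int \<times> int"

definition wdig_arr :: "'v::linorder wdigraph \<Rightarrow> 'v arrangement" where
  "wdig_arr G = \<lparr> coords = vertices G,
     hyps =
       {{x \<in> rspace (vertices G). Poly_Mapping.lookup x i - Poly_Mapping.lookup x j = 0}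
         | i j. i \<in> vertices G \<and> j \<in> vertices G \<and> i < j}
     \<union> {{x \<in> rspace (vertices G). Poly_Mapping.lookup x i - Poly_Mapping.lookup x j = 1}
         | i j. (i, j) \<in> edges G}
     \<union> {{x \<in> rspace (vertices G). Poly_Mapping.lookup x i = of_int c}
         | i c. i \<in> vertices G \<and> c \<in> {fst (weight G i)..snd (weight G i)}} \<rparr>"

definition coking :: "'v wdigraph \<Rightarrow> 'v \<Rightarrow> bool" where
  "coking G v \<longleftrightarrow> v \<in> vertices G \<and> (\<forall>u\<in>vertices G - {v}. (u, v) \<in> edges G)"

definition king :: "'v wdigraph \<Rightarrow> 'v \<Rightarrow> bool" where
  "king G v \<longleftrightarrow> v \<in> vertices G \<and> (\<forall>u\<in>vertices G - {v}. (v, u) \<in> edges G)"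

definition isolated :: "'v wdigraph \<Rightarrow> 'v \<Rightarrow> bool" where
  "isolated G v \<longleftrightarrow> v \<in> vertices G \<and> (\<forall>u. (u, v) \<notin> edges G \<and> (v, u) \<notin> edges G)"

definition coking_elim :: "'v \<Rightarrow> 'v wdigraph \<Rightarrow> 'v wdigraph" where
  "coking_elim v G = \<lparr> vertices = vertices G,
     edges = edges G - {(i, v) | i. True},
     weight = (\<lambda>i\<in>vertices G. if i = v then weight G i
                 else (fst (weight G i) - 1, snd (weight G i))) \<rparr>"

definition king_elim :: "'v \<Rightarrow> 'v wdigraph \<Rightarrow> 'v wdigraph" where
  "king_elim v G = \<lparr> vertices = vertices G,
     edges = edges G - {(v, i) | i. True},
     weight = (\<lambda>i\<in>vertices G. if i = v then weight G i
                 else (fst (weight G i), snd (weight G i) + 1)) \<rparr>"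

definition induced :: "'v wdigraph \<Rightarrow> 'v set \<Rightarrow> 'v wdigraph" where
  "induced G U = \<lparr> vertices = U, edges = edges G \<inter> U \<times> U, weight = restrict (weight G) U \<rparr>"

text \<open>
  The operation \<open>f\<close> is carried out on the subgraph induced on \<open>U\<close>; edges not inside \<open>U\<close> and weights of
  vertices outside \<open>U\<close> are kept.
\<close>

definition apply_on :: "'v set \<Rightarrow> ('v wdigraph \<Rightarrow> 'v wdigraph) \<Rightarrow> 'v wdigraph \<Rightarrow> 'v wdigraph" where
  "apply_on U f G = \<lparr> vertices = vertices G,
     edges = edges (f (induced G U)) \<union> (edges G - U \<times> U),
     weight = (\<lambda>i. if i \<in> U then weight (f (induced G U)) i else weight G i) \<rparr>"

definition C_dig :: "nat \<Rightarrow> nat \<Rightarrow> nat wdigraph" where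
  "C_dig l k = \<lparr> vertices = {1..l},
     edges = {(i, j). i \<in> {k..l} \<and> j \<in> {k..l} \<and> i \<noteq> j},
     weight = (\<lambda>i\<in>{1..l}. (- int (min i k), int (min i k))) \<rparr>"

definition D_dig :: "nat \<Rightarrow> nat \<Rightarrow> nat wdigraph" where
  "D_dig l k = \<lparr> vertices = {1..l},
     edges = {(k, i) | i. i \<in> {k+1..l}}
           \<union> {(i, j). i \<in> {k+1..l} \<and> j \<in> {k+1..l} \<and> i \<noteq> j},
     weight = (\<lambda>i\<in>{1..l}. if i \<le> k then (- int (min i k), int (min i k))
                 else (- int (min i k) - 1, int (min i k))) \<rparr>"

definition Cat :: "nat \<Rightarrow> nat arrangement" where
  "Cat n = \<lparr> coords = {1..n},
     hyps = {{x \<in> rspace {1..n}. Poly_Mapping.lookup x i - Poly_Mapping.lookup x j = c}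
       | i j c. 1 \<le> i \<and> i < j \<and> j \<le> n \<and> c \<in> {-1, 0, 1}} \<rparr>"

end

theory Submission
  imports Defs "HOL-Library.Option_ord" "Jordan_Normal_Form.Determinant"
begin

text \<open>
  Every cone in the sequence is free with an explicit basis, certified by Saito's criterion. Apart from the
  Euler derivation the basis consists of derivations with \<open>\<theta>(z) = 0\<close> and \<open>\<theta>(x\<^sub>i) = P(x\<^sub>i)\<close> for
  polynomials \<open>P(t)\<close> with coefficients in the polynomial ring. On the block \<open>k, \<dots>, l\<close> one takes \<open>P\<close> with \<open>P(0) = 0\<close> and
  \<open>P(t + z) - P(t) = z t\<^sup>r \<Prod>\<^sub>c (t - c z) \<Prod>\<^sub>j (t - x\<^sub>j)\<close>, where \<open>-a \<le> c < k\<close> and \<open>j\<close> runs over the set \<open>S\<close> of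
  heads of edges: the right-hand side vanishes at \<open>t = x\<^sub>j\<close>, so \<open>x\<^sub>i - x\<^sub>j - z\<close> divides \<open>P(x\<^sub>i) - P(x\<^sub>j)\<close>.
  The vertices \<open>m < k\<close> contribute \<open>P(t) = \<Prod>\<^bsub>|c| \<le> m\<^esub> (t - c z) \<Prod>\<^bsub>j > m\<^esub> (t - x\<^sub>j)\<close>. These derivations are independent
  because a dependency would be a polynomial in \<open>t\<close> with more zeros than its degree. The Catalan cone is
  treated in the same way.

  The characteristic polynomials are computed by counting points modulo a large \<open>q\<close>: subtracting from each
  coordinate of the block the number of smaller coordinates indexed by \<open>S\<close> turns the admissible points into
  injective maps, and the lower coordinates are then chosen one after another. Both steps only involve
  \<open>a + |S| = l\<close>, so all arrangements of the sequence have the same count.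

  At the end of the sequence no edges are left, and setting the coordinates free one after another, smallest vertex
  first, gives a maximal chain of modular flats.
\<close>

alias lookup = Poly_Mapping.lookup
alias single = Poly_Mapping.single
alias keys = Poly_Mapping.keys
alias coeff = Polynomial.coeff
alias monom = Polynomial.monom
alias smult = Polynomial.smult
alias det = Determinant.det

section \<open>Polynomials as finitely supported functions\<close>

definition poly_const :: "real \<Rightarrow> 'v rpoly" where
  "poly_const c = single 0 c"

definition monom_eval :: "('v \<Rightarrow> 'b::comm_ring_1) \<Rightarrow> ('v \<Rightarrow>\<^sub>0 nat) \<Rightarrow> 'b" where
  "monom_eval s m = (\<Prod>i\<in>keys m. s i ^ lookup m i)"

definition poly_subst :: "(real \<Rightarrow> 'b::comm_ring_1) \<Rightarrow> ('v \<Rightarrow> 'b) \<Rightarrow> 'v rpoly \<Rightarrow> 'b" where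
  "poly_subst \<kappa> s p = (\<Sum>m\<in>keys p. \<kappa> (lookup p m) * monom_eval s m)"

lemma comm_ring_hom_poly_const: "comm_ring_hom poly_const"
  by unfold_locales (auto simp: poly_const_def single_add mult_single)

interpretation poly_const: comm_ring_hom poly_const
  by (rule comm_ring_hom_poly_const)

lemma poly_const_eq_0_iff [simp]: "poly_const c = 0 \<longleftrightarrow> c = 0"
  by (metis poly_const_def lookup_single_eq single_zero)

lemma poly_const_of_int: "poly_const (of_int c) = of_int c"
  and poly_const_of_nat: "poly_const (of_nat n) = of_nat n"
  by (simp_all add: poly_const_def)

lemma poly_const_mult_single: "poly_const c * single m b = single m (c * b)"
  by (simp add: poly_const_def mult_single)

lemma lookup_scaleR: "lookup (c *\<^sub>R p) m = c * lookup p m" for p :: "'v \<Rightarrow>\<^sub>0 real"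
  by (simp add: scaleR_poly_mapping_def)

lemma sum_single_lookup: "(\<Sum>k\<in>keys p. single k (lookup p k)) = p"
  by (rule poly_mapping_eqI) (auto simp: lookup_sum lookup_single when_def in_keys_iff)

lemma rpoly_induct [case_names single add]:
  fixes p :: "'a \<Rightarrow>\<^sub>0 real"
  assumes "\<And>m c. P (single m c)" "\<And>p q. P p \<Longrightarrow> P q \<Longrightarrow> P (p + q)"
  shows "P p"
proof -
  have "P (\<Sum>m\<in>K. single m (lookup p m))" for K
  proof (induction K rule: infinite_finite_induct)
    case (insert m K)
    then show ?case using assms by simp
  qed (use assms(1)[of undefined 0] in auto)
  then show ?thesis by (metis sum_single_lookup)
qed

lemma scaleR_eq_const_mult: "c *\<^sub>R p = poly_const c * p" for p :: "'v rpoly"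
proof (induction p rule: rpoly_induct)
  case (single m b)
  show ?case
    by (rule poly_mapping_eqI) (simp add: poly_const_mult_single lookup_scaleR lookup_single when_def)
qed (simp add: scaleR_add_right distrib_left)

lemma lookup_const_mult: "lookup (poly_const c * p) m = c * lookup p m"
  by (simp add: lookup_scaleR flip: scaleR_eq_const_mult)

lemma monom_eval_0 [simp]: "monom_eval s 0 = 1"
  by (simp add: monom_eval_def)

lemma monom_eval_single: "monom_eval s (single i n) = s i ^ n"
  by (cases "n = 0") (auto simp: monom_eval_def)

lemma monom_eval_superset:
  assumes "finite K" "keys m \<subseteq> K"
  shows "monom_eval s m = (\<Prod>i\<in>K. s i ^ lookup m i)"
  unfolding monom_eval_def
  by (rule prod.mono_neutral_left) (use assms in \<open>auto simp: in_keys_iff\<close>)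

lemma monom_eval_add: "monom_eval s (m + n) = monom_eval s m * monom_eval s n"
proof -
  let ?K = "keys m \<union> keys n"
  have "monom_eval s (m + n) = (\<Prod>i\<in>?K. s i ^ lookup (m + n) i)"
    by (rule monom_eval_superset) (auto dest: subsetD[OF keys_add])
  also have "\<dots> = (\<Prod>i\<in>?K. s i ^ lookup m i) * (\<Prod>i\<in>?K. s i ^ lookup n i)"
    by (simp add: lookup_add power_add prod.distrib)
  also have "\<dots> = monom_eval s m * monom_eval s n"
    by (simp add: monom_eval_superset[of ?K])
  finally show ?thesis .
qed

lemma single_eq_const_mult_monom: "single m c = poly_const c * monom_eval poly_var m" for c :: real
proof -
  have var_power: "poly_var i ^ n = single (single i n) (1::real)" for i :: 'b and n
    by (induction n) (auto simp: poly_var_def mult_single simp flip: single_add)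
  have "(\<Prod>i\<in>K. poly_var i ^ lookup m i) = single (\<Sum>i\<in>K. single i (lookup m i)) (1::real)" for K
    by (induction K rule: infinite_finite_induct) (auto simp: var_power mult_single)
  then show ?thesis
    by (simp add: monom_eval_def poly_const_mult_single sum_single_lookup)
qed

context
  fixes \<kappa> :: "real \<Rightarrow> 'b::comm_ring_1"
  assumes \<kappa>: "comm_ring_hom \<kappa>"
begin

interpretation \<kappa>: comm_ring_hom \<kappa>
  by (rule \<kappa>)

lemma poly_subst_add: "poly_subst \<kappa> s (p + q) = poly_subst \<kappa> s p + poly_subst \<kappa> s q"
  unfolding poly_subst_def
  by (rule setsum_keys_plus_distrib) (auto simp: \<kappa>.hom_add algebra_simps)

lemma poly_subst_single: "poly_subst \<kappa> s (single m c) = \<kappa> c * monom_eval s m"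
  by (cases "c = 0") (auto simp: poly_subst_def)

lemma poly_subst_mult: "poly_subst \<kappa> s (p * q) = poly_subst \<kappa> s p * poly_subst \<kappa> s q"
proof (induction p rule: rpoly_induct)
  case (single m c)
  show ?case
  proof (induction q rule: rpoly_induct)
    case (single n d)
    show ?case
      by (simp add: mult_single poly_subst_single monom_eval_add \<kappa>.hom_mult algebra_simps)
  qed (simp add: poly_subst_add algebra_simps)
qed (simp add: poly_subst_add algebra_simps)

lemma poly_subst_const: "poly_subst \<kappa> s (poly_const c) = \<kappa> c"
  by (simp add: poly_const_def poly_subst_single)

lemma poly_subst_var: "poly_subst \<kappa> s (poly_var i) = s i"
  by (simp add: poly_var_def poly_subst_single monom_eval_single)

lemma comm_ring_hom_poly_subst: "comm_ring_hom (poly_subst \<kappa> s)"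
proof -
  have "poly_subst \<kappa> s (poly_const 0) = 0" "poly_subst \<kappa> s (poly_const 1) = 1"
    by (simp_all only: poly_subst_const \<kappa>.hom_zero \<kappa>.hom_one)
  then show ?thesis
    by unfold_locales (auto simp: poly_subst_add poly_subst_mult)
qed

end

lemma poly_ring_const [simp]: "poly_const c \<in> poly_ring I"
  by (auto simp: poly_ring_def poly_const_def)

lemma poly_ring_var [simp]: "poly_var i \<in> poly_ring I \<longleftrightarrow> i \<in> I"
  by (auto simp: poly_ring_def poly_var_def)

lemma poly_ring_0 [simp]: "0 \<in> poly_ring I"
  and poly_ring_1 [simp]: "1 \<in> poly_ring I"
  and poly_ring_UNIV: "p \<in> poly_ring UNIV"
  by (auto simp: poly_ring_def)

lemma poly_ring_add: "p \<in> poly_ring I \<Longrightarrow> q \<in> poly_ring I \<Longrightarrow> p + q \<in> poly_ring I"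
  unfolding poly_ring_def using keys_add[of p q] by blast

lemma poly_ring_mult: "p \<in> poly_ring I \<Longrightarrow> q \<in> poly_ring I \<Longrightarrow> p * q \<in> poly_ring I"
  unfolding poly_ring_def using keys_mult[of p q] keys_add
  by (smt (verit, ccfv_threshold) Un_iff mem_Collect_eq subset_iff)

lemma poly_ring_sum: "(\<And>i. i \<in> K \<Longrightarrow> f i \<in> poly_ring I) \<Longrightarrow> sum f K \<in> poly_ring I"
  by (induction K rule: infinite_finite_induct) (auto intro: poly_ring_add)

lemma poly_ring_induct [consumes 1, case_names const var add mult]:
  assumes p: "p \<in> poly_ring I"
    and const: "\<And>c. P (poly_const c)" and var: "\<And>i. i \<in> I \<Longrightarrow> P (poly_var i)"
    and add: "\<And>p q. p \<in> poly_ring I \<Longrightarrow> q \<in> poly_ring I \<Longrightarrow> P p \<Longrightarrow> P q \<Longrightarrow> P (p + q)"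
    and mult: "\<And>p q. p \<in> poly_ring I \<Longrightarrow> q \<in> poly_ring I \<Longrightarrow> P p \<Longrightarrow> P q \<Longrightarrow> P (p * q)"
  shows "P p"
proof -
  define Q where "Q q \<longleftrightarrow> q \<in> poly_ring I \<and> P q" for q
  have Q_0: "Q 0" and Q_1: "Q 1"
    using const[of 0] const[of 1] by (auto simp: Q_def)
  have Q_add: "Q (q + r)" and Q_mult: "Q (q * r)" if "Q q" "Q r" for q r
    using that add mult by (auto simp: Q_def intro: poly_ring_add poly_ring_mult)
  have Q_sum: "Q (sum f K)" if "\<And>k. k \<in> K \<Longrightarrow> Q (f k)" for f :: "('a \<Rightarrow>\<^sub>0 nat) \<Rightarrow> _" and K
    using that by (induction K rule: infinite_finite_induct) (auto intro: Q_0 Q_add)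
  have Q_power: "Q (poly_var i ^ n)" if "i \<in> I" for i n
    using that var by (induction n) (auto intro: Q_1 Q_mult simp: Q_def[of "poly_var i"])
  have Q_prod: "Q (\<Prod>i\<in>K. poly_var i ^ lookup m i)" if "K \<subseteq> I" for K and m :: "'a \<Rightarrow>\<^sub>0 nat"
    using that by (induction K rule: infinite_finite_induct) (auto intro: Q_1 Q_mult Q_power)
  have "Q (poly_const c)" for c using const by (simp add: Q_def)
  then have "Q (single m c)" if "keys m \<subseteq> I" for m c
    unfolding single_eq_const_mult_monom monom_eval_def using that by (intro Q_mult Q_prod)
  then have "Q (\<Sum>m\<in>keys p. single m (lookup p m))"
    using p by (intro Q_sum) (auto simp: poly_ring_def)
  then show ?thesis by (simp add: sum_single_lookup Q_def)
qed

definition retract :: "'v set \<Rightarrow> 'v rpoly \<Rightarrow> 'v rpoly" where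
  "retract I = poly_subst poly_const (\<lambda>i. if i \<in> I then poly_var i else 0)"

interpretation retract: comm_ring_hom "retract I" for I
  unfolding retract_def by (rule comm_ring_hom_poly_subst[OF comm_ring_hom_poly_const])

lemma retract_const: "retract I (poly_const c) = poly_const c"
  and retract_var: "retract I (poly_var i) = (if i \<in> I then poly_var i else 0)"
  by (simp_all add: retract_def poly_subst_const[OF comm_ring_hom_poly_const]
      poly_subst_var[OF comm_ring_hom_poly_const])

lemma retract_in_poly_ring: "retract I p \<in> poly_ring I"
  using poly_ring_UNIV[of p]
  by (induction p rule: poly_ring_induct)
    (auto simp: retract_const retract_var retract.hom_add retract.hom_mult
        intro: poly_ring_add poly_ring_mult)

lemma retract_id: "p \<in> poly_ring I \<Longrightarrow> retract I p = p"
  by (induction p rule: poly_ring_induct)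
    (auto simp: retract_const retract_var retract.hom_add retract.hom_mult)

lemma dvd_in_poly_ring:
  assumes "p \<in> poly_ring I" "q \<in> poly_ring I" "p dvd q"
  shows "\<exists>r\<in>poly_ring I. q = p * r"
proof -
  obtain r where "q = p * r" using assms(3) by (elim dvdE)
  then have "q = p * retract I r"
    using retract_id[OF assms(1)] retract_id[OF assms(2)] by (metis retract.hom_mult)
  then show ?thesis using retract_in_poly_ring by blast
qed

definition point_eval :: "('v \<Rightarrow> real) \<Rightarrow> 'v rpoly \<Rightarrow> real" where
  "point_eval = poly_subst id"

lemma comm_ring_hom_id: "comm_ring_hom (id :: real \<Rightarrow> real)"
  by unfold_locales auto

interpretation point_eval: comm_ring_hom "point_eval x" for x
  unfolding point_eval_def by (rule comm_ring_hom_poly_subst[OF comm_ring_hom_id])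

lemma point_eval_const [simp]: "point_eval x (poly_const c) = c"
  and point_eval_var [simp]: "point_eval x (poly_var i) = x i"
  by (simp_all add: point_eval_def poly_subst_const[OF comm_ring_hom_id] poly_subst_var[OF comm_ring_hom_id])

lemma point_eval_of_int [simp]: "point_eval x (of_int c) = of_int c"
  by (metis poly_const_of_int point_eval_const)

section \<open>Homogeneous polynomials\<close>

definition homogeneous_in :: "'v set \<Rightarrow> nat \<Rightarrow> 'v rpoly \<Rightarrow> bool" where
  "homogeneous_in I d p \<longleftrightarrow> p \<in> poly_ring I \<and> homogeneous_poly d p"

definition scale2 :: "'v set \<Rightarrow> 'v rpoly \<Rightarrow> 'v rpoly" where
  "scale2 I = poly_subst poly_const (\<lambda>i. if i \<in> I then poly_const 2 * poly_var i else 0)"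

interpretation scale2: comm_ring_hom "scale2 I" for I
  unfolding scale2_def by (rule comm_ring_hom_poly_subst[OF comm_ring_hom_poly_const])

lemma scale2_single:
  "scale2 I (single m c) = (if keys m \<subseteq> I then poly_const (2 ^ (\<Sum>i\<in>keys m. lookup m i)) * single m c else 0)"
proof (cases "keys m \<subseteq> I")
  case True
  then have "monom_eval (\<lambda>i. if i \<in> I then poly_const 2 * poly_var i else 0) m
      = (\<Prod>i\<in>keys m. poly_const (2 ^ lookup m i) * (poly_var i :: 'a rpoly) ^ lookup m i)"
    unfolding monom_eval_def
    by (intro prod.cong) (auto simp: power_mult_distrib poly_const.hom_power)
  also have "\<dots> = poly_const (2 ^ (\<Sum>i\<in>keys m. lookup m i)) * monom_eval poly_var m"
    by (simp add: prod.distrib monom_eval_def power_sum poly_const.hom_prod)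
  finally show ?thesis
    using True unfolding scale2_def poly_subst_single[OF comm_ring_hom_poly_const]
    by (simp add: single_eq_const_mult_monom[of m] mult_ac)
next
  case False
  then obtain i where "i \<in> keys m" "i \<notin> I" by blast
  then have "monom_eval (\<lambda>i. if i \<in> I then poly_const 2 * poly_var i else (0::'a rpoly)) m = 0"
    unfolding monom_eval_def by (auto simp: in_keys_iff zero_power intro!: prod_zero bexI[of _ i])
  then show ?thesis
    using False by (simp add: scale2_def poly_subst_single[OF comm_ring_hom_poly_const])
qed

lemma lookup_scale2:
  "lookup (scale2 I p) m = (if keys m \<subseteq> I then 2 ^ (\<Sum>i\<in>keys m. lookup m i) else 0) * lookup p m"
proof (induction p rule: rpoly_induct)
  case (single n c)
  show ?case
    by (auto simp: scale2_single poly_const_mult_single lookup_single when_def)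
qed (simp add: scale2.hom_add lookup_add distrib_left)

text \<open>As an eigenvalue equation for a ring endomorphism, homogeneity can be cancelled from products.\<close>

lemma homogeneous_in_iff_scale2: "homogeneous_in I d p \<longleftrightarrow> scale2 I p = poly_const (2 ^ d) * p"
proof -
  have "scale2 I p = poly_const (2 ^ d) * p \<longleftrightarrow>
    (\<forall>m. (if keys m \<subseteq> I then 2 ^ (\<Sum>i\<in>keys m. lookup m i) else 0) * lookup p m = 2 ^ d * lookup p m)"
    by (auto simp: poly_mapping_eq_iff fun_eq_iff lookup_scale2 lookup_const_mult)
  also have "\<dots> \<longleftrightarrow> (\<forall>m\<in>keys p. keys m \<subseteq> I \<and> (\<Sum>i\<in>keys m. lookup m i) = d)"
    by (auto simp: in_keys_iff split: if_splits)
  finally show ?thesis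
    by (auto simp: homogeneous_in_def poly_ring_def homogeneous_poly_def)
qed

lemma homogeneous_in_0 [simp]: "homogeneous_in I d 0"
  by (simp add: homogeneous_in_iff_scale2)

lemma homogeneous_in_const [simp]: "homogeneous_in I 0 (poly_const c)"
  by (simp add: homogeneous_in_iff_scale2 scale2_def poly_subst_const[OF comm_ring_hom_poly_const])

lemma homogeneous_in_1 [simp]: "homogeneous_in I 0 1"
  using homogeneous_in_const[of I 1] by simp

lemma homogeneous_in_var: "i \<in> I \<Longrightarrow> homogeneous_in I 1 (poly_var i)"
  by (simp add: homogeneous_in_iff_scale2 scale2_def poly_subst_var[OF comm_ring_hom_poly_const])

lemma homogeneous_in_add: "homogeneous_in I d p \<Longrightarrow> homogeneous_in I d q \<Longrightarrow> homogeneous_in I d (p + q)"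
  by (simp add: homogeneous_in_iff_scale2 scale2.hom_add distrib_left)

lemma homogeneous_in_mult:
  "homogeneous_in I d p \<Longrightarrow> homogeneous_in I e q \<Longrightarrow> homogeneous_in I (d + e) (p * q)"
  by (simp add: homogeneous_in_iff_scale2 scale2.hom_mult power_add poly_const.hom_mult mult_ac)

lemma homogeneous_in_const_mult: "homogeneous_in I d p \<Longrightarrow> homogeneous_in I d (poly_const c * p)"
  using homogeneous_in_mult[OF homogeneous_in_const] by fastforce

lemma homogeneous_in_of_int_mult: "homogeneous_in I d p \<Longrightarrow> homogeneous_in I d (of_int c * p)"
  using homogeneous_in_const_mult[of I d p "of_int c"] by (simp add: poly_const_of_int)

lemma homogeneous_in_uminus: "homogeneous_in I d p \<Longrightarrow> homogeneous_in I d (- p)"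
  by (simp add: homogeneous_in_iff_scale2 scale2.hom_uminus)

lemma homogeneous_in_sum: "(\<And>i. i \<in> K \<Longrightarrow> homogeneous_in I d (f i)) \<Longrightarrow> homogeneous_in I d (sum f K)"
  by (induction K rule: infinite_finite_induct) (auto intro: homogeneous_in_add)

lemma homogeneous_in_prod:
  "finite K \<Longrightarrow> (\<And>i. i \<in> K \<Longrightarrow> homogeneous_in I (d i) (f i)) \<Longrightarrow> homogeneous_in I (sum d K) (prod f K)"
  by (induction K rule: finite_induct) (auto intro: homogeneous_in_mult)

lemma homogeneous_in_power: "homogeneous_in I d p \<Longrightarrow> homogeneous_in I (n * d) (p ^ n)"
  by (induction n) (auto intro: homogeneous_in_mult)

lemma homogeneous_in_cancel:
  fixes p :: "'v::linorder rpoly"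
  assumes "p \<noteq> 0" "homogeneous_in I d p" "homogeneous_in I (d + e) (p * q)"
  shows "homogeneous_in I e q"
proof -
  have "(poly_const (2 ^ d) * p) * scale2 I q = (poly_const (2 ^ d) * p) * (poly_const (2 ^ e) * q)"
    using assms(2,3)
    by (simp add: homogeneous_in_iff_scale2 scale2.hom_mult power_add poly_const.hom_mult mult_ac)
  then show ?thesis
    using assms(1) by (simp add: homogeneous_in_iff_scale2)
qed

lemma homogeneous_in_degree_0:
  assumes "homogeneous_in I 0 p"
  obtains c where "p = poly_const c"
proof -
  have "m = 0" if "m \<in> keys p" for m
    using assms that unfolding homogeneous_in_def homogeneous_poly_def
    by (metis finite_keys in_keys_iff poly_mapping_eqI lookup_zero sum_eq_0_iff)
  then have "p = poly_const (lookup p 0)"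
    by (intro poly_mapping_eqI) (auto simp: poly_const_def lookup_single when_def in_keys_iff)
  then show ?thesis using that by blast
qed

lemma homogeneous_in_det:
  fixes M :: "nat \<Rightarrow> nat \<Rightarrow> 'v rpoly"
  assumes "\<And>i j. i < n \<Longrightarrow> j < n \<Longrightarrow> homogeneous_in I (d i) (M i j)"
  shows "homogeneous_in I (\<Sum>i<n. d i) (det (mat n n (\<lambda>(i, j). M i j)))"
proof -
  have "homogeneous_in I (\<Sum>i = 0..<n. d i) (signof p * (\<Prod>i = 0..<n. mat n n (\<lambda>(i, j). M i j) $$ (i, p i)))"
    if "p permutes {0..<n}" for p
  proof -
    have "p i < n" if "i < n" for i
      using permutes_in_image[OF \<open>p permutes {0..<n}\<close>, of i] that by simp
    then have "homogeneous_in I (\<Sum>i = 0..<n. d i) (\<Prod>i = 0..<n. mat n n (\<lambda>(i, j). M i j) $$ (i, p i))"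
      using assms by (intro homogeneous_in_prod) auto
    then show ?thesis by (rule homogeneous_in_of_int_mult)
  qed
  then show ?thesis
    unfolding lessThan_atLeast0 by (subst det_def') (auto intro: homogeneous_in_sum)
qed

section \<open>Linear forms\<close>

lemma rspace_iff: "x \<in> rspace I \<longleftrightarrow> (\<forall>i. i \<notin> I \<longrightarrow> lookup x i = 0)"
  by (auto simp: rspace_def in_keys_iff)

lemma lookup_rspace_0: "x \<in> rspace I \<Longrightarrow> i \<notin> I \<Longrightarrow> lookup x i = 0"
  by (simp add: rspace_iff)

lemma subspace_rspace: "subspace (rspace I)"
  by (simp add: subspace_def rspace_iff lookup_add lookup_scaleR)

lemmas rspace_add = subspace_add[OF subspace_rspace]
  and rspace_diff = subspace_diff[OF subspace_rspace]
  and rspace_scaleR = subspace_scale[OF subspace_rspace]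

lemma nonzero_rspaceE:
  assumes "a \<in> rspace I" "a \<noteq> 0"
  obtains j where "j \<in> I" "lookup a j \<noteq> 0"
  using assms by (metis poly_mapping_eqI lookup_zero lookup_rspace_0)

lemma linear_form_eq: "linear_form I a = (\<Sum>i\<in>I. poly_const (lookup a i) * poly_var i)"
  by (simp add: linear_form_def scaleR_eq_const_mult)

lemma homogeneous_in_linear_form: "homogeneous_in I 1 (linear_form I a)"
  unfolding linear_form_eq
  by (intro homogeneous_in_sum homogeneous_in_const_mult homogeneous_in_var)

lemma linear_form_in_poly_ring [simp]: "linear_form I a \<in> poly_ring I"
  using homogeneous_in_linear_form unfolding homogeneous_in_def by blast

lemma linear_form_add: "linear_form I (a + b) = linear_form I a + linear_form I b"
  by (simp add: linear_form_eq lookup_add poly_const.hom_add distrib_right sum.distrib)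

lemma linear_form_scaleR: "linear_form I (c *\<^sub>R a) = poly_const c * linear_form I a"
  by (simp add: linear_form_eq lookup_scaleR poly_const.hom_mult sum_distrib_left mult.assoc)

lemma linear_form_single:
  assumes "finite I" "i \<in> I"
  shows "linear_form I (single i c) = poly_const c * poly_var i"
proof -
  have "linear_form I (single i c) = (\<Sum>k\<in>I. if k = i then poly_const c * poly_var i else 0)"
    unfolding linear_form_eq by (intro sum.cong) (auto simp: lookup_single when_def)
  then show ?thesis using assms by simp
qed

lemma lookup_linear_form:
  assumes "finite I" "i \<in> I"
  shows "lookup (linear_form I a) (single i 1) = lookup a i"
proof -
  have "single j (1::nat) = single i 1 \<longleftrightarrow> j = i" for j
    by (metis lookup_single_eq lookup_single_not_eq zero_neq_one)
  then have "lookup (poly_const c * poly_var j) (single i 1) = (if j = i then c else 0)" for j c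
    by (simp add: lookup_const_mult poly_var_def lookup_single when_def)
  then show ?thesis
    using assms by (simp add: linear_form_eq lookup_sum)
qed

lemma linear_form_eq_0_iff:
  assumes "finite I" "a \<in> rspace I"
  shows "linear_form I a = 0 \<longleftrightarrow> a = 0"
proof
  assume "linear_form I a = 0"
  then have "lookup a i = 0" if "i \<in> I" for i
    using lookup_linear_form[OF assms(1) that, of a] by simp
  then show "a = 0" using assms(2) by (auto elim: nonzero_rspaceE)
qed (simp add: linear_form_eq)

definition eliminate :: "'v set \<Rightarrow> ('v \<Rightarrow>\<^sub>0 real) \<Rightarrow> 'v \<Rightarrow> 'v rpoly \<Rightarrow> 'v rpoly" where
  "eliminate I a j = poly_subst poly_const (\<lambda>i. if i = j
     then poly_var j - poly_const (1 / lookup a j) * linear_form I a else poly_var i)"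

interpretation eliminate: comm_ring_hom "eliminate I a j" for I a j
  unfolding eliminate_def by (rule comm_ring_hom_poly_subst[OF comm_ring_hom_poly_const])

lemma eliminate_const: "eliminate I a j (poly_const c) = poly_const c"
  and eliminate_var: "eliminate I a j (poly_var i) = (if i = j
     then poly_var j - poly_const (1 / lookup a j) * linear_form I a else poly_var i)"
  by (simp_all add: eliminate_def poly_subst_const[OF comm_ring_hom_poly_const]
      poly_subst_var[OF comm_ring_hom_poly_const])

lemma linear_form_dvd_diff_eliminate: "linear_form I a dvd f - eliminate I a j f"
  using poly_ring_UNIV[of f]
proof (induction f rule: poly_ring_induct)
  case (add p q)
  then have "linear_form I a dvd (p - eliminate I a j p) + (q - eliminate I a j q)"
    by (intro dvd_add)
  then show ?case by (simp add: eliminate.hom_add algebra_simps)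
next
  case (mult p q)
  then have "linear_form I a dvd (p - eliminate I a j p) * q + eliminate I a j p * (q - eliminate I a j q)"
    by (intro dvd_add) auto
  then show ?case by (simp add: eliminate.hom_mult algebra_simps)
qed (simp_all add: eliminate_const eliminate_var)

lemma eliminate_linear_form_without:
  assumes "lookup b j = 0"
  shows "eliminate I a j (linear_form I b) = linear_form I b"
proof -
  have "poly_const (lookup b i) * eliminate I a j (poly_var i) = poly_const (lookup b i) * poly_var i" for i
    using assms by (simp add: eliminate_var)
  then show ?thesis
    by (simp add: linear_form_eq eliminate.hom_sum eliminate.hom_mult eliminate_const)
qed

context
  fixes I :: "'v set" and a :: "'v \<Rightarrow>\<^sub>0 real" and j :: 'v
  assumes finite_I: "finite I" and a: "a \<in> rspace I" and a_j: "lookup a j \<noteq> 0"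
begin

lemma eliminate_linear_form: 
  "eliminate I a j (linear_form I b)
      = linear_form I b - poly_const (lookup b j / lookup a j) * linear_form I a"
proof -
  define b' where "b' = b + single j (- lookup b j)"
  have "b = b' + single j (lookup b j)"
    unfolding b'_def by (simp add: single_uminus)
  moreover have "j \<in> I"
    using a a_j lookup_rspace_0 by metis
  ultimately have split: "linear_form I b = linear_form I b' + poly_const (lookup b j) * poly_var j"
    using finite_I by (metis linear_form_add linear_form_single)
  have "eliminate I a j (linear_form I b') = linear_form I b'"
    by (rule eliminate_linear_form_without) (simp add: b'_def lookup_add)
  then have "eliminate I a j (linear_form I b)
      = linear_form I b - (poly_const (lookup b j) * poly_const (1 / lookup a j)) * linear_form I a"
    unfolding split
    by (simp add: eliminate.hom_add eliminate.hom_mult eliminate_const eliminate_var algebra_simps)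
  then show ?thesis
    by (simp flip: poly_const.hom_mult)
qed

lemma linear_form_dvd_iff_eliminate: "linear_form I a dvd f \<longleftrightarrow> eliminate I a j f = 0"
proof
  assume "linear_form I a dvd f"
  then obtain q where "f = linear_form I a * q" by (elim dvdE)
  then show "eliminate I a j f = 0"
    using a_j by (simp add: eliminate.hom_mult eliminate_linear_form)
next
  assume "eliminate I a j f = 0"
  then show "linear_form I a dvd f"
    using linear_form_dvd_diff_eliminate[of I a f j] by simp
qed

lemma linear_form_dvd_linear_form:
  assumes b: "b \<in> rspace I" and dvd: "linear_form I a dvd linear_form I b"
  shows "b = (lookup b j / lookup a j) *\<^sub>R a"
proof -
  let ?c = "- (lookup b j / lookup a j)"
  have "linear_form I (b + ?c *\<^sub>R a) = eliminate I a j (linear_form I b)"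
    unfolding eliminate_linear_form linear_form_add linear_form_scaleR by (simp add: poly_const.hom_uminus)
  also have "\<dots> = 0"
    using dvd linear_form_dvd_iff_eliminate by blast
  finally have "b + ?c *\<^sub>R a = 0"
    using linear_form_eq_0_iff[OF finite_I rspace_add[OF b rspace_scaleR[OF a]]] by blast
  then show ?thesis by simp
qed

end

lemma prime_elem_linear_form:
  fixes a :: "'v::linorder \<Rightarrow>\<^sub>0 real"
  assumes "finite I" "a \<in> rspace I" "a \<noteq> 0"
  shows "prime_elem (linear_form I a)"
proof -
  obtain j where "lookup a j \<noteq> 0"
    using assms(2,3) by (elim nonzero_rspaceE)
  note dvd_iff = linear_form_dvd_iff_eliminate[OF assms(1,2) this]
  show ?thesis
    using assms by (auto simp: prime_elem_def linear_form_eq_0_iff dvd_iff eliminate.hom_mult)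
qed

lemma prime_elem_dvd_prodD:
  fixes p :: "'a::comm_semiring_1"
  assumes "prime_elem p" "p dvd prod f F"
  shows "\<exists>a\<in>F. p dvd f a"
  using assms
  by (induction F rule: infinite_finite_induct) (auto simp: prime_elem_def)

lemma prod_prime_elems_dvd:
  fixes f :: "'b \<Rightarrow> 'a::comm_semiring_1"
  assumes "finite F" and prime: "\<And>a. a \<in> F \<Longrightarrow> prime_elem (f a)"
    and not_dvd: "\<And>a b. a \<in> F \<Longrightarrow> b \<in> F \<Longrightarrow> f a dvd f b \<Longrightarrow> a = b"
    and dvd: "\<And>a. a \<in> F \<Longrightarrow> f a dvd x"
  shows "prod f F dvd x"
  using assms
proof (induction F rule: finite_induct)
  case (insert a F)
  then obtain y where y: "x = prod f F * y" by auto
  have "\<not> f a dvd prod f F"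
    using prime_elem_dvd_prodD[of "f a" f F] insert.prems(1)[of a] insert.prems(2)[of a] insert.hyps
    by auto
  then have "f a dvd y"
    using insert.prems(1)[of a] insert.prems(3)[of a] y by (auto simp: prime_elem_def)
  then show ?case
    using insert.hyps by (simp add: y mult.commute mult_dvd_mono)
qed simp

lemma prod_linear_forms_dvd:
  fixes f :: "'v::linorder rpoly"
  assumes "finite I" "finite F" "F \<subseteq> rspace I - {0}"
    and nonproportional: "\<And>a b c. a \<in> F \<Longrightarrow> b \<in> F \<Longrightarrow> b = c *\<^sub>R a \<Longrightarrow> a = b"
    and dvd: "\<And>a. a \<in> F \<Longrightarrow> linear_form I a dvd f"
  shows "(\<Prod>a\<in>F. linear_form I a) dvd f"
proof (rule prod_prime_elems_dvd[OF \<open>finite F\<close> _ _ dvd])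
  have normal: "a \<in> rspace I" "a \<noteq> 0" if "a \<in> F" for a
    using assms(3) that by auto
  show "prime_elem (linear_form I a)" if "a \<in> F" for a
    by (rule prime_elem_linear_form[OF assms(1) normal[OF that]])
  fix a b assume ab: "a \<in> F" "b \<in> F" "linear_form I a dvd linear_form I b"
  obtain j where "lookup a j \<noteq> 0"
    using normal[OF ab(1)] by (elim nonzero_rspaceE)
  then show "a = b"
    using ab normal linear_form_dvd_linear_form[OF assms(1)] by (blast intro: nonproportional)
qed

section \<open>Derivations\<close>

lemma derivation_mult:
  "\<theta> \<in> derivations I \<Longrightarrow> p \<in> poly_ring I \<Longrightarrow> q \<in> poly_ring I \<Longrightarrow> \<theta> (p * q) = \<theta> p * q + p * \<theta> q"
  and derivation_add:
  "\<theta> \<in> derivations I \<Longrightarrow> p \<in> poly_ring I \<Longrightarrow> q \<in> poly_ring I \<Longrightarrow> \<theta> (p + q) = \<theta> p + \<theta> q"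
  and derivation_closed:
  "\<theta> \<in> derivations I \<Longrightarrow> p \<in> poly_ring I \<Longrightarrow> \<theta> p \<in> poly_ring I"
  and derivation_outside:
  "\<theta> \<in> derivations I \<Longrightarrow> p \<notin> poly_ring I \<Longrightarrow> \<theta> p = 0"
  unfolding derivations_def by blast+

lemma derivation_const:
  assumes "\<theta> \<in> derivations I"
  shows "\<theta> (poly_const c) = 0"
proof -
  have "\<theta> (1 * 1) = \<theta> 1 * 1 + 1 * \<theta> 1"
    using assms poly_ring_1 by (rule derivation_mult) simp
  then have "\<theta> 1 = 0" by simp
  moreover have "\<theta> (c *\<^sub>R 1) = c *\<^sub>R \<theta> 1"
    using assms poly_ring_1 unfolding derivations_def by blast
  ultimately show ?thesis by (simp add: scaleR_eq_const_mult)
qed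

lemma derivation_const_mult:
  "\<theta> \<in> derivations I \<Longrightarrow> p \<in> poly_ring I \<Longrightarrow> \<theta> (poly_const c * p) = poly_const c * \<theta> p"
  by (simp add: derivation_mult derivation_const)

lemma derivation_eqI:
  assumes "\<theta> \<in> derivations I" "\<eta> \<in> derivations I" "\<And>i. i \<in> I \<Longrightarrow> \<theta> (poly_var i) = \<eta> (poly_var i)"
  shows "\<theta> = \<eta>"
proof
  fix p
  show "\<theta> p = \<eta> p"
  proof (cases "p \<in> poly_ring I")
    case True
    then show ?thesis
      by (induction p rule: poly_ring_induct)
        (use assms in \<open>auto simp: derivation_const derivation_add derivation_mult\<close>)
  qed (use assms in \<open>simp add: derivation_outside\<close>)
qed

lemma derivation_linear_form:
  assumes \<theta>: "\<theta> \<in> derivations I"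
  shows "\<theta> (linear_form I a) = (\<Sum>i\<in>I. poly_const (lookup a i) * \<theta> (poly_var i))"
proof -
  have "\<theta> (\<Sum>i\<in>K. poly_const (lookup a i) * poly_var i)
      = (\<Sum>i\<in>K. poly_const (lookup a i) * \<theta> (poly_var i))" if "K \<subseteq> I" for K
    using that
  proof (induction K rule: infinite_finite_induct)
    case (insert i K)
    moreover have "(\<Sum>i\<in>K. poly_const (lookup a i) * poly_var i) \<in> poly_ring I"
      using insert by (intro poly_ring_sum poly_ring_mult) auto
    ultimately show ?case
      using \<theta> by (simp add: derivation_add derivation_const_mult poly_ring_mult)
  qed (use derivation_const[OF \<theta>, of 0] in auto)
  then show ?thesis by (simp add: linear_form_eq)
qed

lemma derivations_0: "(\<lambda>p. 0) \<in> derivations I"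
  by (simp add: derivations_def)

lemma derivations_add:
  "\<theta> \<in> derivations I \<Longrightarrow> \<eta> \<in> derivations I \<Longrightarrow> (\<lambda>p. \<theta> p + \<eta> p) \<in> derivations I"
  by (simp add: derivations_def poly_ring_add algebra_simps)

lemma derivations_mult:
  assumes "f \<in> poly_ring I" "\<theta> \<in> derivations I"
  shows "(\<lambda>p. f * \<theta> p) \<in> derivations I"
proof -
  have "f * (c *\<^sub>R q) = c *\<^sub>R (f * q)" for c q
    by (simp add: scaleR_eq_const_mult mult.left_commute)
  then show ?thesis
    using assms by (simp add: derivations_def poly_ring_mult algebra_simps)
qed

lemma derivations_combination:
  assumes "\<And>j. j \<in> K \<Longrightarrow> f j \<in> poly_ring I" "\<And>j. j \<in> K \<Longrightarrow> \<theta> j \<in> derivations I"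
  shows "(\<lambda>p. \<Sum>j\<in>K. f j * \<theta> j p) \<in> derivations I"
  using assms
proof (induction K rule: infinite_finite_induct)
  case (insert k K)
  then have "(\<lambda>p. f k * \<theta> k p + (\<Sum>j\<in>K. f j * \<theta> j p)) \<in> derivations I"
    by (intro derivations_add derivations_mult) auto
  then show ?case using insert.hyps by simp
qed (simp_all add: derivations_0)

text \<open>The derivation with prescribed values \<open>g\<close> on the variables is the \<open>\<epsilon>\<close>-coefficient of the
  homomorphism into dual numbers sending \<open>x\<^sub>i\<close> to \<open>x\<^sub>i + \<epsilon> g\<^sub>i\<close>.\<close>

definition der_of :: "'v set \<Rightarrow> ('v \<Rightarrow> 'v rpoly) \<Rightarrow> 'v rpoly \<Rightarrow> 'v rpoly" where
  "der_of I g p = (if p \<in> poly_ring I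
     then coeff (poly_subst (\<lambda>c. [:poly_const c:]) (\<lambda>i. [:poly_var i, g i:]) p) 1 else 0)"

context
  fixes I :: "'v set" and g :: "'v \<Rightarrow> 'v rpoly"
begin

private abbreviation "dual \<equiv> poly_subst (\<lambda>c. [:poly_const c:]) (\<lambda>i. [:poly_var i, g i:])"

private lemma comm_ring_hom_pconst: "comm_ring_hom (\<lambda>c. [:poly_const c:])"
  by unfold_locales (auto simp: poly_const.hom_add poly_const.hom_mult one_pCons)

private lemma dual_const: "dual (poly_const c) = [:poly_const c:]"
  and dual_var: "dual (poly_var i) = [:poly_var i, g i:]"
  and dual_add: "dual (p + q) = dual p + dual q"
  and dual_mult: "dual (p * q) = dual p * dual q"
  by (simp_all add: poly_subst_const[OF comm_ring_hom_pconst] poly_subst_var[OF comm_ring_hom_pconst]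
      poly_subst_add[OF comm_ring_hom_pconst] poly_subst_mult[OF comm_ring_hom_pconst])

private lemma coeff_dual_0: "coeff (dual p) 0 = p"
  using poly_ring_UNIV[of p]
  by (induction p rule: poly_ring_induct)
    (simp_all add: dual_const dual_var dual_add dual_mult coeff_mult_0)

private lemma coeff_dual_mult:
  "coeff (dual (p * q)) 1 = coeff (dual p) 1 * q + p * coeff (dual q) 1"
  by (simp add: dual_mult coeff_mult coeff_dual_0)

lemma der_of_var: "i \<in> I \<Longrightarrow> der_of I g (poly_var i) = g i"
  by (simp add: der_of_def dual_var)

lemma der_of_derivation:
  assumes "\<And>i. i \<in> I \<Longrightarrow> g i \<in> poly_ring I"
  shows "der_of I g \<in> derivations I"
proof -
  have "coeff (dual p) 1 \<in> poly_ring I" if "p \<in> poly_ring I" for p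
    using that
  proof (induction p rule: poly_ring_induct)
    case (add p q)
    then show ?case by (simp add: dual_add poly_ring_add)
  next
    case (mult p q)
    then show ?case unfolding coeff_dual_mult by (intro poly_ring_add poly_ring_mult)
  qed (auto simp: dual_const dual_var assms)
  moreover have "coeff (dual (c *\<^sub>R p)) 1 = c *\<^sub>R coeff (dual p) 1" for c p
    unfolding scaleR_eq_const_mult coeff_dual_mult by (simp add: dual_const)
  ultimately show ?thesis
    unfolding derivations_def mem_Collect_eq
    by (intro conjI ballI allI impI)
      (simp_all add: der_of_def poly_ring_add poly_ring_mult coeff_dual_mult[unfolded One_nat_def] dual_add
        scaleR_eq_const_mult)
qed

end

section \<open>Saito's criterion\<close>

lemma sum_det_replace_row:
  fixes M :: "nat \<Rightarrow> nat \<Rightarrow> 'a::comm_ring_1"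
  assumes c: "c < n"
  shows "(\<Sum>r<n. det (mat n n (\<lambda>(i, j). if i = r then v j else M i j)) * M r c)
    = det (mat n n (\<lambda>(i, j). M i j)) * v c"
proof -
  let ?M = "mat n n (\<lambda>(i, j). M i j)"
  let ?N = "\<lambda>r. mat n n (\<lambda>(i, j). if i = r then v j else M i j)"
  have expand: "det (?N r) = (\<Sum>j<n. v j * cofactor ?M r j)" if r: "r < n" for r
  proof -
    have "mat_delete (?N r) r j = mat_delete ?M r j" for j
      unfolding mat_delete_def using r by (intro eq_matI) auto
    then show ?thesis
      using r laplace_expansion_row[of "?N r" n r] by (simp add: cofactor_def)
  qed
  have cofactors: "(\<Sum>r<n. cofactor ?M r j * M r c) = (if j = c then det ?M else 0)" if j: "j < n" for j
  proof -
    have "(adj_mat ?M * ?M) $$ (j, c) = (\<Sum>r<n. cofactor ?M r j * M r c)"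
      using j c by (simp add: adj_mat_def scalar_prod_def lessThan_atLeast0)
    then show ?thesis
      using adj_mat(3)[of ?M n] j c by (auto simp: mult.commute)
  qed
  have "(\<Sum>r<n. det (?N r) * M r c) = (\<Sum>r<n. \<Sum>j<n. v j * (cofactor ?M r j * M r c))"
    by (intro sum.cong) (auto simp: expand sum_distrib_right mult.assoc)
  also have "\<dots> = (\<Sum>j<n. \<Sum>r<n. v j * (cofactor ?M r j * M r c))"
    by (rule sum.swap)
  also have "\<dots> = (\<Sum>j<n. v j * (if j = c then det ?M else 0))"
    by (intro sum.cong) (auto simp: cofactors simp flip: sum_distrib_left)
  also have "\<dots> = v c * det ?M"
    using c by (simp add: if_distrib cong: if_cong)
  finally show ?thesis by (simp add: mult.commute)
qed

lemma det_eq_0_iff_dependent_rows: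
  fixes M :: "nat \<Rightarrow> nat \<Rightarrow> 'a::idom"
  shows "det (mat n n (\<lambda>(i, j). M i j)) = 0 \<longleftrightarrow>
    (\<exists>w. (\<forall>c<n. (\<Sum>r<n. w r * M r c) = 0) \<and> (\<exists>r<n. w r \<noteq> 0))"
proof -
  let ?M = "mat n n (\<lambda>(i, j). M i j)"
  have kernel_iff: "transpose_mat ?M *\<^sub>v w = 0\<^sub>v n \<longleftrightarrow> (\<forall>c<n. (\<Sum>r<n. vec_index w r * M r c) = 0)"
    if "dim_vec w = n" for w
  proof -
    have "vec_index (transpose_mat ?M *\<^sub>v w) c = (\<Sum>r<n. vec_index w r * M r c)" if "c < n" for c
      using that \<open>dim_vec w = n\<close> by (simp add: scalar_prod_def lessThan_atLeast0 mult.commute)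
    then show ?thesis by (auto simp: vec_eq_iff simp del: index_mult_mat_vec)
  qed
  have "det ?M = 0 \<longleftrightarrow> det (transpose_mat ?M) = 0"
    by (subst Determinant.det_transpose[of _ n]) auto
  also have "\<dots> \<longleftrightarrow> (\<exists>w. w \<in> carrier_vec n \<and> w \<noteq> 0\<^sub>v n \<and> transpose_mat ?M *\<^sub>v w = 0\<^sub>v n)"
    by (rule det_0_iff_vec_prod_zero) simp
  also have "\<dots> \<longleftrightarrow> (\<exists>w. (\<forall>c<n. (\<Sum>r<n. w r * M r c) = 0) \<and> (\<exists>r<n. w r \<noteq> 0))"
  proof safe
    fix w assume w: "w \<in> carrier_vec n" "w \<noteq> 0\<^sub>v n" "transpose_mat ?M *\<^sub>v w = 0\<^sub>v n"
    then have "\<exists>r<n. vec_index w r \<noteq> 0" by (metis carrier_vecD eq_vecI index_zero_vec)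
    then show "\<exists>w. (\<forall>c<n. (\<Sum>r<n. w r * M r c) = 0) \<and> (\<exists>r<n. w r \<noteq> 0)"
      using w kernel_iff by (intro exI[of _ "\<lambda>r. vec_index w r"]) auto
  next
    fix w r assume w: "\<forall>c<n. (\<Sum>r<n. w r * M r c) = 0" "r < n" "w r \<noteq> 0"
    then have "vec n w \<noteq> 0\<^sub>v n" by (metis index_vec index_zero_vec(1))
    then show "\<exists>w. w \<in> carrier_vec n \<and> w \<noteq> 0\<^sub>v n \<and> transpose_mat ?M *\<^sub>v w = 0\<^sub>v n"
      using w kernel_iff by (intro exI[of _ "vec n w"]) auto
  qed
  finally show ?thesis .
qed

lemma hyperplane_eq_imp_proportional:
  fixes a b :: "'v \<Rightarrow>\<^sub>0 real"
  assumes "finite I" and a: "a \<in> rspace I" "a \<noteq> 0" and b: "b \<in> rspace I" "b \<noteq> 0"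
    and eq: "hyperplane I a c = hyperplane I b d"
  obtains r where "r \<noteq> 0" "a = r *\<^sub>R b" "c = r * d"
proof -
  obtain j where j: "j \<in> I" "lookup b j \<noteq> 0"
    using b by (rule nonzero_rspaceE)
  have sum_single: "(\<Sum>i\<in>I. lookup v i * lookup (single k s) i) = lookup v k * s"
      if "k \<in> I" for v :: "'v \<Rightarrow>\<^sub>0 real" and k s
  proof -
    have "lookup v i * lookup (single k s) i = (if k = i then lookup v k * s else 0)" for i
      by (simp add: lookup_single when_def)
    then show ?thesis using \<open>finite I\<close> that by simp
  qed
  have mem: "single j s + single k t \<in> hyperplane I v e \<longleftrightarrow> lookup v j * s + lookup v k * t = e"
    if "k \<in> I" for v :: "'v \<Rightarrow>\<^sub>0 real" and k s t e
  proof -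
    have "single j s + single k t \<in> rspace I"
      using that j by (auto simp: rspace_iff lookup_add lookup_single when_def)
    then show ?thesis
      using sum_single[OF j(1)] sum_single[OF that]
      by (simp add: hyperplane_def lookup_add distrib_left sum.distrib)
  qed
  define r where "r = lookup a j / lookup b j"
  have "single j (d / lookup b j) + single j 0 \<in> hyperplane I b d"
    unfolding mem[OF j(1)] using j by simp
  then have c: "c = r * d"
    unfolding eq[symmetric] mem[OF j(1)] using j by (simp add: r_def)
  have "lookup a k = r * lookup b k" for k
  proof (cases "k \<in> I")
    case True
    have "single j ((d - lookup b k) / lookup b j) + single k 1 \<in> hyperplane I b d"
      unfolding mem[OF True] using j by simp
    then have "lookup a j * ((d - lookup b k) / lookup b j) + lookup a k = r * d"
      unfolding eq[symmetric] mem[OF True] c by simp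
    then show ?thesis using j by (simp add: r_def field_simps)
  next
    case False
    then show ?thesis using a(1) b(1) by (simp add: lookup_rspace_0)
  qed
  then have "a = r *\<^sub>R b" by (intro poly_mapping_eqI) (simp add: lookup_scaleR)
  moreover from this have "r \<noteq> 0" using a(2) by auto
  ultimately show ?thesis using c that by blast
qed

definition coefficient_mat :: "(nat \<Rightarrow> 'v) \<Rightarrow> nat \<Rightarrow> (nat \<Rightarrow> 'v rpoly \<Rightarrow> 'v rpoly) \<Rightarrow> 'v rpoly mat" where
  "coefficient_mat e n \<theta> = mat n n (\<lambda>(i, j). \<theta> i (poly_var (e j)))"

locale normal_vectors =
  fixes A :: "'v::linorder arrangement" and N :: "('v \<Rightarrow>\<^sub>0 real) set"
  assumes finite_coords: "finite (coords A)" and finite_normals: "finite N"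
    and normals: "N \<subseteq> ambient A - {0}"
    and nonproportional: "\<And>a b c. a \<in> N \<Longrightarrow> b \<in> N \<Longrightarrow> b = c *\<^sub>R a \<Longrightarrow> a = b"
    and hyps_eq: "hyps A = (\<lambda>a. hyperplane (coords A) a 0) ` N"
begin

lemma central: "central A"
  by (auto simp: central_def hyps_eq hyperplane_def rspace_iff)

lemma normalD:
  assumes "a \<in> N"
  shows "a \<in> ambient A" "a \<noteq> 0" "hyperplane (coords A) a 0 \<in> hyps A"
  using assms normals hyps_eq by auto

lemma log_derivations_iff:
  "\<theta> \<in> log_derivations A \<longleftrightarrow> \<theta> \<in> derivations (coords A) \<and>
    (\<forall>a\<in>N. linear_form (coords A) a dvd \<theta> (linear_form (coords A) a))" (is "_ \<longleftrightarrow> ?der \<and> ?dvd")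
proof
  assume \<theta>: "\<theta> \<in> log_derivations A"
  have "linear_form (coords A) a dvd \<theta> (linear_form (coords A) a)" if "a \<in> N" for a
    using \<theta> normalD[OF that] unfolding log_derivations_def by (blast intro: dvdI)
  then show "?der \<and> ?dvd" using \<theta> by (simp add: log_derivations_def)
next
  assume \<theta>: "?der \<and> ?dvd"
  have "\<exists>q\<in>poly_ring (coords A). \<theta> (linear_form (coords A) a) = linear_form (coords A) a * q"
    if a: "a \<in> ambient A" "a \<noteq> 0" "hyperplane (coords A) a 0 \<in> hyps A" for a
  proof (rule dvd_in_poly_ring)
    obtain b where b: "b \<in> N" "hyperplane (coords A) a 0 = hyperplane (coords A) b 0"
      using a(3) by (auto simp: hyps_eq)
    obtain r where "a = r *\<^sub>R b"
      using hyperplane_eq_imp_proportional[OF finite_coords a(1,2) normalD(1,2)[OF b(1)] b(2)] .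
    then show "linear_form (coords A) a dvd \<theta> (linear_form (coords A) a)"
      using \<theta> b(1) derivation_const_mult[of \<theta> "coords A"]
      by (simp add: linear_form_scaleR mult_dvd_mono)
  qed (use \<theta> in \<open>auto intro: derivation_closed\<close>)
  then show "\<theta> \<in> log_derivations A"
    using \<theta> by (simp add: log_derivations_def)
qed

lemma log_derivation_derivation: "\<theta> \<in> log_derivations A \<Longrightarrow> \<theta> \<in> derivations (coords A)"
  by (simp add: log_derivations_iff)

definition defining_poly :: "'v rpoly" where
  "defining_poly = (\<Prod>a\<in>N. linear_form (coords A) a)"

lemma defining_poly_nonzero: "defining_poly \<noteq> 0"
  using finite_coords finite_normals normalD by (simp add: defining_poly_def linear_form_eq_0_iff)

lemma homogeneous_in_defining_poly: "homogeneous_in (coords A) (card N) defining_poly"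
proof -
  have "homogeneous_in (coords A) (\<Sum>a\<in>N. 1) defining_poly"
    unfolding defining_poly_def
    by (intro homogeneous_in_prod finite_normals homogeneous_in_linear_form)
  then show ?thesis by simp
qed

context
  fixes e :: "nat \<Rightarrow> 'v" and n :: nat
  assumes e: "bij_betw e {..<n} (coords A)"
begin

lemma e_in_coords: "j < n \<Longrightarrow> e j \<in> coords A"
  using e by (auto simp: bij_betw_def)

lemma coordE:
  assumes "i \<in> coords A"
  obtains j where "j < n" "i = e j"
  using assms e by (auto simp: bij_betw_def)

lemma defining_poly_dvd_det:
  assumes \<theta>: "\<And>i. i < n \<Longrightarrow> \<theta> i \<in> log_derivations A"
  shows "defining_poly dvd det (coefficient_mat e n \<theta>)"
  unfolding defining_poly_def
proof (rule prod_linear_forms_dvd[OF finite_coords finite_normals normals nonproportional])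
  fix a assume a: "a \<in> N"
  then obtain k where k: "k \<in> coords A" "lookup a k \<noteq> 0"
    using normalD by (metis nonzero_rspaceE)
  define \<sigma> where "\<sigma> = eliminate (coords A) a k"
  have dvd_iff: "linear_form (coords A) a dvd f \<longleftrightarrow> \<sigma> f = 0" for f
    unfolding \<sigma>_def using finite_coords normalD(1)[OF a] k(2) by (rule linear_form_dvd_iff_eliminate)
  let ?M = "map_mat \<sigma> (coefficient_mat e n \<theta>)"
  let ?v = "vec n (\<lambda>j. poly_const (lookup a (e j))) :: 'v rpoly Matrix.vec"
  have "?M *\<^sub>v ?v = 0\<^sub>v n"
  proof (rule eq_vecI)
    fix i assume "i < dim_vec (0\<^sub>v n :: 'v rpoly Matrix.vec)"
    then have i: "i < n" by simp
    have "vec_index (?M *\<^sub>v ?v) i = (\<Sum>j<n. \<sigma> (\<theta> i (poly_var (e j))) * poly_const (lookup a (e j)))"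
      using i by (simp add: scalar_prod_def lessThan_atLeast0 coefficient_mat_def)
    also have "\<dots> = \<sigma> (\<Sum>j<n. poly_const (lookup a (e j)) * \<theta> i (poly_var (e j)))"
      by (simp add: \<sigma>_def eliminate.hom_sum eliminate.hom_mult eliminate_const mult.commute)
    also have "(\<Sum>j<n. poly_const (lookup a (e j)) * \<theta> i (poly_var (e j)))
        = (\<Sum>x\<in>coords A. poly_const (lookup a x) * \<theta> i (poly_var x))"
      by (rule sum.reindex_bij_betw[OF e])
    also have "\<dots> = \<theta> i (linear_form (coords A) a)"
      using derivation_linear_form[OF log_derivation_derivation[OF \<theta>[OF i]]] by simp
    also have "\<sigma> \<dots> = 0"
      using \<theta>[OF i] a unfolding log_derivations_iff dvd_iff[symmetric] by blast
    finally show "vec_index (?M *\<^sub>v ?v) i = vec_index (0\<^sub>v n) i" using i by simp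
  qed (simp add: coefficient_mat_def)
  moreover have "?v \<noteq> 0\<^sub>v n"
  proof -
    obtain j where "j < n" "k = e j" using k(1) by (rule coordE)
    then show ?thesis using k(2) by (metis index_vec index_zero_vec(1) poly_const_eq_0_iff)
  qed
  ultimately have "det ?M = 0"
    using det_0_iff_vec_prod_zero[of ?M n] by (auto simp: coefficient_mat_def intro!: exI[of _ ?v])
  then show "linear_form (coords A) a dvd det (coefficient_mat e n \<theta>)"
    by (simp add: dvd_iff \<sigma>_def)
qed

lemma det_coefficient_mat_eq:
  assumes \<theta>: "\<And>i. i < n \<Longrightarrow> \<theta> i \<in> log_derivations A"
    and homogeneous: "\<And>i. i < n \<Longrightarrow> homogeneous_der (coords A) (d i) (\<theta> i)"
    and degree_sum: "(\<Sum>i<n. d i) = card N"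
    and nonzero: "det (coefficient_mat e n \<theta>) \<noteq> 0"
  obtains \<gamma> where "\<gamma> \<noteq> 0" "det (coefficient_mat e n \<theta>) = poly_const \<gamma> * defining_poly"
proof -
  obtain g where g: "det (coefficient_mat e n \<theta>) = defining_poly * g"
    using defining_poly_dvd_det[of \<theta>] \<theta> by auto
  have "homogeneous_in (coords A) (d i) (\<theta> i (poly_var (e j)))" if "i < n" "j < n" for i j
    using homogeneous[OF that(1)] e_in_coords[OF that(2)]
      derivation_closed[OF log_derivation_derivation[OF \<theta>[OF that(1)]], of "poly_var (e j)"]
    by (simp add: homogeneous_in_def homogeneous_der_def)
  then have "homogeneous_in (coords A) (\<Sum>i<n. d i) (det (coefficient_mat e n \<theta>))"
    unfolding coefficient_mat_def by (rule homogeneous_in_det)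
  then have "homogeneous_in (coords A) (card N + 0) (defining_poly * g)"
    by (simp add: g degree_sum)
  then have "homogeneous_in (coords A) 0 g"
    by (rule homogeneous_in_cancel[OF defining_poly_nonzero homogeneous_in_defining_poly])
  then obtain \<gamma> where "g = poly_const \<gamma>" by (rule homogeneous_in_degree_0)
  then show ?thesis
    using that[of \<gamma>] nonzero g by (auto simp: mult.commute)
qed

context
  fixes \<theta> :: "nat \<Rightarrow> 'v rpoly \<Rightarrow> 'v rpoly" and \<gamma> :: real
  assumes \<theta>: "\<And>i. i < n \<Longrightarrow> \<theta> i \<in> log_derivations A"
    and \<gamma>: "\<gamma> \<noteq> 0" and det_eq: "det (coefficient_mat e n \<theta>) = poly_const \<gamma> * defining_poly"
begin

text \<open>Cramer's rule: the determinants in which \<open>\<eta>\<close> replaces one of the \<open>\<theta>\<^sub>i\<close> are divisible by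
  the defining polynomial.\<close>

lemma log_derivation_combination:
  assumes \<eta>: "\<eta> \<in> log_derivations A"
  obtains f where "\<And>i. f i \<in> poly_ring (coords A)" "\<eta> = (\<lambda>p. \<Sum>i<n. f i * \<theta> i p)"
proof -
  let ?I = "coords A"
  have "defining_poly dvd det (mat n n (\<lambda>(i, j). if i = r then \<eta> (poly_var (e j)) else \<theta> i (poly_var (e j))))"
      for r
  proof -
    have "coefficient_mat e n (\<lambda>i. if i = r then \<eta> else \<theta> i)
        = mat n n (\<lambda>(i, j). if i = r then \<eta> (poly_var (e j)) else \<theta> i (poly_var (e j)))"
      by (auto simp: coefficient_mat_def intro!: eq_matI)
    then show ?thesis
      using defining_poly_dvd_det[of "\<lambda>i. if i = r then \<eta> else \<theta> i"] \<theta> \<eta> by auto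
  qed
  then obtain u where u:
      "\<And>r. det (mat n n (\<lambda>(i, j). if i = r then \<eta> (poly_var (e j)) else \<theta> i (poly_var (e j))))
      = defining_poly * u r"
    unfolding dvd_def by metis
  define f where "f r = retract ?I (poly_const (1 / \<gamma>) * u r)" for r
  have f: "f r \<in> poly_ring ?I" for r
    unfolding f_def by (rule retract_in_poly_ring)
  have "\<eta> (poly_var (e c)) = (\<Sum>r<n. f r * \<theta> r (poly_var (e c)))" if c: "c < n" for c
  proof -
    have "defining_poly * (\<Sum>r<n. u r * \<theta> r (poly_var (e c)))
        = defining_poly * (poly_const \<gamma> * \<eta> (poly_var (e c)))"
      using sum_det_replace_row[OF c, of "\<lambda>j. \<eta> (poly_var (e j))" "\<lambda>i j. \<theta> i (poly_var (e j))"] det_eq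
      by (simp add: u coefficient_mat_def sum_distrib_left mult_ac)
    then have "poly_const \<gamma> * \<eta> (poly_var (e c)) = (\<Sum>r<n. u r * \<theta> r (poly_var (e c)))"
      using defining_poly_nonzero by simp
    then have "poly_const (1 / \<gamma>) * (poly_const \<gamma> * \<eta> (poly_var (e c)))
        = (\<Sum>r<n. (poly_const (1 / \<gamma>) * u r) * \<theta> r (poly_var (e c)))"
      by (simp add: sum_distrib_left mult.assoc)
    then have "retract ?I (\<eta> (poly_var (e c))) = (\<Sum>r<n. f r * retract ?I (\<theta> r (poly_var (e c))))"
      using \<gamma> unfolding mult.assoc[symmetric] poly_const.hom_mult[symmetric]
      by (simp add: retract.hom_sum f_def flip: retract.hom_mult)
    then show ?thesis
      using c \<eta> \<theta> e_in_coords by (simp add: retract_id derivation_closed log_derivation_derivation)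
  qed
  then have "\<eta> (poly_var i) = (\<Sum>r<n. f r * \<theta> r (poly_var i))" if "i \<in> ?I" for i
    using that by (auto elim: coordE)
  then have "\<eta> = (\<lambda>p. \<Sum>r<n. f r * \<theta> r p)"
    using f \<theta> \<eta> by (intro derivation_eqI[OF _ derivations_combination]) (auto simp: log_derivation_derivation)
  then show ?thesis using f that by blast
qed

lemma combination_eqD:
  assumes "(\<lambda>p. \<Sum>r<n. f r * \<theta> r p) = (\<lambda>p. \<Sum>r<n. g r * \<theta> r p)" "r < n"
  shows "f r = g r"
proof -
  have "(\<Sum>r<n. (f r - g r) * \<theta> r (poly_var (e c))) = 0" for c
    using fun_cong[OF assms(1), of "poly_var (e c)"] by (simp add: left_diff_distrib sum_subtractf)
  moreover have "det (mat n n (\<lambda>(i, j). \<theta> i (poly_var (e j)))) \<noteq> 0"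
    using det_eq \<gamma> defining_poly_nonzero by (simp add: coefficient_mat_def)
  ultimately have "f r - g r = 0"
    using assms(2) unfolding det_eq_0_iff_dependent_rows
    by (auto dest!: spec[of _ "\<lambda>r. f r - g r"])
  then show ?thesis by simp
qed

lemma log_basis: "log_basis A (map \<theta> [0..<n])"
  unfolding log_basis_def
proof (intro conjI ballI)
  show "set (map \<theta> [0..<n]) \<subseteq> log_derivations A"
    using \<theta> by auto
  have nth: "(\<Sum>j<length (map \<theta> [0..<n]). f ! j * (map \<theta> [0..<n] ! j) p) = (\<Sum>j<n. f ! j * \<theta> j p)" for f p
    by simp
  fix \<eta> assume "\<eta> \<in> log_derivations A"
  then obtain f where f: "\<And>i. f i \<in> poly_ring (coords A)" "\<eta> = (\<lambda>p. \<Sum>i<n. f i * \<theta> i p)"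
    using log_derivation_combination by blast
  show "\<exists>!fs. length fs = length (map \<theta> [0..<n]) \<and> set fs \<subseteq> poly_ring (coords A)
      \<and> \<eta> = (\<lambda>p. \<Sum>j<length (map \<theta> [0..<n]). fs ! j * (map \<theta> [0..<n] ! j) p)"
    unfolding nth
  proof (rule ex1I[of _ "map f [0..<n]"])
    show "length (map f [0..<n]) = length (map \<theta> [0..<n]) \<and> set (map f [0..<n]) \<subseteq> poly_ring (coords A)
      \<and> \<eta> = (\<lambda>p. \<Sum>j<n. map f [0..<n] ! j * \<theta> j p)"
      using f by auto
    fix fs assume fs: "length fs = length (map \<theta> [0..<n]) \<and> set fs \<subseteq> poly_ring (coords A)
      \<and> \<eta> = (\<lambda>p. \<Sum>j<n. fs ! j * \<theta> j p)"
    then have "fs ! r = f r" if "r < n" for r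
      using f(2) combination_eqD[OF _ that, of "\<lambda>r. fs ! r" f] by blast
    then show "fs = map f [0..<n]"
      using fs by (intro nth_equalityI) simp_all
  qed
qed

end

lemma det_coefficient_mat_nonzero:
  assumes independent: "\<And>w. (\<And>i. i \<in> coords A \<Longrightarrow> (\<Sum>r<n. w r * point_eval x (\<theta> r (poly_var i))) = 0)
      \<Longrightarrow> \<forall>r<n. w r = 0"
  shows "det (coefficient_mat e n \<theta>) \<noteq> 0"
proof
  assume "det (coefficient_mat e n \<theta>) = 0"
  then have "det (map_mat (point_eval x) (coefficient_mat e n \<theta>)) = 0"
    by simp
  also have "map_mat (point_eval x) (coefficient_mat e n \<theta>)
      = mat n n (\<lambda>(i, j). point_eval x (\<theta> i (poly_var (e j))))"
    unfolding coefficient_mat_def by (rule eq_matI) auto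
  finally obtain w where w: "\<forall>c<n. (\<Sum>r<n. w r * point_eval x (\<theta> r (poly_var (e c)))) = 0" "\<exists>r<n. w r \<noteq> 0"
    unfolding det_eq_0_iff_dependent_rows by blast
  have "(\<Sum>r<n. w r * point_eval x (\<theta> r (poly_var i))) = 0" if "i \<in> coords A" for i
    using that w(1) by (auto elim: coordE)
  then show False using independent w(2) by blast
qed

end

theorem saito_criterion:
  fixes \<theta> :: "'i \<Rightarrow> 'v rpoly \<Rightarrow> 'v rpoly"
  assumes "finite R" "card R = card (coords A)"
    and \<theta>: "\<And>r. r \<in> R \<Longrightarrow> \<theta> r \<in> log_derivations A"
    and homogeneous: "\<And>r. r \<in> R \<Longrightarrow> homogeneous_der (coords A) (d r) (\<theta> r)"
    and degree_sum: "(\<Sum>r\<in>R. d r) = card N"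
    and independent: "\<And>w. (\<And>i. i \<in> coords A \<Longrightarrow> (\<Sum>r\<in>R. w r * point_eval x (\<theta> r (poly_var i))) = 0)
      \<Longrightarrow> \<forall>r\<in>R. w r = 0"
  shows "free_with_exponents A (image_mset d (mset_set R))"
proof -
  define n where "n = card (coords A)"
  obtain e where e: "bij_betw e {..<n} (coords A)"
    using ex_bij_betw_nat_finite[OF finite_coords] by (auto simp: n_def lessThan_atLeast0)
  obtain b where b: "bij_betw b {..<n} R"
    using ex_bij_betw_nat_finite[OF \<open>finite R\<close>] assms(2) by (auto simp: n_def lessThan_atLeast0)
  then have bR: "b i \<in> R" if "i < n" for i
    using that by (auto simp: bij_betw_def)
  have "det (coefficient_mat e n (\<lambda>i. \<theta> (b i))) \<noteq> 0"
  proof (rule det_coefficient_mat_nonzero[OF e])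
    fix w :: "nat \<Rightarrow> real"
    assume w: "\<And>i. i \<in> coords A \<Longrightarrow> (\<Sum>r<n. w r * point_eval x (\<theta> (b r) (poly_var i))) = 0"
    let ?w = "\<lambda>r. w (the_inv_into {..<n} b r)"
    have inv: "the_inv_into {..<n} b (b r) = r" if "r < n" for r
      using b that by (simp add: bij_betw_def the_inv_into_f_f)
    have "(\<Sum>r\<in>R. ?w r * point_eval x (\<theta> r (poly_var i))) = 0" if "i \<in> coords A" for i
      using w[OF that] inv by (simp flip: sum.reindex_bij_betw[OF b])
    then have "\<forall>r\<in>R. ?w r = 0" by (rule independent)
    then show "\<forall>r<n. w r = 0" using inv bR by metis
  qed
  moreover have "(\<Sum>i<n. d (b i)) = card N"
    using degree_sum by (simp add: sum.reindex_bij_betw[OF b])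
  ultimately obtain \<gamma> where \<gamma>: "\<gamma> \<noteq> 0"
      "det (coefficient_mat e n (\<lambda>i. \<theta> (b i))) = poly_const \<gamma> * defining_poly"
    using det_coefficient_mat_eq[OF e, of "\<lambda>i. \<theta> (b i)" "\<lambda>i. d (b i)"] \<theta> homogeneous bR by blast
  have "log_basis A (map (\<lambda>i. \<theta> (b i)) [0..<n])"
    using \<theta> bR \<gamma> by (intro log_basis[OF e]) auto
  moreover have
      "list_all2 (homogeneous_der (coords A)) (map (\<lambda>i. d (b i)) [0..<n]) (map (\<lambda>i. \<theta> (b i)) [0..<n])"
    using homogeneous bR by (auto simp: list_all2_conv_all_nth)
  moreover have "mset (map (\<lambda>i. d (b i)) [0..<n]) = image_mset d (mset_set R)"
  proof -
    have "mset (map (\<lambda>i. d (b i)) [0..<n]) = image_mset d (image_mset b (mset_set {..<n}))"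
      by (simp add: lessThan_atLeast0 multiset.map_comp comp_def)
    also have "image_mset b (mset_set {..<n}) = mset_set R"
      using b by (simp add: bij_betw_def image_mset_mset_set)
    finally show ?thesis .
  qed
  ultimately show ?thesis
    using central unfolding free_with_exponents_def by blast
qed

end

section \<open>Discrete antiderivatives\<close>

definition poly_homogeneous :: "'v set \<Rightarrow> nat \<Rightarrow> 'v rpoly poly \<Rightarrow> bool" where
  "poly_homogeneous I d P \<longleftrightarrow> degree P \<le> d \<and> (\<forall>n. homogeneous_in I (d - n) (coeff P n))"

lemma poly_homogeneousD:
  assumes "poly_homogeneous I d P"
  shows "degree P \<le> d" "homogeneous_in I (d - n) (coeff P n)"
  using assms by (auto simp: poly_homogeneous_def)

lemma homogeneous_in_poly:
  assumes P: "poly_homogeneous I d P" and x: "homogeneous_in I 1 x"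
  shows "homogeneous_in I d (poly P x)"
  unfolding poly_altdef
proof (rule homogeneous_in_sum)
  fix n assume "n \<in> {..degree P}"
  then have "d - n + n * 1 = d" using poly_homogeneousD(1)[OF P] by simp
  then show "homogeneous_in I d (coeff P n * x ^ n)"
    using homogeneous_in_mult[OF poly_homogeneousD(2)[OF P, of n] homogeneous_in_power[OF x, of n]] by simp
qed

lemma poly_homogeneous_0: "poly_homogeneous I d 0"
  and poly_homogeneous_1: "poly_homogeneous I 0 1"
  by (simp_all add: poly_homogeneous_def coeff_eq_0)

lemma poly_homogeneous_monom: "poly_homogeneous I n (monom 1 n)"
  by (auto simp: poly_homogeneous_def degree_monom_le)

lemma poly_homogeneous_linear:
  assumes "homogeneous_in I 1 a"
  shows "poly_homogeneous I 1 [:- a, 1:]"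
  using assms
  by (auto simp: poly_homogeneous_def coeff_pCons intro: homogeneous_in_uminus split: nat.splits)

lemma poly_homogeneous_add:
  "poly_homogeneous I d P \<Longrightarrow> poly_homogeneous I d Q \<Longrightarrow> poly_homogeneous I d (P + Q)"
  by (auto simp: poly_homogeneous_def intro: degree_add_le homogeneous_in_add)

lemma poly_homogeneous_uminus: "poly_homogeneous I d P \<Longrightarrow> poly_homogeneous I d (- P)"
  by (auto simp: poly_homogeneous_def intro: homogeneous_in_uminus)

lemma poly_homogeneous_sum:
  "(\<And>i. i \<in> K \<Longrightarrow> poly_homogeneous I d (f i)) \<Longrightarrow> poly_homogeneous I d (sum f K)"
  by (induction K rule: infinite_finite_induct) (auto intro: poly_homogeneous_add poly_homogeneous_0)

lemma poly_homogeneous_mult: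
  assumes P: "poly_homogeneous I d P" and Q: "poly_homogeneous I e Q"
  shows "poly_homogeneous I (d + e) (P * Q)"
  unfolding poly_homogeneous_def
proof (intro conjI allI)
  show "degree (P * Q) \<le> d + e"
    using degree_mult_le[of P Q] poly_homogeneousD(1)[OF P] poly_homogeneousD(1)[OF Q] by linarith
  fix n
  show "homogeneous_in I (d + e - n) (coeff (P * Q) n)"
    unfolding coeff_mult
  proof (rule homogeneous_in_sum)
    fix i assume "i \<in> {..n}"
    then consider (within) "d - i + (e - (n - i)) = d + e - n" | (left) "d < i" | (right) "e < n - i"
      by fastforce
    then show "homogeneous_in I (d + e - n) (coeff P i * coeff Q (n - i))"
    proof cases
      case within
      then show ?thesis
        using homogeneous_in_mult[OF poly_homogeneousD(2)[OF P, of i] poly_homogeneousD(2)[OF Q, of "n - i"]]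
        by simp
    next
      case left
      then have "coeff P i = 0" using poly_homogeneousD(1)[OF P] by (intro coeff_eq_0) simp
      then show ?thesis by simp
    next
      case right
      then have "coeff Q (n - i) = 0" using poly_homogeneousD(1)[OF Q] by (intro coeff_eq_0) simp
      then show ?thesis by simp
    qed
  qed
qed

lemma poly_homogeneous_prod:
  "finite K \<Longrightarrow> (\<And>i. i \<in> K \<Longrightarrow> poly_homogeneous I (d i) (f i)) \<Longrightarrow> poly_homogeneous I (sum d K) (prod f K)"
  by (induction K rule: finite_induct) (auto intro: poly_homogeneous_mult poly_homogeneous_1)

lemma poly_homogeneous_smult:
  assumes "homogeneous_in I k c" "poly_homogeneous I d P"
  shows "poly_homogeneous I (k + d) (smult c P)"
proof -
  have "poly_homogeneous I k [:c:]"
    using assms(1) by (auto simp: poly_homogeneous_def coeff_pCons split: nat.splits)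
  then show ?thesis
    using poly_homogeneous_mult[OF _ assms(2)] by fastforce
qed

lemma binomial_difference:
  fixes x z :: "'a::comm_ring_1"
  shows "(x + z) ^ Suc n - x ^ Suc n
    = (\<Sum>i<n. of_nat (Suc n choose i) * z ^ (n - i) * (z * x ^ i)) + of_nat (Suc n) * (z * x ^ n)"
proof -
  have "(x + z) ^ Suc n = (\<Sum>i\<le>Suc n. of_nat (Suc n choose i) * x ^ i * z ^ (Suc n - i))"
    by (rule binomial_ring)
  also have "\<dots>
      = (\<Sum>i<n. of_nat (Suc n choose i) * x ^ i * z ^ (Suc n - i)) + of_nat (Suc n) * (z * x ^ n) + x ^ Suc n"
    unfolding lessThan_Suc_atMost[symmetric] sum.lessThan_Suc by (simp add: mult_ac)
  also have "(\<Sum>i<n. of_nat (Suc n choose i) * x ^ i * z ^ (Suc n - i))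
      = (\<Sum>i<n. of_nat (Suc n choose i) * z ^ (n - i) * (z * x ^ i))"
    by (intro sum.cong refl) (simp add: Suc_diff_le mult_ac)
  finally show ?thesis by simp
qed

text \<open>The Bernoulli polynomials \<open>z\<^bsup>n+1\<^esup> (B\<^bsub>n+1\<^esub>(t/z) - B\<^bsub>n+1\<^esub>) / (n+1)\<close>.\<close>

fun power_antidifference :: "'v rpoly \<Rightarrow> nat \<Rightarrow> 'v rpoly poly" where
  "power_antidifference z n = smult (poly_const (1 / of_nat (Suc n)))
     (monom 1 (Suc n) - (\<Sum>i<n. smult (of_nat (Suc n choose i) * z ^ (n - i)) (power_antidifference z i)))"

declare power_antidifference.simps [simp del]

lemma poly_power_antidifference_shift:
  "poly (power_antidifference z n) (x + z) - poly (power_antidifference z n) x = z * x ^ n"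
proof (induction n rule: less_induct)
  case (less n)
  let ?k = "poly_const (1 / of_nat (Suc n))"
  have "poly (power_antidifference z n) (x + z) - poly (power_antidifference z n) x
      = ?k * ((x + z) ^ Suc n - x ^ Suc n - (\<Sum>i<n. of_nat (Suc n choose i) * z ^ (n - i)
          * (poly (power_antidifference z i) (x + z) - poly (power_antidifference z i) x)))"
    unfolding power_antidifference.simps[of z n]
    by (simp add: poly_monom poly_sum right_diff_distrib sum_subtractf del: power_Suc binomial_Suc_Suc of_nat_Suc)
  also have "\<dots>
      = ?k * ((x + z) ^ Suc n - x ^ Suc n - (\<Sum>i<n. of_nat (Suc n choose i) * z ^ (n - i) * (z * x ^ i)))"
    using less.IH by (simp del: power_Suc binomial_Suc_Suc of_nat_Suc)
  also have "\<dots> = (?k * of_nat (Suc n)) * (z * x ^ n)"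
    unfolding binomial_difference by (simp only: add_diff_cancel_left' mult.assoc)
  also have "?k * of_nat (Suc n) = poly_const (1 / of_nat (Suc n) * of_nat (Suc n))"
    by (simp only: poly_const_of_nat poly_const.hom_mult)
  finally show ?case by simp
qed

lemma poly_power_antidifference_0: "poly (power_antidifference z n) 0 = 0"
proof (induction n rule: less_induct)
  case (less n)
  then show ?case
    unfolding power_antidifference.simps[of z n] by (simp add: poly_monom poly_sum)
qed

lemma poly_homogeneous_power_antidifference:
  assumes z: "homogeneous_in I 1 z"
  shows "poly_homogeneous I (Suc n) (power_antidifference z n)"
proof (induction n rule: less_induct)
  case (less n)
  have "poly_homogeneous I (Suc n)
    (smult (of_nat (Suc n choose i) * z ^ (n - i)) (power_antidifference z i))" if i: "i < n" for i
  proof -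
    have "homogeneous_in I (n - i) (poly_const (of_nat (Suc n choose i)) * z ^ (n - i))"
      using homogeneous_in_const_mult[OF homogeneous_in_power[OF z, of "n - i"]] by simp
    then show ?thesis
      using poly_homogeneous_smult[OF _ less.IH[OF i]] i by (fastforce simp: poly_const_of_nat)
  qed
  then have "poly_homogeneous I (Suc n)
      (monom 1 (Suc n) + - (\<Sum>i<n. smult (of_nat (Suc n choose i) * z ^ (n - i)) (power_antidifference z i)))"
    by (intro poly_homogeneous_add poly_homogeneous_monom poly_homogeneous_uminus poly_homogeneous_sum) simp
  then show ?case
    unfolding power_antidifference.simps[of z n] using poly_homogeneous_smult[OF homogeneous_in_const]
    by fastforce
qed

definition antidifference :: "'v rpoly \<Rightarrow> 'v rpoly poly \<Rightarrow> 'v rpoly poly" where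
  "antidifference z h = (\<Sum>n\<le>degree h. smult (coeff h n) (power_antidifference z n))"

lemma poly_antidifference_shift:
  "poly (antidifference z h) (x + z) - poly (antidifference z h) x = z * poly h x"
proof -
  have "poly (antidifference z h) (x + z) - poly (antidifference z h) x
      = (\<Sum>n\<le>degree h. coeff h n * (poly (power_antidifference z n) (x + z) - poly (power_antidifference z n) x))"
    by (simp add: antidifference_def poly_sum right_diff_distrib sum_subtractf)
  also have "\<dots> = z * poly h x"
    by (simp add: poly_power_antidifference_shift poly_altdef[of h] sum_distrib_left mult_ac)
  finally show ?thesis .
qed

lemma poly_antidifference_0: "poly (antidifference z h) 0 = 0"
  by (simp add: antidifference_def poly_sum poly_power_antidifference_0)

lemma poly_homogeneous_antidifference:
  assumes z: "homogeneous_in I 1 z" and h: "poly_homogeneous I d h"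
  shows "poly_homogeneous I (Suc d) (antidifference z h)"
  unfolding antidifference_def
proof (rule poly_homogeneous_sum)
  fix n assume "n \<in> {..degree h}"
  then have "d - n + Suc n = Suc d" using poly_homogeneousD(1)[OF h] by simp
  then show "poly_homogeneous I (Suc d) (smult (coeff h n) (power_antidifference z n))"
    using poly_homogeneous_smult[OF poly_homogeneousD(2)[OF h, of n] poly_homogeneous_power_antidifference[OF z, of n]]
    by simp
qed

section \<open>Arrangements of integral gain graphs and their cones\<close>

text \<open>A triple \<open>(i, j, c)\<close> stands for the hyperplane \<open>x\<^sub>i - x\<^sub>j = c\<close>. The index \<open>0\<close> is never a
  coordinate, so \<open>x\<^sub>0 = 0\<close> and the hyperplane \<open>x\<^sub>i = c\<close> is given by \<open>(i, 0, c)\<close>.\<close>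

definition gain_hyp :: "nat set \<Rightarrow> nat \<times> nat \<times> int \<Rightarrow> (nat \<Rightarrow>\<^sub>0 real) set" where
  "gain_hyp I = (\<lambda>(i, j, c). {x \<in> rspace I. lookup x i - lookup x j = of_int c})"

definition gain_arr :: "nat set \<Rightarrow> (nat \<times> nat \<times> int) set \<Rightarrow> nat arrangement" where
  "gain_arr I T = \<lparr> coords = I, hyps = gain_hyp I ` T \<rparr>"

definition cone_hyp :: "nat set \<Rightarrow> nat \<times> nat \<times> int \<Rightarrow> (nat option \<Rightarrow>\<^sub>0 real) set" where
  "cone_hyp I = (\<lambda>(i, j, c). {y \<in> rspace (cone_coords I).
     lookup y (Some i) - lookup y (Some j) = of_int c * lookup y None})"

definition infinity_hyp :: "nat set \<Rightarrow> (nat option \<Rightarrow>\<^sub>0 real) set" where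
  "infinity_hyp I = {y \<in> rspace (cone_coords I). lookup y None = 0}"

definition gain_vec :: "nat \<Rightarrow> nat \<Rightarrow> nat \<Rightarrow>\<^sub>0 real" where
  "gain_vec i j = single i 1 - (if j = 0 then 0 else single j 1)"

definition cone_vec :: "nat \<times> nat \<times> int \<Rightarrow> nat option \<Rightarrow>\<^sub>0 real" where
  "cone_vec = (\<lambda>(i, j, c). single (Some i) 1
      - (if j = 0 then 0 else single (Some j) 1) - single None (of_int c))"

lemma coords_gain_arr [simp]: "coords (gain_arr I T) = I"
  and hyps_gain_arr [simp]: "hyps (gain_arr I T) = gain_hyp I ` T"
  by (simp_all add: gain_arr_def)

lemma lookup_gain_vec:
  "lookup (gain_vec i j) k = of_bool (k = i) - of_bool (k = j \<and> j \<noteq> 0)"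
  by (auto simp: gain_vec_def lookup_minus lookup_single when_def)

lemma lookup_cone_vec_Some [simp]: "lookup (cone_vec (i, j, c)) (Some k) = lookup (gain_vec i j) k"
  and lookup_cone_vec_None [simp]: "lookup (cone_vec (i, j, c)) None = - of_int c"
  by (auto simp: cone_vec_def gain_vec_def lookup_minus lookup_single when_def)

lemma finite_cone_coords [simp]: "finite (cone_coords I) \<longleftrightarrow> finite I"
  by (auto simp: cone_coords_def dest: finite_imageD)

lemma Some_in_cone_coords [simp]: "Some i \<in> cone_coords I \<longleftrightarrow> i \<in> I"
  and None_in_cone_coords [simp]: "None \<in> cone_coords I"
  by (auto simp: cone_coords_def)

lemma card_cone_coords: "finite I \<Longrightarrow> card (cone_coords I) = Suc (card I)"
  unfolding cone_coords_def by (subst card_insert_disjoint) (auto simp: card_image)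

lemma sum_cone_coords: "finite I \<Longrightarrow> (\<Sum>v\<in>cone_coords I. f v) = f None + (\<Sum>i\<in>I. f (Some i))"
  unfolding cone_coords_def by (subst sum.insert) (auto simp: sum.reindex)

lemma image_mset_case_option_cone_coords:
  assumes "finite I"
  shows "image_mset (case_option x f) (mset_set (cone_coords I)) = add_mset x (image_mset f (mset_set I))"
proof -
  have "mset_set (cone_coords I) = add_mset None (image_mset Some (mset_set I))"
    using assms by (simp add: cone_coords_def image_mset_mset_set)
  then show ?thesis by (simp add: multiset.map_comp comp_def)
qed

lemma ball_cone_coords: "(\<forall>v\<in>cone_coords I. Q v) \<longleftrightarrow> Q None \<and> (\<forall>i\<in>I. Q (Some i))"
  by (auto simp: cone_coords_def)

locale gain_graph =
  fixes I :: "nat set" and T :: "(nat \<times> nat \<times> int) set"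
  assumes finite_vertices: "finite I" and finite_gains: "finite T" and ground_notin: "0 \<notin> I"
    and gain_ends: "(i, j, c) \<in> T \<Longrightarrow> i \<in> I \<and> j \<in> insert 0 I \<and> i \<noteq> j"
    and gain_not_reversed: "(i, j, c) \<in> T \<Longrightarrow> (j, i, - c) \<notin> T"
begin

lemma gain_source_nonzero: "(i, j, c) \<in> T \<Longrightarrow> i \<noteq> 0"
  using gain_ends ground_notin by metis

lemma sum_gain_vec:
  assumes "comm_ring_hom h" and t: "(i, j, c) \<in> T"
  shows "(\<Sum>k\<in>I. h (lookup (gain_vec i j) k) * f k) = f i - (if j = 0 then 0 else f j)"
proof -
  interpret comm_ring_hom h by fact
  have "(\<Sum>k\<in>I. h (lookup (gain_vec i j) k) * f k)
      = (\<Sum>k\<in>I. (if k = i then f k else 0) - (if k = j then f k else 0))"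
    using ground_notin by (intro sum.cong refl) (auto simp: lookup_gain_vec hom_minus hom_uminus)
  then show ?thesis
    using gain_ends[OF t] finite_vertices ground_notin by (auto simp: sum_subtractf)
qed

lemma sum_gain_vec_lookup:
  assumes "(i, j, c) \<in> T" "f 0 = 0"
  shows "(\<Sum>k\<in>I. lookup (gain_vec i j) k * f k) = f i - f j"
  using sum_gain_vec[OF comm_ring_hom_id assms(1), of f] assms(2) by simp

lemma gain_vec_rspace:
  assumes "(i, j, c) \<in> T"
  shows "gain_vec i j \<in> rspace I - {0}"
proof -
  have "lookup (gain_vec i j) i \<noteq> 0"
    using gain_ends[OF assms] by (simp add: lookup_gain_vec)
  moreover have "gain_vec i j \<in> rspace I"
    using gain_ends[OF assms] by (auto simp: rspace_iff lookup_gain_vec)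
  ultimately show ?thesis by auto
qed

lemma gain_hyp_eq:
  assumes "(i, j, c) \<in> T"
  shows "gain_hyp I (i, j, c) = hyperplane I (gain_vec i j) (of_int c)"
  using sum_gain_vec_lookup[OF assms] ground_notin by (auto simp: gain_hyp_def hyperplane_def lookup_rspace_0)

lemma cone_hyp_eq:
  assumes "(i, j, c) \<in> T"
  shows "cone_hyp I (i, j, c) = hyperplane (cone_coords I) (cone_vec (i, j, c)) 0"
proof -
  have "(\<Sum>v\<in>cone_coords I. lookup (cone_vec (i, j, c)) v * lookup y v)
      = lookup y (Some i) - lookup y (Some j) - of_int c * lookup y None"
    if "y \<in> rspace (cone_coords I)" for y
    using sum_gain_vec_lookup[OF assms, of "\<lambda>k. lookup y (Some k)"] that finite_vertices ground_notin
    by (simp add: sum_cone_coords lookup_rspace_0)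
  then show ?thesis by (auto simp: cone_hyp_def hyperplane_def)
qed

lemma infinity_hyp_eq: "infinity_hyp I = hyperplane (cone_coords I) (single None 1) 0"
  using finite_vertices by (auto simp: infinity_hyp_def hyperplane_def sum_cone_coords lookup_single)

lemma hyps_cone: "hyps (arr_cone (gain_arr I T)) = insert (infinity_hyp I) (cone_hyp I ` T)"
proof -
  define homogenize where "homogenize a c = {y \<in> rspace (cone_coords I).
    (\<Sum>k\<in>I. lookup a k * lookup y (Some k)) = c * lookup y None}" for a c
  have homogenize_gain: "homogenize (gain_vec i j) (of_int c) = cone_hyp I (i, j, c)"
    if "(i, j, c) \<in> T" for i j c
    using sum_gain_vec_lookup[OF that, of "\<lambda>k. lookup y (Some k)" for y] ground_notin
    by (auto simp: homogenize_def cone_hyp_def lookup_rspace_0)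
  have homogenize_scaleR: "homogenize (r *\<^sub>R a) (r * c) = homogenize a c" if "r \<noteq> 0" for r a c
    using that by (simp add: homogenize_def lookup_scaleR mult.assoc flip: sum_distrib_left)
  have "{homogenize a c | a c. a \<in> rspace I \<and> a \<noteq> 0 \<and> hyperplane I a c \<in> gain_hyp I ` T} = cone_hyp I ` T"
    (is "?L = ?R")
  proof (intro subset_antisym subsetI)
    fix K assume "K \<in> ?L"
    then obtain a c i j d where K: "K = homogenize a c" and a: "a \<in> rspace I" "a \<noteq> 0"
      and t: "(i, j, d) \<in> T" "hyperplane I a c = gain_hyp I (i, j, d)" by auto
    have "gain_vec i j \<in> rspace I" "gain_vec i j \<noteq> 0" using gain_vec_rspace[OF t(1)] by auto
    then obtain r where "r \<noteq> 0" "a = r *\<^sub>R gain_vec i j" "c = r * of_int d"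
      using hyperplane_eq_imp_proportional[OF finite_vertices a] t gain_hyp_eq by metis
    then show "K \<in> ?R" using K t(1) homogenize_scaleR homogenize_gain by auto
  next
    fix K assume "K \<in> ?R"
    then obtain i j c where t: "(i, j, c) \<in> T" and K: "K = cone_hyp I (i, j, c)" by auto
    then show "K \<in> ?L"
      using gain_vec_rspace[OF t] gain_hyp_eq[OF t] homogenize_gain[OF t]
      by (auto intro!: exI[of _ "gain_vec i j"] exI[of _ "real_of_int c"])
  qed
  then show ?thesis by (simp add: arr_cone_def infinity_hyp_def homogenize_def)
qed

lemma coords_cone: "coords (arr_cone (gain_arr I T)) = cone_coords I"
  by (simp add: arr_cone_def)

lemma cone_vec_proportional_imp_eq:
  assumes s: "s \<in> T" and t: "t \<in> T" and eq: "cone_vec s = r *\<^sub>R cone_vec t"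
  shows "s = t"
proof -
  obtain i j c i' j' c' where ijc: "s = (i, j, c)" "t = (i', j', c')" by (metis prod.exhaust)
  have ends: "i \<noteq> 0" "i' \<noteq> 0" "i \<noteq> j" "i' \<noteq> j'"
    using s t gain_ends gain_source_nonzero unfolding ijc by blast+
  have vertex:
      "of_bool (k = i) - of_bool (k = j \<and> j \<noteq> 0) = r * (of_bool (k = i') - of_bool (k = j' \<and> j' \<noteq> 0))" for k
    using arg_cong[OF eq, of "\<lambda>y. lookup y (Some k)"] by (simp add: ijc lookup_scaleR lookup_gain_vec)
  have infinity: "real_of_int c = r * of_int c'"
    using arg_cong[OF eq, of "\<lambda>y. lookup y None"] by (simp add: ijc lookup_scaleR)
  show ?thesis
  proof (cases "i = i'")
    case True
    then have "r = 1" using vertex[of i] ends by (auto split: if_splits)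
    moreover have "j = j'"
      using vertex[of j] vertex[of j'] True ends \<open>r = 1\<close> by (auto simp: of_bool_def split: if_splits)
    ultimately show ?thesis using True infinity by (simp add: ijc)
  next
    case False
    then have "i = j'" "r = -1"
      using vertex[of i] ends by (auto simp: of_bool_def split: if_splits)
    moreover from this have "j = i'"
      using vertex[of i'] ends False by (auto simp: of_bool_def split: if_splits)
    moreover have "c' = - c" using infinity \<open>r = -1\<close> by (simp flip: of_int_minus)
    ultimately show ?thesis using gain_not_reversed s t unfolding ijc by blast
  qed
qed

lemma inj_on_cone_vec: "inj_on cone_vec T"
  using cone_vec_proportional_imp_eq[of _ _ 1] by (auto intro: inj_onI)

lemma cone_vec_not_vertical:
  assumes "t \<in> T"
  shows "\<exists>i. lookup (cone_vec t) (Some i) \<noteq> 0"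
proof -
  obtain i j c where t: "t = (i, j, c)" by (cases t)
  then have "lookup (cone_vec t) (Some i) \<noteq> 0"
    using assms gain_ends by (fastforce simp: lookup_gain_vec)
  then show ?thesis ..
qed

definition cone_normals :: "(nat option \<Rightarrow>\<^sub>0 real) set" where
  "cone_normals = insert (single None 1) (cone_vec ` T)"

lemma card_cone_normals: "card cone_normals = Suc (card T)"
proof -
  have "lookup (single None 1) (Some i) = 0" for i :: nat
    by (simp add: lookup_single)
  then have "single None 1 \<notin> cone_vec ` T"
    using cone_vec_not_vertical by (metis imageE)
  then show ?thesis
    using finite_gains by (simp add: cone_normals_def card_image inj_on_cone_vec)
qed

sublocale cone: normal_vectors "arr_cone (gain_arr I T)" cone_normals
proof
  show "finite (coords (arr_cone (gain_arr I T)))" "finite cone_normals"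
    using finite_vertices finite_gains by (simp_all add: coords_cone cone_normals_def)
  have "single None (1::real) \<in> rspace (cone_coords I) - {0}"
    by (simp add: rspace_iff lookup_single when_def) (metis lookup_single_eq lookup_zero zero_neq_one)
  moreover have "cone_vec t \<in> rspace (cone_coords I) - {0}" if t: "t \<in> T" for t
  proof -
    have "cone_vec t \<in> rspace (cone_coords I)"
      using gain_ends t by (cases t) (auto simp: rspace_iff lookup_gain_vec split_option_all)
    then show ?thesis using cone_vec_not_vertical[OF t] by auto
  qed
  ultimately show "cone_normals \<subseteq> ambient (arr_cone (gain_arr I T)) - {0}"
    by (auto simp: cone_normals_def coords_cone)
  have "hyps (arr_cone (gain_arr I T))
      = insert (infinity_hyp I) ((\<lambda>t. hyperplane (cone_coords I) (cone_vec t) 0) ` T)"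
    unfolding hyps_cone using cone_hyp_eq by (auto intro!: arg_cong2[where f = insert] image_cong)
  then show "hyps (arr_cone (gain_arr I T))
      = (\<lambda>a. hyperplane (coords (arr_cone (gain_arr I T))) a 0) ` cone_normals"
    by (simp add: coords_cone cone_normals_def infinity_hyp_eq image_image)
  fix a b r assume ab: "a \<in> cone_normals" "b \<in> cone_normals" and b: "b = r *\<^sub>R a"
  then have coordinate: "lookup b v = r * lookup a v" for v by (simp add: lookup_scaleR)
  consider (finite) "a \<in> cone_vec ` T" "b \<in> cone_vec ` T"
    | (left_infinity) "a = single None 1" | (right_infinity) "b = single None 1" "a \<in> cone_vec ` T"
    using ab by (auto simp: cone_normals_def)
  then show "a = b"
  proof cases
    case finite
    then obtain s t where "s \<in> T" "t \<in> T" "a = cone_vec s" "b = cone_vec t" by blast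
    then show ?thesis using cone_vec_proportional_imp_eq[of t s r] b by simp
  next
    case left_infinity
    then have "lookup b (Some i) = 0" for i
      using coordinate[of "Some i"] by (simp add: lookup_single)
    then have "b \<notin> cone_vec ` T" using cone_vec_not_vertical by blast
    then show ?thesis using left_infinity ab(2) by (simp add: cone_normals_def)
  next
    case right_infinity
    then obtain i where "lookup a (Some i) \<noteq> 0" using cone_vec_not_vertical by blast
    then show ?thesis using right_infinity(1) coordinate[of None] coordinate[of "Some i"]
      by (simp add: lookup_single)
  qed
qed

end

section \<open>Derivations given by a polynomial in one variable\<close>

definition zvar :: "nat option rpoly" where
  "zvar = poly_var None"

definition xvar :: "nat \<Rightarrow> nat option rpoly" where
  "xvar i = (if i = 0 then 0 else poly_var (Some i))"

lemma xvar_0 [simp]: "xvar 0 = 0"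
  by (simp add: xvar_def)

lemma homogeneous_in_zvar: "homogeneous_in (cone_coords I) 1 zvar"
  by (simp add: zvar_def homogeneous_in_var[unfolded One_nat_def])

lemma homogeneous_in_xvar: "i \<in> I \<Longrightarrow> homogeneous_in (cone_coords I) 1 (xvar i)"
  by (simp add: xvar_def homogeneous_in_var[unfolded One_nat_def])

definition affine_point :: "(nat \<Rightarrow> real) \<Rightarrow> nat option \<Rightarrow> real" where
  "affine_point p v = (case v of None \<Rightarrow> 1 | Some i \<Rightarrow> p i)"

lemma point_eval_zvar [simp]: "point_eval (affine_point p) zvar = 1"
  and point_eval_xvar: "i \<noteq> 0 \<Longrightarrow> point_eval (affine_point p) (xvar i) = p i"
  by (simp_all add: zvar_def xvar_def affine_point_def)

definition euler_derivation :: "'v set \<Rightarrow> 'v rpoly \<Rightarrow> 'v rpoly" where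
  "euler_derivation I = der_of I poly_var"

lemma homogeneous_der_euler_derivation: "homogeneous_der I 1 (euler_derivation I)" for I :: "'v set"
proof -
  have "homogeneous_poly 1 (poly_var i)" if "i \<in> I" for i
    using homogeneous_in_var[OF that] by (simp add: homogeneous_in_def)
  then show ?thesis by (simp add: homogeneous_der_def euler_derivation_def der_of_var)
qed

lemma (in normal_vectors) euler_derivation_log: "euler_derivation (coords A) \<in> log_derivations A"
proof -
  have der: "euler_derivation (coords A) \<in> derivations (coords A)"
    unfolding euler_derivation_def by (rule der_of_derivation) simp
  have "euler_derivation (coords A) (linear_form (coords A) a) = linear_form (coords A) a" for a
    unfolding derivation_linear_form[OF der]
    by (simp add: euler_derivation_def der_of_var linear_form_eq)
  then show ?thesis using der by (simp add: log_derivations_iff)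
qed

definition poly_derivation :: "nat set \<Rightarrow> nat option rpoly poly \<Rightarrow> nat option rpoly \<Rightarrow> nat option rpoly" where
  "poly_derivation I P = der_of (cone_coords I) (\<lambda>v. case v of None \<Rightarrow> 0 | Some i \<Rightarrow> poly P (xvar i))"

lemma poly_derivation_zvar: "poly_derivation I P (poly_var None) = 0"
  and poly_derivation_xvar: "i \<in> I \<Longrightarrow> poly_derivation I P (poly_var (Some i)) = poly P (xvar i)"
  by (simp_all add: poly_derivation_def der_of_var)

lemma poly_derivation_derivation:
  assumes "poly_homogeneous (cone_coords I) d P"
  shows "poly_derivation I P \<in> derivations (cone_coords I)"
  unfolding poly_derivation_def
proof (rule der_of_derivation)
  have "poly P (xvar i) \<in> poly_ring (cone_coords I)" if "i \<in> I" for i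
    using homogeneous_in_poly[OF assms homogeneous_in_xvar[OF that]] by (simp add: homogeneous_in_def)
  then show "(case v of None \<Rightarrow> 0 | Some i \<Rightarrow> poly P (xvar i)) \<in> poly_ring (cone_coords I)"
    if "v \<in> cone_coords I" for v
    using that by (cases v) auto
qed

lemma homogeneous_der_poly_derivation:
  assumes "poly_homogeneous (cone_coords I) d P"
  shows "homogeneous_der (cone_coords I) d (poly_derivation I P)"
  using homogeneous_in_poly[OF assms homogeneous_in_xvar]
  by (auto simp: homogeneous_der_def ball_cone_coords poly_derivation_zvar poly_derivation_xvar homogeneous_in_def
      intro: homogeneous_poly_def[THEN iffD2])

definition logarithmic_poly :: "(nat \<times> nat \<times> int) set \<Rightarrow> nat option rpoly poly \<Rightarrow> bool" where
  "logarithmic_poly T P \<longleftrightarrow> (\<forall>(i, j, c)\<in>T.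
     xvar i - xvar j - of_int c * zvar dvd poly P (xvar i) - (if j = 0 then 0 else poly P (xvar j)))"

context gain_graph
begin

lemma linear_form_cone_vec:
  assumes t: "(i, j, c) \<in> T"
  shows "linear_form (cone_coords I) (cone_vec (i, j, c)) = xvar i - xvar j - of_int c * zvar"
  using sum_gain_vec[OF comm_ring_hom_poly_const t, of "\<lambda>k. poly_var (Some k)"] finite_vertices gain_source_nonzero[OF t]
  by (simp add: linear_form_eq sum_cone_coords xvar_def zvar_def poly_const.hom_uminus poly_const_of_int)

lemma poly_derivation_log:
  assumes P: "logarithmic_poly T P" "poly_homogeneous (cone_coords I) d P"
  shows "poly_derivation I P \<in> log_derivations (arr_cone (gain_arr I T))"
proof -
  note der = poly_derivation_derivation[OF P(2)]
  have apply_linear_form: "poly_derivation I P (linear_form (cone_coords I) a)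
      = (\<Sum>i\<in>I. poly_const (lookup a (Some i)) * poly P (xvar i))" for a
    using finite_vertices
    by (simp add: derivation_linear_form[OF der] sum_cone_coords poly_derivation_zvar poly_derivation_xvar)
  have "linear_form (cone_coords I) a dvd poly_derivation I P (linear_form (cone_coords I) a)"
    if a: "a \<in> cone_normals" for a
  proof (cases "a = single None 1")
    case True
    then show ?thesis by (simp add: apply_linear_form lookup_single)
  next
    case False
    then obtain i j c where t: "(i, j, c) \<in> T" and a: "a = cone_vec (i, j, c)"
      using a by (auto simp: cone_normals_def)
    have "xvar i - xvar j - of_int c * zvar dvd poly P (xvar i) - (if j = 0 then 0 else poly P (xvar j))"
      using P(1) t unfolding logarithmic_poly_def by blast
    also have "\<dots> = poly_derivation I P (linear_form (cone_coords I) a)"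
      unfolding apply_linear_form a
      using sum_gain_vec[OF comm_ring_hom_poly_const t, of "\<lambda>k. poly P (xvar k)"] by simp
    finally show ?thesis
      unfolding a linear_form_cone_vec[OF t] .
  qed
  then show ?thesis
    using der by (simp add: cone.log_derivations_iff coords_cone)
qed

theorem free_cone:
  fixes P :: "'i \<Rightarrow> nat option rpoly poly"
  assumes R: "finite R" "card R = card I"
    and log: "\<And>r. r \<in> R \<Longrightarrow> logarithmic_poly T (P r)"
    and homogeneous: "\<And>r. r \<in> R \<Longrightarrow> poly_homogeneous (cone_coords I) (d r) (P r)"
    and degree_sum: "(\<Sum>r\<in>R. d r) = card T"
    and independent: "\<And>w. (\<And>i. i \<in> I \<Longrightarrow> (\<Sum>r\<in>R. w r * point_eval (affine_point p) (poly (P r) (xvar i))) = 0)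
      \<Longrightarrow> \<forall>r\<in>R. w r = 0"
  shows "free_with_exponents (arr_cone (gain_arr I T)) (add_mset 1 (image_mset d (mset_set R)))"
proof -
  let ?J = "cone_coords I"
  let ?\<theta> = "case_option (euler_derivation ?J) (\<lambda>r. poly_derivation I (P r))"
  have "free_with_exponents (arr_cone (gain_arr I T)) (image_mset (case_option 1 d) (mset_set (cone_coords R)))"
  proof (rule cone.saito_criterion[where \<theta> = ?\<theta> and x = "affine_point p"])
    show "finite (cone_coords R)" "card (cone_coords R) = card (coords (arr_cone (gain_arr I T)))"
      using R finite_vertices by (simp_all add: coords_cone card_cone_coords)
    show "?\<theta> r \<in> log_derivations (arr_cone (gain_arr I T))" if "r \<in> cone_coords R" for r
      using that log homogeneous cone.euler_derivation_log
      by (cases r) (auto simp: coords_cone intro: poly_derivation_log)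
    show "homogeneous_der (coords (arr_cone (gain_arr I T))) (case_option 1 d r) (?\<theta> r)"
        if "r \<in> cone_coords R" for r
      using that homogeneous
      by (cases r) (auto simp: coords_cone intro: homogeneous_der_euler_derivation[unfolded One_nat_def]
          homogeneous_der_poly_derivation)
    show "(\<Sum>r\<in>cone_coords R. case_option 1 d r) = card cone_normals"
      using R degree_sum by (simp add: sum_cone_coords card_cone_normals)
    fix w :: "'i option \<Rightarrow> real"
    assume w: "\<And>v. v \<in> coords (arr_cone (gain_arr I T)) \<Longrightarrow>
      (\<Sum>r\<in>cone_coords R. w r * point_eval (affine_point p) (?\<theta> r (poly_var v))) = 0"
    have "w None = 0"
      using w[of None] R
      by (simp add: coords_cone sum_cone_coords poly_derivation_zvar euler_derivation_def der_of_var affine_point_def)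
    moreover from this have "(\<Sum>r\<in>R. w (Some r) * point_eval (affine_point p) (poly (P r) (xvar i))) = 0"
        if "i \<in> I" for i
      using w[of "Some i"] R that by (simp add: coords_cone sum_cone_coords poly_derivation_xvar)
    then have "\<forall>r\<in>R. w (Some r) = 0" by (rule independent)
    ultimately show "\<forall>r\<in>cone_coords R. w r = 0" by (simp add: ball_cone_coords)
  qed
  then show ?thesis using R(1) by (simp add: image_mset_case_option_cone_coords)
qed

end

section \<open>The gains of a vertex-weighted digraph\<close>

definition wdig_gains :: "nat wdigraph \<Rightarrow> (nat \<times> nat \<times> int) set" where
  "wdig_gains G = (\<lambda>(i, j). (i, j, 0)) ` {(i, j). i \<in> vertices G \<and> j \<in> vertices G \<and> i < j}
    \<union> (\<lambda>(i, j). (i, j, 1)) ` edges G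
    \<union> (\<lambda>(i, c). (i, 0, c)) ` (SIGMA i:vertices G. {fst (weight G i)..snd (weight G i)})"

lemma mem_wdig_gains:
  "(i, j, c) \<in> wdig_gains G \<longleftrightarrow>
    c = 0 \<and> i \<in> vertices G \<and> j \<in> vertices G \<and> i < j \<or> c = 1 \<and> (i, j) \<in> edges G
    \<or> j = 0 \<and> i \<in> vertices G \<and> fst (weight G i) \<le> c \<and> c \<le> snd (weight G i)"
  by (auto simp: wdig_gains_def)

lemma wdig_gains_cases [consumes 1, case_names equal edge weight]:
  assumes "(i, j, c) \<in> wdig_gains G"
  obtains "c = 0" "i \<in> vertices G" "j \<in> vertices G" "i < j"
    | "c = 1" "(i, j) \<in> edges G"
    | "j = 0" "i \<in> vertices G" "fst (weight G i) \<le> c" "c \<le> snd (weight G i)"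
  using assms by (auto simp: mem_wdig_gains)

lemma wdig_arr_eq_gain_arr:
  assumes "0 \<notin> vertices G"
  shows "wdig_arr G = gain_arr (vertices G) (wdig_gains G)"
proof -
  let ?V = "vertices G"
  have "{{x \<in> rspace ?V. lookup x i - lookup x j = 0} | i j. i \<in> ?V \<and> j \<in> ?V \<and> i < j}
      = gain_hyp ?V ` (\<lambda>(i, j). (i, j, 0)) ` {(i, j). i \<in> ?V \<and> j \<in> ?V \<and> i < j}"
    by (force simp: gain_hyp_def image_iff)
  moreover have "{{x \<in> rspace ?V. lookup x i - lookup x j = 1} | i j. (i, j) \<in> edges G}
      = gain_hyp ?V ` (\<lambda>(i, j). (i, j, 1)) ` edges G"
    by (force simp: gain_hyp_def image_iff)
  moreover have
      "{{x \<in> rspace ?V. lookup x i = of_int c} | i c. i \<in> ?V \<and> c \<in> {fst (weight G i)..snd (weight G i)}}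
      = gain_hyp ?V ` (\<lambda>(i, c). (i, 0, c)) ` (SIGMA i:?V. {fst (weight G i)..snd (weight G i)})"
  proof -
    have "gain_hyp ?V (i, 0, c) = {x \<in> rspace ?V. lookup x i = of_int c}" for i c
      using assms by (auto simp: gain_hyp_def lookup_rspace_0)
    then show ?thesis by (force simp: image_iff)
  qed
  ultimately show ?thesis
    unfolding wdig_arr_def gain_arr_def wdig_gains_def image_Un by simp
qed

lemma card_distinct_pairs:
  assumes "finite B" "S \<subseteq> B"
  shows "card {(i, j). i \<in> B \<and> j \<in> S \<and> i \<noteq> j} = card S * (card B - 1)"
proof -
  have "{(i, j). i \<in> B \<and> j \<in> S \<and> i \<noteq> j} = (\<lambda>(j, i). (i, j)) ` (SIGMA j:S. B - {j})"
    by auto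
  then have "card {(i, j). i \<in> B \<and> j \<in> S \<and> i \<noteq> j} = card (SIGMA j:S. B - {j})"
    by (simp add: card_image inj_on_def)
  also have "\<dots> = (\<Sum>j\<in>S. card (B - {j}))"
    using assms finite_subset by (intro card_SigmaI) auto
  also have "\<dots> = (\<Sum>j\<in>S. card B - 1)"
    using assms by (intro sum.cong refl) (auto simp: card_Diff_singleton_if)
  finally show ?thesis by simp
qed

lemma card_less_pairs:
  fixes V :: "nat set"
  assumes "finite V"
  shows "2 * card {(i, j). i \<in> V \<and> j \<in> V \<and> i < j} = card V * (card V - 1)"
proof -
  let ?L = "{(i, j). i \<in> V \<and> j \<in> V \<and> i < j}"
  have finite: "finite ?L"
    by (rule finite_subset[of _ "V \<times> V"]) (use assms in auto)
  have "{(i, j). i \<in> V \<and> j \<in> V \<and> i \<noteq> j} = ?L \<union> prod.swap ` ?L"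
    by (auto simp: image_iff)
  then have "card {(i, j). i \<in> V \<and> j \<in> V \<and> i \<noteq> j} = card ?L + card (prod.swap ` ?L)"
    using finite by (simp only:) (intro card_Un_disjoint; auto)
  then show ?thesis
    using card_distinct_pairs[OF assms order.refl] by (simp add: card_image)
qed

locale loopless_wdigraph =
  fixes G :: "nat wdigraph"
  assumes finite_verts: "finite (vertices G)" and zero_notin_verts: "0 \<notin> vertices G"
    and edge_ends: "(i, j) \<in> edges G \<Longrightarrow> i \<in> vertices G \<and> j \<in> vertices G \<and> i \<noteq> j"
begin

lemma finite_edges: "finite (edges G)"
  by (rule finite_subset[of _ "vertices G \<times> vertices G"]) (use edge_ends finite_verts in auto)

sublocale gain_graph "vertices G" "wdig_gains G"
proof
  have "finite {(i, j). i \<in> vertices G \<and> j \<in> vertices G \<and> i < j}"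
    by (rule finite_subset[of _ "vertices G \<times> vertices G"]) (use finite_verts in auto)
  then show "finite (wdig_gains G)"
    using finite_verts finite_edges by (simp add: wdig_gains_def)
  show "i \<in> vertices G \<and> j \<in> insert 0 (vertices G) \<and> i \<noteq> j" if "(i, j, c) \<in> wdig_gains G" for i j c
    using that edge_ends zero_notin_verts by (cases rule: wdig_gains_cases) (auto intro: gr0I)
  show "(j, i, - c) \<notin> wdig_gains G" if "(i, j, c) \<in> wdig_gains G" for i j c
    using that edge_ends zero_notin_verts by (cases rule: wdig_gains_cases) (auto simp: mem_wdig_gains)
qed (use finite_verts zero_notin_verts in auto)

lemma card_wdig_gains:
  "2 * card (wdig_gains G) = card (vertices G) * (card (vertices G) - 1)
    + 2 * (card (edges G) + (\<Sum>i\<in>vertices G. nat (snd (weight G i) - fst (weight G i) + 1)))"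
proof -
  let ?V = "vertices G"
  let ?E = "(\<lambda>(i, j). (i, j, 0)) ` {(i, j). i \<in> ?V \<and> j \<in> ?V \<and> i < j} :: (nat \<times> nat \<times> int) set"
  let ?D = "(\<lambda>(i, j). (i, j, 1)) ` edges G :: (nat \<times> nat \<times> int) set"
  let ?W = "(\<lambda>(i, c). (i, 0, c)) ` (SIGMA i:?V. {fst (weight G i)..snd (weight G i)}) :: (nat \<times> nat \<times> int) set"
  have finite: "finite ?E" "finite ?D" "finite ?W"
    using finite_gains by (auto simp: wdig_gains_def)
  have "card (wdig_gains G) = card (?E \<union> ?D) + card ?W"
    unfolding wdig_gains_def using finite zero_notin_verts edge_ends by (intro card_Un_disjoint) auto
  also have "card (?E \<union> ?D) = card ?E + card ?D"
    using finite by (intro card_Un_disjoint) auto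
  also have "card ?E = card {(i, j). i \<in> ?V \<and> j \<in> ?V \<and> i < j}" by (rule card_image) (auto simp: inj_on_def)
  also have "card ?D = card (edges G)" by (rule card_image) (auto simp: inj_on_def)
  also have "card ?W = card (SIGMA i:?V. {fst (weight G i)..snd (weight G i)})"
    by (rule card_image) (auto simp: inj_on_def)
  also have "\<dots> = (\<Sum>i\<in>?V. nat (snd (weight G i) - fst (weight G i) + 1))"
    using finite_verts by (simp add: add.commute)
  finally show ?thesis using card_less_pairs[OF finite_verts] by simp
qed

end

section \<open>The derivations of a block\<close>

definition block_poly :: "int set \<Rightarrow> nat set \<Rightarrow> nat \<Rightarrow> nat option rpoly poly" where
  "block_poly K S r = (\<Prod>c\<in>K. [:- (of_int c * zvar), 1:]) * (\<Prod>j\<in>S. [:- xvar j, 1:]) * monom 1 r"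

lemma poly_block_poly:
  "poly (block_poly K S r) x = (\<Prod>c\<in>K. x - of_int c * zvar) * (\<Prod>j\<in>S. x - xvar j) * x ^ r"
  by (simp add: block_poly_def poly_prod poly_monom)

lemma poly_homogeneous_block_poly:
  assumes "finite K" "finite S" "S \<subseteq> I"
  shows "poly_homogeneous (cone_coords I) (card K + card S + r) (block_poly K S r)"
proof -
  have "poly_homogeneous (cone_coords I) (sum (\<lambda>_. 1) K + sum (\<lambda>_. 1) S + r) (block_poly K S r)"
    unfolding block_poly_def using assms
    by (intro poly_homogeneous_mult poly_homogeneous_prod poly_homogeneous_linear poly_homogeneous_monom
        homogeneous_in_of_int_mult homogeneous_in_zvar homogeneous_in_xvar) auto
  then show ?thesis by simp
qed

definition block_antidifference :: "int set \<Rightarrow> nat set \<Rightarrow> nat \<Rightarrow> nat option rpoly poly" where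
  "block_antidifference K S r = antidifference zvar (block_poly K S r)"

lemma poly_block_antidifference_0: "poly (block_antidifference K S r) 0 = 0"
  by (simp add: block_antidifference_def poly_antidifference_0)

lemma poly_block_antidifference_shift:
  "poly (block_antidifference K S r) (x + zvar)
      = poly (block_antidifference K S r) x + zvar * poly (block_poly K S r) x"
  using poly_antidifference_shift[of zvar "block_poly K S r" x]
  by (simp add: block_antidifference_def algebra_simps)

lemma poly_homogeneous_block_antidifference:
  assumes "finite K" "finite S" "S \<subseteq> I"
  shows "poly_homogeneous (cone_coords I) (Suc (card K + card S + r)) (block_antidifference K S r)"
  unfolding block_antidifference_def
  by (intro poly_homogeneous_antidifference homogeneous_in_zvar poly_homogeneous_block_poly assms)

lemma diff_dvd_poly_diff: "x - y dvd poly P x - poly P y" for P :: "'a::comm_ring_1 poly"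
proof (induction P)
  case (pCons a P)
  have "x * poly P x - y * poly P y = (x - y) * poly P x + y * (poly P x - poly P y)"
    by (simp add: algebra_simps)
  then show ?case using pCons by simp
qed simp

lemma block_antidifference_edge_dvd:
  assumes "finite S" "j \<in> S"
  shows "x - xvar j - zvar
      dvd poly (block_antidifference K S r) x - poly (block_antidifference K S r) (xvar j)"
proof -
  have "poly (block_poly K S r) (xvar j) = 0"
    using assms by (auto simp: poly_block_poly)
  then have "poly (block_antidifference K S r) (xvar j) = poly (block_antidifference K S r) (xvar j + zvar)"
    by (simp add: poly_block_antidifference_shift)
  then show ?thesis
    using diff_dvd_poly_diff[of x "xvar j + zvar"] by (simp add: diff_diff_eq)
qed

context
  fixes K :: "int set" and S :: "nat set" and a b :: int
  assumes finite_K: "finite K" and finite_S: "finite S"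
    and window: "{- a..<b} \<subseteq> K" and a: "0 \<le> a" and b: "0 \<le> b"
begin

lemma block_antidifference_vanishes:
  assumes "c \<in> {- a..b}"
  shows "poly (block_antidifference K S r) (of_int c * zvar) = 0"
proof -
  let ?f = "\<lambda>c. poly (block_antidifference K S r) (of_int c * zvar)"
  have shift_invariant: "?f (c + 1) = ?f c" if "c \<in> {- a..<b}" for c
  proof -
    have "poly (block_poly K S r) (of_int c * zvar) = 0"
      using that window finite_K by (auto simp: poly_block_poly)
    then show ?thesis
      using poly_block_antidifference_shift[of K S r "of_int c * zvar"] by (simp add: algebra_simps)
  qed
  show ?thesis
  proof (cases "c \<ge> 0")
    case True
    then have "c \<le> b \<Longrightarrow> ?f c = 0"
    proof (induction c rule: int_ge_induct)
      case (step i)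
      then show ?case using shift_invariant[of i] a by simp
    qed (simp add: poly_block_antidifference_0)
    then show ?thesis using assms by simp
  next
    case False
    then have "c \<le> 0" by simp
    then have "- a \<le> c \<Longrightarrow> ?f c = 0"
    proof (induction c rule: int_le_induct)
      case (step i)
      then show ?case using shift_invariant[of "i - 1"] b by simp
    qed (simp add: poly_block_antidifference_0)
    then show ?thesis using assms by simp
  qed
qed

lemma block_antidifference_weight_dvd:
  assumes c: "- a - of_bool (i \<in> S) \<le> c" "c \<le> b"
  shows "xvar i - of_int c * zvar dvd poly (block_antidifference K S r) (xvar i)"
proof -
  let ?P = "block_antidifference K S r" and ?c = "of_int c * zvar"
  have "xvar i - ?c dvd poly ?P ?c"
  proof (cases "- a \<le> c")
    case True
    then show ?thesis using block_antidifference_vanishes[of c r] c by simp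
  next
    case False
    then have i: "i \<in> S" and "c + 1 = - a"
      using c by (auto simp: of_bool_def split: if_splits)
    then have "?c + zvar = of_int (- a) * zvar"
      by (metis distrib_right mult_1 of_int_1 of_int_add)
    then have "poly ?P ?c = - zvar * poly (block_poly K S r) ?c"
      using poly_block_antidifference_shift[of K S r ?c] block_antidifference_vanishes[of "- a" r] a b
      by (simp add: add_eq_0_iff2)
    moreover have "?c - xvar i dvd poly (block_poly K S r) ?c"
      using i finite_S dvd_prodI[of S i "\<lambda>j. ?c - xvar j"] by (simp add: poly_block_poly)
    ultimately show ?thesis by (metis dvd_mult minus_diff_eq minus_dvd_iff)
  qed
  then show ?thesis
    using diff_dvd_poly_diff[of "xvar i" ?c ?P] by (metis dvd_add diff_add_cancel)
qed

lemma logarithmic_block_antidifference: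
  assumes "\<And>i j. (i, j) \<in> edges G \<Longrightarrow> j \<in> S \<and> j \<noteq> 0" and "0 \<notin> vertices G"
    and "\<And>i. i \<in> vertices G \<Longrightarrow> - a - of_bool (i \<in> S) \<le> fst (weight G i) \<and> snd (weight G i) \<le> b"
  shows "logarithmic_poly (wdig_gains G) (block_antidifference K S r)"
  unfolding logarithmic_poly_def
proof clarify
  fix i j c assume "(i, j, c) \<in> wdig_gains G"
  then show "xvar i - xvar j - of_int c * zvar dvd poly (block_antidifference K S r) (xvar i)
      - (if j = 0 then 0 else poly (block_antidifference K S r) (xvar j))"
  proof (cases rule: wdig_gains_cases)
    case equal
    then show ?thesis using assms(2) by (auto simp: diff_dvd_poly_diff)
  next
    case edge
    then have "j \<in> S" "j \<noteq> 0" using assms(1) by auto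
    then show ?thesis using edge block_antidifference_edge_dvd[OF finite_S] by simp
  next
    case weight
    then show ?thesis using assms(3) block_antidifference_weight_dvd[of i c r] by force
  qed
qed

end

text \<open>A combination of the discrete antiderivatives of \<open>H\<close>, \<open>t H\<close>, \<dots>, \<open>t\<^bsup>N-1\<^esup> H\<close> with more zeros than its
  degree vanishes, and then so does its difference.\<close>

lemma antidifferences_independent:
  fixes Q :: "nat \<Rightarrow> real poly" and H :: "real poly"
  assumes shift: "\<And>r s. r < N \<Longrightarrow> poly (Q r) (s + 1) = poly (Q r) s + poly H s * s ^ r"
    and degree: "\<And>r. r < N \<Longrightarrow> degree (Q r) \<le> D" and H: "H \<noteq> 0"
    and X: "finite X" "D < card X"
    and zero: "\<And>s. s \<in> X \<Longrightarrow> (\<Sum>r<N. w r * poly (Q r) s) + c = 0"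
  shows "(\<forall>r<N. w r = 0) \<and> c = 0"
proof -
  define W where "W = (\<Sum>r<N. smult (w r) (Q r)) + [:c:]"
  have poly_W: "poly W s = (\<Sum>r<N. w r * poly (Q r) s) + c" for s
    by (simp add: W_def poly_sum)
  have "degree W \<le> D"
    unfolding W_def using degree
    by (intro degree_add_le degree_sum_le) (auto intro: order.trans[OF degree_smult_le])
  moreover have "card X \<le> card {s. poly W s = 0}" if "W \<noteq> 0"
    by (intro card_mono poly_roots_finite that) (use zero poly_W in auto)
  moreover have "card {s. poly W s = 0} \<le> degree W" if "W \<noteq> 0"
    by (rule card_poly_roots_bound[OF that])
  ultimately have W: "W = 0" using X by fastforce
  define V where "V = (\<Sum>r<N. monom (w r) r)"
  have "poly (H * V) s = 0" for s
  proof -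
    have "poly (H * V) s = (\<Sum>r<N. w r * (poly (Q r) (s + 1) - poly (Q r) s))"
      by (simp add: V_def poly_sum poly_monom sum_distrib_left shift mult_ac)
    also have "\<dots> = poly W (s + 1) - poly W s"
      by (simp add: poly_W right_diff_distrib sum_subtractf)
    finally show ?thesis by (simp add: W)
  qed
  then have "H * V = 0" by (simp add: poly_eq_poly_eq_iff[symmetric] fun_eq_iff)
  then have V: "V = 0" using H by simp
  have "w r = 0" if "r < N" for r
    using arg_cong[OF V, of "\<lambda>q. coeff q r"] that by (simp add: V_def coeff_sum)
  moreover from this have "c = 0" using poly_W[of 0] W by simp
  ultimately show ?thesis by blast
qed

lemma (in comm_ring_hom) poly_map_poly_hom: "poly (map_poly hom P) (hom x) = hom (poly P x)"
  by (induction P) (simp_all add: map_poly_pCons hom_add hom_mult)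

lemma block_antidifferences_independent:
  fixes p :: "nat \<Rightarrow> real"
  assumes K: "finite K" and S: "finite S" "0 \<notin> S"
    and X: "finite X" "p ` S \<subseteq> X" "card K + card S + N < card (X \<union> (\<lambda>j. p j + 1) ` S)"
    and zero: "\<And>s. s \<in> X \<Longrightarrow>
      (\<Sum>r<N. w r * point_eval (affine_point p) (poly (block_antidifference K S r) (poly_const s))) + c = 0"
  shows "(\<forall>r<N. w r = 0) \<and> c = 0"
proof (rule antidifferences_independent)
  let ?e = "point_eval (affine_point p)"
  define Q where "Q r x = ?e (poly (block_antidifference K S r) x)" for r x
  define H where "H = (\<Prod>c\<in>K. [:- of_int c, 1:]) * (\<Prod>j\<in>S. [:- p j, 1:])"
  have Q_eq: "Q r (poly_const s) = poly (map_poly ?e (block_antidifference K S r)) s" for r s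
    using point_eval.poly_map_poly_hom[of "affine_point p" "block_antidifference K S r" "poly_const s"]
    by (simp add: Q_def)
  have xvar_S: "?e (xvar j) = p j" if "j \<in> S" for j
    using that S(2) by (metis point_eval_xvar)
  have shift: "Q r (poly_const (s + 1)) = Q r (poly_const s) + poly H s * s ^ r" for r s
  proof -
    have "Q r (poly_const (s + 1)) = Q r (poly_const s + zvar)"
      by (simp add: Q_eq) (simp add: Q_def point_eval.hom_add flip: point_eval.poly_map_poly_hom)
    also have "\<dots> = Q r (poly_const s) + ?e (zvar * poly (block_poly K S r) (poly_const s))"
      by (simp add: Q_def poly_block_antidifference_shift point_eval.hom_add)
    also have "?e (zvar * poly (block_poly K S r) (poly_const s)) = poly H s * s ^ r"
      by (simp add: poly_block_poly H_def poly_prod point_eval.hom_mult point_eval.hom_prod point_eval.hom_minus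
          point_eval.hom_power xvar_S)
    finally show ?thesis .
  qed
  show "poly (map_poly ?e (block_antidifference K S r)) (s + 1)
      = poly (map_poly ?e (block_antidifference K S r)) s + poly H s * s ^ r" for r s
    using shift by (simp add: Q_eq)
  show "degree (map_poly ?e (block_antidifference K S r)) \<le> card K + card S + N" if "r < N" for r
    using poly_homogeneousD(1)[OF poly_homogeneous_block_antidifference[OF K S(1) subset_refl, of r]]
      map_poly_degree_leq[of ?e "block_antidifference K S r"] that by simp
  show "H \<noteq> 0" using K S by (simp add: H_def)
  show "finite (X \<union> (\<lambda>j. p j + 1) ` S)" "card K + card S + N < card (X \<union> (\<lambda>j. p j + 1) ` S)"
    using X S by simp_all
  fix s assume "s \<in> X \<union> (\<lambda>j. p j + 1) ` S"
  then show "(\<Sum>r<N. w r * poly (map_poly ?e (block_antidifference K S r)) s) + c = 0"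
  proof
    assume "s \<in> (\<lambda>j. p j + 1) ` S"
    then obtain j where j: "j \<in> S" "s = p j + 1" by blast
    then have "poly H (p j) = 0" using S by (auto simp: H_def poly_prod)
    then have "Q r (poly_const s) = Q r (poly_const (p j))" for r
      using shift[of r "p j"] j by simp
    then show ?thesis using zero[of "p j"] j X(2) by (auto simp: Q_def simp flip: Q_eq)
  qed (use zero in \<open>simp add: Q_def flip: Q_eq\<close>)
qed

lemma triangular_independent:
  fixes f :: "nat \<Rightarrow> nat \<Rightarrow> real"
  assumes "finite M" and diagonal: "\<And>m. m \<in> M \<Longrightarrow> f m m \<noteq> 0"
    and above: "\<And>m i. m \<in> M \<Longrightarrow> i \<in> M \<Longrightarrow> m < i \<Longrightarrow> f m i = 0"
    and zero: "\<And>i. i \<in> M \<Longrightarrow> (\<Sum>m\<in>M. w m * f m i) = 0"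
  shows "\<forall>m\<in>M. w m = 0"
proof (rule ccontr)
  assume dependent: "\<not> (\<forall>m\<in>M. w m = 0)"
  define i where "i = Max {m \<in> M. w m \<noteq> 0}"
  have "i \<in> {m \<in> M. w m \<noteq> 0}"
    unfolding i_def using dependent \<open>finite M\<close> by (intro Max_in) auto
  then have i: "i \<in> M" "w i \<noteq> 0" by auto
  have "w m * f m i = 0" if "m \<in> M - {i}" for m
  proof (cases "m < i")
    case False
    then have "i < m" using that by simp
    then have "m \<notin> {m \<in> M. w m \<noteq> 0}"
      using \<open>finite M\<close> Max_ge[of "{m \<in> M. w m \<noteq> 0}" m] unfolding i_def by fastforce
    then show ?thesis using that by simp
  qed (use that i above in auto)
  then have "(\<Sum>m\<in>M - {i}. w m * f m i) = 0"
    by (intro sum.neutral ballI)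
  then have "(\<Sum>m\<in>M. w m * f m i) = w i * f i i"
    using \<open>finite M\<close> i(1) by (simp add: sum.remove)
  then show False using zero[OF i(1)] i diagonal by simp
qed

definition spaced_point :: "nat \<Rightarrow> nat \<Rightarrow> real" where
  "spaced_point l i = real (l + 2 * i)"

lemma card_spaced_points:
  assumes "finite B" "finite S"
  shows "card (spaced_point l ` B \<union> (\<lambda>j. spaced_point l j + 1) ` S) = card B + card S"
proof -
  have "spaced_point l i \<noteq> spaced_point l j + 1" for i j
  proof
    assume "spaced_point l i = spaced_point l j + 1"
    then have "real (l + 2 * i) = real (l + 2 * j + 1)" by (simp add: spaced_point_def)
    then have "l + 2 * i = l + 2 * j + 1" by (rule of_nat_eq_iff[THEN iffD1])
    then show False by presburger
  qed
  then have "card (spaced_point l ` B \<union> (\<lambda>j. spaced_point l j + 1) ` S)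
      = card (spaced_point l ` B) + card ((\<lambda>j. spaced_point l j + 1) ` S)"
    using assms by (intro card_Un_disjoint) auto
  also have "\<dots> = card B + card S"
    by (subst (1 2) card_image) (auto simp: inj_on_def spaced_point_def)
  finally show ?thesis .
qed

section \<open>Freeness of the cones\<close>

text \<open>For \<open>S = {k..l}\<close>, \<open>a = k - 1\<close> this is the digraph \<open>C\<close>, and for \<open>S = {k+1..l}\<close>, \<open>a = k\<close> it is
  the digraph \<open>D\<close>. In both cases \<open>a + |S| = l\<close>, which is all that the sequel depends on.\<close>

definition stage_dig :: "nat \<Rightarrow> nat \<Rightarrow> nat \<Rightarrow> nat set \<Rightarrow> nat wdigraph" where
  "stage_dig l k a S = \<lparr> vertices = {1..l}, edges = {(i, j). i \<in> {k..l} \<and> j \<in> S \<and> i \<noteq> j},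
     weight = (\<lambda>i\<in>{1..l}. if i < k then (- int i, int i) else (- int a - of_bool (i \<in> S), int k)) \<rparr>"

lemma vertices_stage_dig [simp]: "vertices (stage_dig l k a S) = {1..l}"
  and edges_stage_dig [simp]: "edges (stage_dig l k a S) = {(i, j). i \<in> {k..l} \<and> j \<in> S \<and> i \<noteq> j}"
  and weight_stage_dig: "i \<in> {1..l} \<Longrightarrow> weight (stage_dig l k a S) i
    = (if i < k then (- int i, int i) else (- int a - of_bool (i \<in> S), int k))"
  by (simp_all add: stage_dig_def)

definition lower_poly :: "nat \<Rightarrow> nat \<Rightarrow> nat option rpoly poly" where
  "lower_poly l m = block_poly {- int m..int m} {m<..l} 0"

lemma poly_lower_poly:
  "poly (lower_poly l m) x = (\<Prod>c\<in>{- int m..int m}. x - of_int c * zvar) * (\<Prod>j\<in>{m<..l}. x - xvar j)"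
  by (simp add: lower_poly_def poly_block_poly)

lemma poly_lower_poly_above: "m < i \<Longrightarrow> i \<le> l \<Longrightarrow> poly (lower_poly l m) (xvar i) = 0"
  by (auto simp: poly_lower_poly)

lemma poly_lower_poly_weight_dvd:
  assumes "- int m \<le> c" "c \<le> int m"
  shows "x - of_int c * zvar dvd poly (lower_poly l m) x"
  unfolding poly_lower_poly using assms by (intro dvd_mult2 dvd_prodI) auto

lemma poly_homogeneous_lower_poly:
  assumes "m \<le> l"
  shows "poly_homogeneous (cone_coords {1..l}) (l + m + 1) (lower_poly l m)"
proof -
  have "card {- int m..int m} + card {m<..l} + 0 = l + m + 1"
    using assms by simp
  moreover have "{m<..l} \<subseteq> {1..l}" by auto
  ultimately show ?thesis
    using poly_homogeneous_block_poly[of "{- int m..int m}" "{m<..l}" "{1..l}" 0]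
    by (simp only: lower_poly_def finite_atLeastAtMost_int finite_greaterThanAtMost)
qed

locale stage =
  fixes l k a :: nat and S :: "nat set"
  assumes k: "1 \<le> k" "k \<le> l" and S: "S \<subseteq> {k..l}" and a: "a + card S = l"
begin

abbreviation "G \<equiv> stage_dig l k a S"

lemma finite_S: "finite S" and zero_notin_S: "0 \<notin> S"
  using S k finite_subset by auto

lemma k_le: "k \<le> a + 1"
  using card_mono[OF _ S] a k by simp

sublocale loopless_wdigraph G
proof
  show "i \<in> vertices G \<and> j \<in> vertices G \<and> i \<noteq> j" if "(i, j) \<in> edges G" for i j
    using that S k by auto
qed simp_all

lemma sum_weight_lengths:
  "(\<Sum>i\<in>{1..l}. nat (snd (weight G i) - fst (weight G i) + 1))
      = k * k - 1 + ((l + 1 - k) * (a + k + 1) + card S)"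
proof -
  have split: "{1..l} = {1..<k} \<union> {k..l}" using k by auto
  have "(\<Sum>i\<in>{1..l}. nat (snd (weight G i) - fst (weight G i) + 1))
      = (\<Sum>i\<in>{1..l}. if i < k then 2 * i + 1 else a + k + 1 + of_bool (i \<in> S))"
    by (intro sum.cong refl) (auto simp: weight_stage_dig nat_eq_iff)
  also have "\<dots> = (\<Sum>i = 1..<k. 2 * i + 1) + (\<Sum>i\<in>{k..l}. a + k + 1 + of_bool (i \<in> S))"
    unfolding split by (subst sum.union_disjoint) auto
  also have "(\<Sum>i = 1..<k. 2 * i + 1) = k * k - 1"
    using k(1) by (induction k rule: nat_induct_at_least) (auto simp: algebra_simps)
  also have "(\<Sum>i\<in>{k..l}. a + k + 1 + of_bool (i \<in> S)) = (l + 1 - k) * (a + k + 1) + card S"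
  proof -
    have "(\<Sum>i\<in>{k..l}. of_bool (i \<in> S)) = card S"
      using S by (simp add: Int_absorb1)
    then show ?thesis unfolding sum.distrib by (simp add: add_mult_distrib2)
  qed
  finally show ?thesis .
qed

lemma card_gains: "card (wdig_gains G) = (\<Sum>m = 1..l. l + m + 1)"
proof -
  have "card (edges G) = card S * (l - k)"
    using card_distinct_pairs[OF _ S] by simp
  then have "2 * card (wdig_gains G)
      = l * (l - 1) + 2 * (card S * (l - k) + (k * k - 1 + ((l + 1 - k) * (a + k + 1) + card S)))"
    using card_wdig_gains sum_weight_lengths by simp
  moreover have "2 * (\<Sum>m = 1..l. l + m + 1) = 3 * (l * (l + 1))"
  proof -
    have "(\<Sum>m = 1..l. l + m + 1) = (\<Sum>m = 1..l. l + 1) + (\<Sum>m = 1..l. m)"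
      unfolding sum.distrib[symmetric] by (intro sum.cong) auto
    then show ?thesis using double_gauss_sum_from_Suc_0[of l, where 'a = nat] by simp
  qed
  moreover obtain n where n: "l = k + n" using k le_Suc_ex by blast
  moreover obtain j where j: "k = Suc j" using k by (cases k) auto
  moreover have "a * n + card S * n = l * n" using a by (simp flip: distrib_right)
  ultimately show ?thesis using a by (simp add: algebra_simps)
qed

definition derivation_poly :: "nat \<Rightarrow> nat option rpoly poly" where
  "derivation_poly m = (if m < k then lower_poly l m else block_antidifference {- int a..<int k} S (m - k))"

lemma logarithmic_lower_poly:
  assumes m: "1 \<le> m" "m < k"
  shows "logarithmic_poly (wdig_gains G) (lower_poly l m)"
  unfolding logarithmic_poly_def
proof clarify
  fix i j c assume "(i, j, c) \<in> wdig_gains G"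
  then show "xvar i - xvar j - of_int c * zvar dvd
      poly (lower_poly l m) (xvar i) - (if j = 0 then 0 else poly (lower_poly l m) (xvar j))"
  proof (cases rule: wdig_gains_cases)
    case equal
    then show ?thesis by (simp add: diff_dvd_poly_diff)
  next
    case edge
    then have "m < i" "i \<le> l" "m < j" "j \<le> l" using m S by auto
    then show ?thesis by (simp add: poly_lower_poly_above)
  next
    case weight
    show ?thesis
    proof (cases "i \<le> m")
      case True
      then have "- int m \<le> c" "c \<le> int m" using weight m by (auto simp: weight_stage_dig)
      then show ?thesis using weight(1) poly_lower_poly_weight_dvd by simp
    next
      case False
      then show ?thesis using weight by (simp add: poly_lower_poly_above)
    qed
  qed
qed

lemma logarithmic_derivation_poly:
  assumes "m \<in> {1..l}"
  shows "logarithmic_poly (wdig_gains G) (derivation_poly m)"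
proof (cases "m < k")
  case True
  then show ?thesis using assms logarithmic_lower_poly by (simp add: derivation_poly_def)
next
  case False
  have "logarithmic_poly (wdig_gains G) (block_antidifference {- int a..<int k} S (m - k))"
  proof (rule logarithmic_block_antidifference[where a = "int a" and b = "int k"])
    show "- int a - of_bool (i \<in> S) \<le> fst (weight G i) \<and> snd (weight G i) \<le> int k" if "i \<in> vertices G" for i
      using that k_le by (auto simp: weight_stage_dig)
  qed (use finite_S zero_notin_S in \<open>auto intro: gr0I\<close>)
  then show ?thesis using False by (simp add: derivation_poly_def)
qed

lemma poly_homogeneous_derivation_poly:
  assumes "m \<in> {1..l}"
  shows "poly_homogeneous (cone_coords {1..l}) (l + m + 1) (derivation_poly m)"
proof (cases "m < k")
  case True
  then show ?thesis using assms poly_homogeneous_lower_poly by (simp add: derivation_poly_def)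
next
  case False
  then have "Suc (card {- int a..<int k} + card S + (m - k)) = l + m + 1"
    using a by simp
  moreover have "S \<subseteq> {1..l}" using S k by auto
  ultimately show ?thesis
    using False finite_S poly_homogeneous_block_antidifference[of "{- int a..<int k}" S "{1..l}" "m - k"]
    by (simp add: derivation_poly_def)
qed

abbreviation "eval \<equiv> point_eval (affine_point (spaced_point l))"

lemma eval_xvar: "i \<in> {1..l} \<Longrightarrow> eval (xvar i) = real (l + 2 * i)"
  by (simp add: point_eval_xvar spaced_point_def)

lemma eval_lower_poly_nonzero:
  assumes m: "m \<in> {1..<k}"
  shows "eval (poly (lower_poly l m) (xvar m)) \<noteq> 0"
proof -
  have "real (l + 2 * m) \<noteq> of_int c" if "c \<in> {- int m..int m}" for c
    using that m by auto
  moreover have "eval (xvar m) - eval (xvar j) \<noteq> 0" if "j \<in> {m<..l}" for j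
    using that m k eval_xvar[of m] eval_xvar[of j] by simp
  ultimately show ?thesis
    using m k by (simp add: poly_lower_poly point_eval.hom_mult point_eval.hom_prod point_eval.hom_minus eval_xvar)
qed

abbreviation block_zeros :: "real set" where
  "block_zeros \<equiv> of_int ` {- int a..int k} \<union> spaced_point l ` {k..l}"

lemma card_block_zeros:
  "card (block_zeros \<union> (\<lambda>j. spaced_point l j + 1) ` S) = (a + k + 1) + ((l + 1 - k) + card S)"
proof -
  have "of_int c < spaced_point l j" if "c \<le> int k" "j \<in> {k..l}" for c j
  proof -
    have "real_of_int c \<le> real k" using that(1) by linarith
    then show ?thesis using k that(2) by (simp add: spaced_point_def)
  qed
  then have "of_int ` {- int a..int k} \<inter> (spaced_point l ` {k..l} \<union> (\<lambda>j. spaced_point l j + 1) ` S) = {}"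
    using S by fastforce
  then have "card (of_int ` {- int a..int k} \<union> (spaced_point l ` {k..l} \<union> (\<lambda>j. spaced_point l j + 1) ` S))
      = card (of_int ` {- int a..int k} :: real set) + card (spaced_point l ` {k..l} \<union> (\<lambda>j. spaced_point l j + 1) ` S)"
    using finite_S by (intro card_Un_disjoint) auto
  also have "card (of_int ` {- int a..int k} :: real set) = a + k + 1"
    by (subst card_image) (auto simp: inj_on_def)
  also have "card (spaced_point l ` {k..l} \<union> (\<lambda>j. spaced_point l j + 1) ` S) = l + 1 - k + card S"
    using finite_S by (simp add: card_spaced_points)
  finally show ?thesis by (simp add: Un_assoc)
qed

lemma block_derivations_independent:
  assumes zero: "\<And>i. i \<in> {k..l} \<Longrightarrow>
    (\<Sum>r<l + 1 - k. w r * eval (poly (block_antidifference {- int a..<int k} S r) (xvar i))) = 0"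
  shows "\<forall>r<l + 1 - k. w r = 0"
proof -
  let ?P = "block_antidifference {- int a..<int k} S"
  have eval_const: "eval (poly (?P r) x) = eval (poly (?P r) (poly_const s))" if "eval x = s" for r x s
    using that by (simp flip: point_eval.poly_map_poly_hom)
  have "(\<forall>r<l + 1 - k. w r = 0) \<and> 0 = (0::real)"
  proof (rule block_antidifferences_independent[where K = "{- int a..<int k}" and S = S and X = block_zeros])
    show "card {- int a..<int k} + card S + (l + 1 - k) < card (block_zeros \<union> (\<lambda>j. spaced_point l j + 1) ` S)"
      unfolding card_block_zeros by simp
    fix s assume "s \<in> block_zeros"
    then show "(\<Sum>r<l + 1 - k. w r * eval (poly (?P r) (poly_const s))) + 0 = 0"
    proof
      assume "s \<in> of_int ` {- int a..int k}"
      then obtain c where c: "c \<in> {- int a..int k}" "s = of_int c" by blast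
      have "eval (poly (?P r) (of_int c * zvar)) = 0" for r
        using c finite_S by (subst block_antidifference_vanishes[of _ _ "int a" "int k"]) auto
      then show ?thesis
        using c eval_const[of "of_int c * zvar" s] by (simp add: point_eval.hom_mult)
    next
      assume "s \<in> spaced_point l ` {k..l}"
      then obtain i where i: "i \<in> {k..l}" "s = spaced_point l i" by blast
      then have "eval (xvar i) = s" using k by (simp add: point_eval_xvar)
      then show ?thesis using zero[OF i(1)] eval_const[of "xvar i" s] by simp
    qed
  qed (use finite_S zero_notin_S S in auto)
  then show ?thesis by simp
qed

lemma derivation_polys_independent:
  assumes zero: "\<And>i. i \<in> {1..l} \<Longrightarrow> (\<Sum>m\<in>{1..l}. w m * eval (poly (derivation_poly m) (xvar i))) = 0"
  shows "\<forall>m\<in>{1..l}. w m = 0"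
proof -
  have split: "(\<Sum>m\<in>{1..l}. f m) = (\<Sum>m\<in>{1..<k}. f m) + (\<Sum>m\<in>{k..l}. f m)" for f :: "nat \<Rightarrow> real"
    using k by (subst sum.union_disjoint[symmetric]) (auto intro: sum.cong)
  have "\<forall>r<l + 1 - k. w (k + r) = 0"
  proof (rule block_derivations_independent)
    fix i assume i: "i \<in> {k..l}"
    have "(\<Sum>r<l + 1 - k. w (k + r) * eval (poly (block_antidifference {- int a..<int k} S r) (xvar i)))
        = (\<Sum>m\<in>{k..l}. w m * eval (poly (derivation_poly m) (xvar i)))"
      by (rule sum.reindex_bij_witness[of _ "\<lambda>m. m - k" "\<lambda>r. k + r"]) (auto simp: derivation_poly_def)
    also have "\<dots> = (\<Sum>m\<in>{1..l}. w m * eval (poly (derivation_poly m) (xvar i)))"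
      unfolding split using i by (simp add: derivation_poly_def poly_lower_poly_above)
    finally show
        "(\<Sum>r<l + 1 - k. w (k + r) * eval (poly (block_antidifference {- int a..<int k} S r) (xvar i))) = 0"
      using zero i k by simp
  qed
  then have block: "w m = 0" if "m \<in> {k..l}" for m
    using that by (auto dest!: spec[of _ "m - k"])
  have "\<forall>m\<in>{1..<k}. w m = 0"
  proof (rule triangular_independent[where f = "\<lambda>m i. eval (poly (lower_poly l m) (xvar i))"])
    show "(\<Sum>m\<in>{1..<k}. w m * eval (poly (lower_poly l m) (xvar i))) = 0" if "i \<in> {1..<k}" for i
      using zero[of i] that k block unfolding split by (simp add: derivation_poly_def)
  qed (use eval_lower_poly_nonzero k in \<open>auto simp: poly_lower_poly_above\<close>)
  then show ?thesis using block by fastforce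
qed

theorem free_cone_stage:
  "free_with_exponents (arr_cone (wdig_arr G)) (add_mset 1 (image_mset (\<lambda>m. l + m + 1) (mset_set {1..l})))"
  unfolding wdig_arr_eq_gain_arr[OF zero_notin_verts]
  using logarithmic_derivation_poly poly_homogeneous_derivation_poly derivation_polys_independent
  by (intro free_cone[where P = derivation_poly and p = "spaced_point l"]) (auto simp: card_gains)

end

definition complete_dig :: "nat \<Rightarrow> nat wdigraph" where
  "complete_dig n = \<lparr> vertices = {1..n}, edges = {(i, j). i \<in> {1..n} \<and> j \<in> {1..n} \<and> i \<noteq> j},
     weight = (\<lambda>_. (1, 0)) \<rparr>"

lemma vertices_complete_dig [simp]: "vertices (complete_dig n) = {1..n}"
  and edges_complete_dig [simp]: "edges (complete_dig n) = {(i, j). i \<in> {1..n} \<and> j \<in> {1..n} \<and> i \<noteq> j}"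
  and weight_complete_dig [simp]: "weight (complete_dig n) i = (1, 0)"
  by (simp_all add: complete_dig_def)

interpretation complete_dig: loopless_wdigraph "complete_dig n" for n
  by unfold_locales auto

lemma Cat_eq_wdig_arr: "Cat n = wdig_arr (complete_dig n)"
proof -
  have diff_neg: "lookup x i - lookup x j = -1 \<longleftrightarrow> lookup x j - lookup x i = 1" for x :: "nat \<Rightarrow>\<^sub>0 real" and i j
    by linarith
  have "{{x \<in> rspace {1..n}. lookup x i - lookup x j = c} | i j c. 1 \<le> i \<and> i < j \<and> j \<le> n \<and> c \<in> {-1, 0, 1}}
      = {{x \<in> rspace {1..n}. lookup x i - lookup x j = 0} | i j. i \<in> {1..n} \<and> j \<in> {1..n} \<and> i < j}
      \<union> {{x \<in> rspace {1..n}. lookup x i - lookup x j = 1} | i j. i \<in> {1..n} \<and> j \<in> {1..n} \<and> i \<noteq> j}"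
    (is "?L = ?E \<union> ?D")
  proof (intro subset_antisym subsetI)
    fix H assume "H \<in> ?L"
    then obtain i j c where H: "H = {x \<in> rspace {1..n}. lookup x i - lookup x j = c}"
      and ij: "i \<in> {1..n}" "j \<in> {1..n}" "i < j" and "c = -1 \<or> c = 0 \<or> c = 1" by auto
    then consider (negative) "c = -1" | "c = 0" | "c = 1" by blast
    then show "H \<in> ?E \<union> ?D"
    proof cases
      case negative
      then have "H = {x \<in> rspace {1..n}. lookup x j - lookup x i = 1}" using H diff_neg by auto
      then show ?thesis using ij by blast
    qed (use H ij in blast)+
  next
    fix H assume "H \<in> ?E \<union> ?D"
    then consider i j where "H = {x \<in> rspace {1..n}. lookup x i - lookup x j = 0}" "1 \<le> i" "i < j" "j \<le> n"
      | i j where "H = {x \<in> rspace {1..n}. lookup x i - lookup x j = 1}" "1 \<le> i" "i < j" "j \<le> n"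
      | i j where "H = {x \<in> rspace {1..n}. lookup x j - lookup x i = -1}" "1 \<le> j" "j < i" "i \<le> n"
      using diff_neg by (auto simp: neq_iff)
    then show "H \<in> ?L" by cases blast+
  qed
  then show ?thesis by (simp add: Cat_def wdig_arr_def)
qed

lemma card_complete_gains:
  assumes "n \<ge> 1"
  shows "card (wdig_gains (complete_dig n)) = (\<Sum>r<n. if r = 0 then 0 else n + r)"
proof -
  obtain m where m: "n = Suc m" using assms by (cases n) auto
  have "2 * card (wdig_gains (complete_dig n)) = n * (n - 1) + 2 * (n * (n - 1))"
    using complete_dig.card_wdig_gains[of n] card_distinct_pairs[of "{1..n}" "{1..n}"] by simp
  moreover have "(\<Sum>r<n. if r = 0 then 0 else n + r) = (\<Sum>r = 1..m. n + r)"
    unfolding m by (rule sum.mono_neutral_cong_right) auto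
  moreover have "2 * (\<Sum>r = 1..m. n + r) = 2 * m * n + m * (m + 1)"
    using double_gauss_sum_from_Suc_0[of m, where 'a = nat] by (simp add: sum.distrib algebra_simps)
  ultimately show ?thesis by (simp add: m algebra_simps)
qed

definition Cat_poly :: "nat \<Rightarrow> nat \<Rightarrow> nat option rpoly poly" where
  "Cat_poly n r = (if r = 0 then 1 else block_antidifference {} {1..n} (r - 1))"

lemma logarithmic_Cat_poly: "logarithmic_poly (wdig_gains (complete_dig n)) (Cat_poly n r)"
proof -
  have "logarithmic_poly (wdig_gains (complete_dig n)) 1"
    by (auto simp: logarithmic_poly_def mem_wdig_gains)
  moreover have "logarithmic_poly (wdig_gains (complete_dig n)) (block_antidifference {} {1..n} (r - 1))"
    by (rule logarithmic_block_antidifference[where a = 0 and b = 0]) auto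
  ultimately show ?thesis by (simp add: Cat_poly_def)
qed

lemma poly_homogeneous_Cat_poly:
  "poly_homogeneous (cone_coords {1..n}) (if r = 0 then 0 else n + r) (Cat_poly n r)"
  using poly_homogeneous_block_antidifference[of "{}" "{1..n}" "{1..n}" "r - 1"]
  by (cases r) (simp_all add: Cat_poly_def poly_homogeneous_1)

lemma Cat_polys_independent:
  assumes zero: "\<And>i. i \<in> {1..n} \<Longrightarrow>
    (\<Sum>r<n. w r * point_eval (affine_point (spaced_point n)) (poly (Cat_poly n r) (xvar i))) = 0"
  shows "\<forall>r<n. w r = 0"
proof (cases n)
  case (Suc m)
  have "(\<forall>r<m. w (Suc r) = 0) \<and> w 0 = 0"
  proof (rule block_antidifferences_independent[where K = "{}" and S = "{1..n}" and X = "spaced_point n ` {1..n}"])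
    show "card ({} :: int set) + card {1..n} + m
        < card (spaced_point n ` {1..n} \<union> (\<lambda>j. spaced_point n j + 1) ` {1..n})"
      using Suc by (simp add: card_spaced_points)
    fix s assume "s \<in> spaced_point n ` {1..n}"
    then obtain i where i: "i \<in> {1..n}" "s = spaced_point n i" by blast
    have "(\<Sum>r<n. f r) = (\<Sum>r<m. f (Suc r)) + f 0" for f :: "nat \<Rightarrow> real"
      unfolding Suc by (simp add: sum.lessThan_Suc_shift del: sum.lessThan_Suc)
    then show "(\<Sum>r<m. w (Suc r) * point_eval (affine_point (spaced_point n))
        (poly (block_antidifference {} {1..n} r) (poly_const s))) + w 0 = 0"
      using zero[OF i(1)] i by (simp add: Cat_poly_def point_eval_xvar flip: point_eval.poly_map_poly_hom)
  qed auto
  then show ?thesis using Suc by (auto simp: less_Suc_eq_0_disj)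
qed simp

lemma image_mset_Cat_degrees:
  fixes n :: nat
  assumes "n \<ge> 1"
  shows "image_mset (\<lambda>r. if r = 0 then 0 else n + r) (mset_set {..<n})
      = add_mset 0 (mset_set {n + 1..2 * n - 1})"
proof -
  have "{..<n} = insert 0 {1..<n}" using assms by auto
  then have "image_mset (\<lambda>r. if r = 0 then 0 else n + r) (mset_set {..<n})
      = add_mset 0 (image_mset (\<lambda>r. if r = 0 then 0 else n + r) (mset_set {1..<n}))"
    by simp
  also have "image_mset (\<lambda>r. if r = 0 then 0 else n + r) (mset_set {1..<n})
      = image_mset ((+) n) (mset_set {1..<n})"
    by (rule image_mset_cong) auto
  also have "\<dots> = mset_set ((+) n ` {1..<n})"
    by (rule image_mset_mset_set) simp
  also have "(+) n ` {1..<n} = {n + 1..2 * n - 1}"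
    using assms by auto
  finally show ?thesis .
qed

theorem free_cone_Cat:
  assumes "n \<ge> 1"
  shows "free_with_exponents (arr_cone (Cat n)) ({#0, 1#} + mset_set {n + 1..2 * n - 1})"
proof -
  have "free_with_exponents (arr_cone (gain_arr {1..n} (wdig_gains (complete_dig n))))
      (add_mset 1 (image_mset (\<lambda>r. if r = 0 then 0 else n + r) (mset_set {..<n})))"
  proof (rule complete_dig.free_cone[where P = "Cat_poly n" and p = "spaced_point n", unfolded vertices_complete_dig])
    show "\<forall>r\<in>{..<n}. w r = 0"
      if "\<And>i. i \<in> {1..n} \<Longrightarrow>
        (\<Sum>r<n. w r * point_eval (affine_point (spaced_point n)) (poly (Cat_poly n r) (xvar i))) = 0" for w
      using Cat_polys_independent[OF that] by simp
  qed (use logarithmic_Cat_poly poly_homogeneous_Cat_poly card_complete_gains[OF assms] in simp_all)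
  then show ?thesis
    using assms by (simp add: image_mset_Cat_degrees Cat_eq_wdig_arr wdig_arr_eq_gain_arr add_mset_commute)
qed

section \<open>Solutions of gain equations\<close>

inductive_set gain_walks :: "('v \<times> 'v \<times> int) set \<Rightarrow> ('v \<times> 'v \<times> int) set" for B where
  walk_refl: "(i, i, 0) \<in> gain_walks B"
| walk_edge: "(i, j, c) \<in> B \<Longrightarrow> (i, j, c) \<in> gain_walks B"
| walk_sym: "(i, j, c) \<in> gain_walks B \<Longrightarrow> (j, i, - c) \<in> gain_walks B"
| walk_trans: "(i, j, c) \<in> gain_walks B \<Longrightarrow> (j, k, d) \<in> gain_walks B \<Longrightarrow> (i, k, c + d) \<in> gain_walks B"

definition balanced :: "('v \<times> 'v \<times> int) set \<Rightarrow> bool" where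
  "balanced B \<longleftrightarrow> (\<forall>i c. (i, i, c) \<in> gain_walks B \<longrightarrow> c = 0)"

definition component_root :: "(nat \<times> nat \<times> int) set \<Rightarrow> nat \<Rightarrow> nat" where
  "component_root B i = (LEAST j. \<exists>c. (i, j, c) \<in> gain_walks B)"

definition potential :: "(nat \<times> nat \<times> int) set \<Rightarrow> nat \<Rightarrow> int" where
  "potential B i = (SOME c. (i, component_root B i, c) \<in> gain_walks B)"

lemma walk_to_component_root: "(i, component_root B i, potential B i) \<in> gain_walks B"
proof -
  have "\<exists>c. (i, component_root B i, c) \<in> gain_walks B"
    unfolding component_root_def by (rule LeastI[of _ i]) (blast intro: walk_refl)
  then show ?thesis
    unfolding potential_def by (rule someI_ex)
qed

lemma walk_imp_component_root_eq:
  assumes "(i, j, c) \<in> gain_walks B"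
  shows "component_root B i = component_root B j"
proof -
  have "(\<exists>d. (i, k, d) \<in> gain_walks B) \<longleftrightarrow> (\<exists>d. (j, k, d) \<in> gain_walks B)" for k
    using assms by (meson walk_sym walk_trans)
  then show ?thesis by (simp add: component_root_def)
qed

lemma component_root_idem [simp]: "component_root B (component_root B i) = component_root B i"
  using walk_imp_component_root_eq[OF walk_to_component_root] by metis

lemma component_root_0 [simp]: "component_root B 0 = 0"
proof -
  have "component_root B 0 \<le> 0"
    unfolding component_root_def by (rule Least_le) (blast intro: walk_refl)
  then show ?thesis by simp
qed

lemma balanced_walk_unique:
  assumes "balanced B" "(i, j, c) \<in> gain_walks B" "(i, j, d) \<in> gain_walks B"
  shows "c = d"
proof -
  have "(i, i, c + - d) \<in> gain_walks B"
    using assms by (blast intro: walk_sym walk_trans)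
  then have "c + - d = 0" using assms(1) unfolding balanced_def by blast
  then show ?thesis by simp
qed

lemma balanced_walk_potential:
  assumes "balanced B" "(i, j, c) \<in> gain_walks B"
  shows "potential B i = c + potential B j"
proof -
  have "(i, component_root B j, c + potential B j) \<in> gain_walks B"
    using assms(2) walk_to_component_root by (rule walk_trans)
  then show ?thesis
    using balanced_walk_unique[OF assms(1) walk_to_component_root] walk_imp_component_root_eq[OF assms(2)]
    by metis
qed

lemma potential_component_root [simp]: "balanced B \<Longrightarrow> potential B (component_root B i) = 0"
  using balanced_walk_potential[OF _ walk_to_component_root, of B i] by simp

lemma walk_within:
  assumes "(i, j, c) \<in> gain_walks B" and "\<And>i j c. (i, j, c) \<in> B \<Longrightarrow> i \<in> E \<and> j \<in> E"
  shows "i = j \<or> i \<in> E \<and> j \<in> E"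
  using assms(1) by induction (use assms(2) in auto)

lemma component_root_within:
  assumes "\<And>i j c. (i, j, c) \<in> B \<Longrightarrow> i \<in> E \<and> j \<in> E"
  shows "i \<in> E \<Longrightarrow> component_root B i \<in> E" "i \<notin> E \<Longrightarrow> component_root B i = i"
proof -
  have "i = component_root B i \<or> i \<in> E \<and> component_root B i \<in> E"
    by (rule walk_within[OF walk_to_component_root]) (rule assms)
  then show "i \<in> E \<Longrightarrow> component_root B i \<in> E" "i \<notin> E \<Longrightarrow> component_root B i = i" by auto
qed

context
  fixes N :: "'g::ring_1 set"
  assumes zero_in_N: "0 \<in> N" and diff_in_N: "u \<in> N \<Longrightarrow> v \<in> N \<Longrightarrow> u - v \<in> N"
begin

lemma solution_on_walk:
  assumes "\<And>i j c. (i, j, c) \<in> B \<Longrightarrow> y i - y j - of_int c \<in> N" and "(i, j, c) \<in> gain_walks B"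
  shows "y i - y j - of_int c \<in> N"
  using assms(2)
proof induction
  case (walk_sym i j c)
  show ?case using diff_in_N[OF zero_in_N walk_sym.IH] by (simp add: algebra_simps)
next
  case (walk_trans i j c k d)
  show ?case using diff_in_N[OF walk_trans.IH(1) diff_in_N[OF zero_in_N walk_trans.IH(2)]]
    by (simp add: algebra_simps)
qed (use assms(1) zero_in_N in auto)

lemma balanced_solution_iff:
  assumes "balanced B"
  shows "(\<forall>(i, j, c)\<in>B. y i - y j - of_int c \<in> N)
      \<longleftrightarrow> (\<forall>i. y i - y (component_root B i) - of_int (potential B i) \<in> N)"
proof
  assume "\<forall>(i, j, c)\<in>B. y i - y j - of_int c \<in> N"
  then show "\<forall>i. y i - y (component_root B i) - of_int (potential B i) \<in> N"
    using solution_on_walk[OF _ walk_to_component_root] by fast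
next
  assume solved: "\<forall>i. y i - y (component_root B i) - of_int (potential B i) \<in> N"
  have "y i - y j - of_int c \<in> N" if "(i, j, c) \<in> B" for i j c
  proof -
    have walk: "(i, j, c) \<in> gain_walks B" using that by (rule walk_edge)
    have "(y i - y (component_root B i) - of_int (potential B i))
        - (y j - y (component_root B j) - of_int (potential B j)) \<in> N"
      using solved by (blast intro: diff_in_N)
    then show ?thesis
      unfolding balanced_walk_potential[OF assms walk] walk_imp_component_root_eq[OF walk]
      by (simp add: algebra_simps)
  qed
  then show "\<forall>(i, j, c)\<in>B. y i - y j - of_int c \<in> N" by blast
qed

lemma solution_imp_closed_walk_in_N:
  assumes "\<forall>(i, j, c)\<in>B. y i - y j - of_int c \<in> N" "(i, i, d) \<in> gain_walks B"
  shows "of_int d \<in> N"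
proof -
  have "y i - y i - of_int d \<in> N"
    using solution_on_walk[OF _ assms(2), of y] assms(1) by blast
  then show ?thesis using diff_in_N[OF zero_in_N] by fastforce
qed

end

definition gain_sol :: "nat set \<Rightarrow> (nat \<times> nat \<times> int) set \<Rightarrow> (nat \<Rightarrow>\<^sub>0 real) set" where
  "gain_sol I B = {x \<in> rspace I. \<forall>(i, j, c)\<in>B. lookup x i - lookup x j = of_int c}"

lemma gain_sol_eq:
  assumes "balanced B"
  shows "gain_sol I B
      = {x \<in> rspace I. \<forall>i. lookup x (component_root B i) = lookup x i - of_int (potential B i)}"
proof -
  have "(\<forall>(i, j, c)\<in>B. lookup x i - lookup x j - of_int c \<in> {0})
      \<longleftrightarrow> (\<forall>i. lookup x i - lookup x (component_root B i) - of_int (potential B i) \<in> {0})" for x :: "nat \<Rightarrow>\<^sub>0 real"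
    using assms by (intro balanced_solution_iff) auto
  then show ?thesis by (simp add: gain_sol_def) (simp add: algebra_simps eq_commute)
qed

lemma gain_sol_unbalanced:
  assumes "(i, i, d) \<in> gain_walks B" "d \<noteq> 0"
  shows "gain_sol I B = {}"
proof -
  have "x \<notin> gain_sol I B" for x
  proof
    assume "x \<in> gain_sol I B"
    then have "\<forall>(i, j, c)\<in>B. lookup x i - lookup x j - of_int c \<in> {0}" by (auto simp: gain_sol_def)
    then show False using solution_imp_closed_walk_in_N[of "{0::real}" B "lookup x"] assms by simp
  qed
  then show ?thesis by blast
qed

lemma lookup_sum_single:
  "finite K \<Longrightarrow> lookup (\<Sum>m\<in>K. single m (f m)) k = (if k \<in> K then f k else (0::real))"
  by (simp add: lookup_sum lookup_single when_def)

lemma rspace_sum_single: "finite I \<Longrightarrow> (\<Sum>m\<in>I. single m (f m :: real)) \<in> rspace I"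
  by (simp add: rspace_iff lookup_sum_single)

lemma inj_on_single_1: "inj_on (\<lambda>i. single i (1::real)) R"
  by (rule inj_onI) (metis lookup_single_eq lookup_single_not_eq zero_neq_one)

lemma span_single:
  fixes R :: "'v set"
  assumes "finite R"
  shows "span ((\<lambda>i. single i (1::real)) ` R) = rspace R"
proof (intro subset_antisym span_minimal subspace_rspace subsetI)
  fix x :: "'v \<Rightarrow>\<^sub>0 real" assume "x \<in> rspace R"
  then have "x = (\<Sum>i\<in>R. single i (lookup x i))"
    using assms by (intro poly_mapping_eqI) (simp add: lookup_sum_single lookup_rspace_0)
  moreover have "single i (lookup x i) = lookup x i *\<^sub>R single i 1" for i
    by (rule poly_mapping_eqI) (simp add: lookup_scaleR lookup_single when_def)
  ultimately have "x = (\<Sum>i\<in>R. lookup x i *\<^sub>R single i 1)" by simp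
  moreover have "\<dots> \<in> span ((\<lambda>i. single i 1) ` R)"
    by (intro span_sum span_scale span_base) auto
  ultimately show "x \<in> span ((\<lambda>i. single i (1::real)) ` R)" by simp
qed (auto simp: rspace_iff lookup_single when_def)

lemma independent_single:
  fixes R :: "'v set"
  assumes "finite R"
  shows "independent ((\<lambda>i. single i (1::real)) ` R)"
proof (rule independent_if_scalars_zero)
  fix f :: "('v \<Rightarrow>\<^sub>0 real) \<Rightarrow> real" and x :: "'v \<Rightarrow>\<^sub>0 real"
  assume "(\<Sum>x\<in>(\<lambda>i. single i (1::real)) ` R. f x *\<^sub>R x) = 0" "x \<in> (\<lambda>i. single i 1) ` R"
  then obtain i where i: "i \<in> R" "x = single i 1" and "(\<Sum>k\<in>R. f (single k 1) *\<^sub>R single k (1::real)) = 0"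
    by (auto simp: sum.reindex[OF inj_on_single_1])
  moreover have "f (single k 1) *\<^sub>R single k (1::real) = single k (f (single k 1))" for k
    by (rule poly_mapping_eqI) (simp add: lookup_scaleR lookup_single when_def)
  ultimately have "lookup (\<Sum>k\<in>R. single k (f (single k 1))) i = 0" by simp
  then show "f x = 0"
    using i assms by (simp add: lookup_sum_single)
qed (use assms in simp)

lemma dim_linear_image_rspace:
  assumes f: "linear f" "inj_on f (rspace R)" and "finite R"
  shows "dim (f ` rspace R) = card R"
proof -
  let ?B = "(\<lambda>i. single i (1::real)) ` R"
  have "inj_on f ?B"
    using f(2) by (rule inj_on_subset) (auto simp: rspace_iff lookup_single when_def)
  then have "card R = card (f ` ?B)" by (simp add: card_image inj_on_single_1)
  moreover have "independent (f ` ?B)"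
    using f independent_single[OF \<open>finite R\<close>]
    by (intro linear_independent_injective_image) (simp_all add: span_single[OF \<open>finite R\<close>])
  moreover have "span (f ` ?B) = f ` rspace R"
    using linear_span_image[OF f(1)] span_single[OF \<open>finite R\<close>] by metis
  ultimately show ?thesis by (metis dim_eq_card dim_span)
qed

lemma flat_dim_translate:
  assumes "subspace W"
  shows "flat_dim ((+) x ` W) = dim W"
proof -
  have "{u - v | u v. u \<in> (+) x ` W \<and> v \<in> (+) x ` W} = W"
  proof (intro subset_antisym subsetI)
    fix w assume "w \<in> W"
    moreover have "w = (x + w) - (x + 0)" by simp
    ultimately show "w \<in> {u - v | u v. u \<in> (+) x ` W \<and> v \<in> (+) x ` W}"
      using subspace_0[OF assms] by blast
  qed (use subspace_diff[OF assms] in auto)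
  then show ?thesis by (simp add: flat_dim_def)
qed

text \<open>Points of \<open>(\<int>/q)\<^sup>I\<close> as functions with values in \<open>{0..<q}\<close>, extended by \<open>0\<close>.\<close>

definition mod_points :: "nat set \<Rightarrow> nat \<Rightarrow> (nat \<Rightarrow> int) set" where
  "mod_points I q = {y. (\<forall>i\<in>I. y i \<in> {0..<int q}) \<and> (\<forall>i. i \<notin> I \<longrightarrow> y i = 0)}"

definition mod_sol :: "nat set \<Rightarrow> nat \<Rightarrow> (nat \<times> nat \<times> int) set \<Rightarrow> (nat \<Rightarrow> int) set" where
  "mod_sol I q B = {y \<in> mod_points I q. \<forall>(i, j, c)\<in>B. int q dvd y i - y j - c}"

definition mod_complement :: "nat set \<Rightarrow> nat \<Rightarrow> (nat \<times> nat \<times> int) set \<Rightarrow> (nat \<Rightarrow> int) set" where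
  "mod_complement I q T = {y \<in> mod_points I q. \<forall>(i, j, c)\<in>T. \<not> int q dvd y i - y j - c}"

lemma mod_pointsD:
  assumes "y \<in> mod_points I q"
  shows "i \<in> I \<Longrightarrow> 0 \<le> y i \<and> y i < int q" "i \<notin> I \<Longrightarrow> y i = 0"
  using assms by (auto simp: mod_points_def)

lemma mod_points_bounds: "q > 0 \<Longrightarrow> y \<in> mod_points I q \<Longrightarrow> 0 \<le> y i \<and> y i < int q"
  by (cases "i \<in> I") (auto simp: mod_points_def)

lemma bij_betw_restrict_mod_points:
  "bij_betw (\<lambda>y. restrict y I) (mod_points I q) (I \<rightarrow>\<^sub>E {0..<int q})"
  by (rule bij_betw_byWitness[where f' = "\<lambda>u i. if i \<in> I then u i else 0"])
    (auto simp: mod_points_def fun_eq_iff PiE_def extensional_def Pi_def)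

lemma finite_mod_points: "finite I \<Longrightarrow> finite (mod_points I q)"
  using bij_betw_finite[OF bij_betw_restrict_mod_points] by (simp add: finite_PiE)

lemma card_mod_points: "finite I \<Longrightarrow> card (mod_points I q) = q ^ card I"
  using bij_betw_same_card[OF bij_betw_restrict_mod_points, of I q] by (simp add: card_funcsetE)

lemma mod_sol_eq:
  assumes "balanced B"
  shows "mod_sol I q B = {y \<in> mod_points I q. \<forall>i. int q dvd y i - y (component_root B i) - potential B i}"
proof -
  have "0 \<in> {d. int q dvd d}" "\<And>u v. u \<in> {d. int q dvd d} \<Longrightarrow> v \<in> {d. int q dvd d} \<Longrightarrow> u - v \<in> {d. int q dvd d}"
    by auto
  from balanced_solution_iff[OF this assms] show ?thesis by (simp add: mod_sol_def)
qed

lemma mod_sol_unbalanced: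
  assumes "(i, i, d) \<in> gain_walks B" "d \<noteq> 0" "int q > \<bar>d\<bar>"
  shows "mod_sol I q B = {}"
proof -
  have "y \<notin> mod_sol I q B" for y
  proof
    assume "y \<in> mod_sol I q B"
    then have "\<forall>(i, j, c)\<in>B. y i - y j - of_int c \<in> {d. int q dvd d}" by (auto simp: mod_sol_def)
    then have "of_int d \<in> {d. int q dvd d}"
      using solution_imp_closed_walk_in_N[of "{d. int q dvd d}" B y, OF _ _ _ assms(1)] by simp
    then show False using assms dvd_imp_le_int[of d "int q"] by simp
  qed
  then show ?thesis by blast
qed

context
  fixes I :: "nat set" and B :: "(nat \<times> nat \<times> int) set"
  assumes finite_I: "finite I" and zero_notin_I: "0 \<notin> I"
    and B_within: "(i, j, c) \<in> B \<Longrightarrow> i \<in> insert 0 I \<and> j \<in> insert 0 I"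
begin

lemma component_root_in_I: "i \<in> I \<Longrightarrow> component_root B i \<in> insert 0 I"
  by (rule component_root_within(1)) (use B_within in auto)

lemma component_root_notin_I [simp]: "i \<notin> I \<Longrightarrow> component_root B i = i"
  using component_root_within(2)[of B "insert 0 I" i] B_within by (cases "i = 0") auto

context
  assumes balanced: "balanced B"
begin

lemma potential_notin_I: "i \<notin> I \<Longrightarrow> potential B i = 0"
  using potential_component_root[OF balanced, of i] by simp

definition component_constant :: "(nat \<Rightarrow>\<^sub>0 real) set" where
  "component_constant = {w \<in> rspace I. \<forall>i. lookup w (component_root B i) = lookup w i}"

lemma subspace_component_constant: "subspace component_constant"
  using subspace_rspace[of I] by (auto simp: component_constant_def subspace_def lookup_add lookup_scaleR)

lemma dim_component_constant: "dim component_constant = card {i \<in> I. component_root B i = i}"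
proof -
  let ?R = "{i \<in> I. component_root B i = i}"
  define f where "f v = (\<Sum>i\<in>I. single i (lookup v (component_root B i)))" for v :: "nat \<Rightarrow>\<^sub>0 real"
  have lookup_f: "lookup (f v) i = (if i \<in> I then lookup v (component_root B i) else 0)" for v i
    unfolding f_def using finite_I by (rule lookup_sum_single)
  have "linear f"
    by (rule linearI; rule poly_mapping_eqI) (auto simp: lookup_f lookup_add lookup_scaleR)
  moreover have "inj_on f (rspace ?R)"
  proof (intro inj_onI poly_mapping_eqI)
    fix u v i assume "u \<in> rspace ?R" "v \<in> rspace ?R" "f u = f v"
    then show "lookup u i = lookup v i"
      using arg_cong[of "f u" "f v" "\<lambda>w. lookup w i", unfolded lookup_f]
      by (cases "i \<in> ?R") (auto simp: rspace_iff)
  qed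
  moreover have "component_constant = f ` rspace ?R"
  proof (intro subset_antisym subsetI)
    fix w assume w: "w \<in> component_constant"
    let ?v = "\<Sum>i\<in>?R. single i (lookup w i)"
    have "w = f ?v"
    proof (rule poly_mapping_eqI)
      fix i
      have "lookup w i = 0" if "component_root B i \<notin> I"
        using w that lookup_rspace_0[of w I "component_root B i"] by (simp add: component_constant_def)
      then show "lookup w i = lookup (f ?v) i"
        using w finite_I by (auto simp: component_constant_def lookup_f lookup_sum_single lookup_rspace_0)
    qed
    then show "w \<in> f ` rspace ?R" using finite_I by (simp add: rspace_sum_single)
  next
    fix w assume "w \<in> f ` rspace ?R"
    then obtain v where v: "v \<in> rspace ?R" "w = f v" by blast
    then have "lookup v (component_root B i) = 0" if "i \<notin> I" for i
      using that by (simp add: rspace_iff)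
    then have "lookup w (component_root B i) = lookup w i" for i
      using v component_root_in_I[of i] zero_notin_I by (auto simp: lookup_f rspace_iff)
    then show "w \<in> component_constant" using v by (auto simp: component_constant_def lookup_f rspace_iff)
  qed
  ultimately show ?thesis using finite_I by (simp add: dim_linear_image_rspace)
qed

lemma gain_sol_eq_translate:
  obtains x where "x \<in> gain_sol I B" "gain_sol I B = (+) x ` component_constant"
proof
  let ?x = "\<Sum>i\<in>I. single i (real_of_int (potential B i))"
  have lookup_x: "lookup ?x i = of_int (potential B i)" for i
    using finite_I potential_notin_I by (simp add: lookup_sum_single)
  show x: "?x \<in> gain_sol I B"
    using rspace_sum_single[OF finite_I] balanced by (simp add: gain_sol_eq lookup_x)
  show "gain_sol I B = (+) ?x ` component_constant"
  proof (intro subset_antisym subsetI)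
    fix y assume "y \<in> gain_sol I B"
    then have "y - ?x \<in> component_constant"
      using x balanced
      by (auto simp: component_constant_def gain_sol_eq lookup_minus lookup_x intro: rspace_diff)
    then show "y \<in> (+) ?x ` component_constant" by (intro image_eqI[of _ _ "y - ?x"]) auto
  next
    fix y assume "y \<in> (+) ?x ` component_constant"
    then show "y \<in> gain_sol I B"
      using x balanced
      by (auto simp: component_constant_def gain_sol_eq lookup_add lookup_x intro: rspace_add)
  qed
qed

lemma flat_dim_gain_sol:
  "gain_sol I B \<noteq> {}" "flat_dim (gain_sol I B) = card {i \<in> I. component_root B i = i}"
proof -
  obtain x where x: "x \<in> gain_sol I B" "gain_sol I B = (+) x ` component_constant"
    by (rule gain_sol_eq_translate)
  then show "gain_sol I B \<noteq> {}" by blast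
  show "flat_dim (gain_sol I B) = card {i \<in> I. component_root B i = i}"
    unfolding x(2) by (simp add: flat_dim_translate subspace_component_constant dim_component_constant)
qed

definition extend_from_roots :: "nat \<Rightarrow> (nat \<Rightarrow> int) \<Rightarrow> nat \<Rightarrow> int" where
  "extend_from_roots q u i = (u (component_root B i) + potential B i) mod int q"

lemma extend_from_roots_mem_mod_sol:
  assumes q: "q > 0" and u: "u \<in> mod_points {i \<in> I. component_root B i = i} q"
  shows "extend_from_roots q u \<in> mod_sol I q B"
proof -
  have "extend_from_roots q u \<in> mod_points I q"
    using q mod_pointsD(2)[OF u] by (auto simp: mod_points_def extend_from_roots_def potential_notin_I)
  moreover have
      "int q dvd extend_from_roots q u i - extend_from_roots q u (component_root B i) - potential B i" for i
    using balanced mod_points_bounds[OF q u, of "component_root B i"]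
    by (simp add: extend_from_roots_def diff_diff_eq flip: mod_eq_dvd_iff)
  ultimately show ?thesis by (simp add: mod_sol_eq[OF balanced])
qed

lemma mod_sol_determined_by_roots:
  assumes q: "q > 0" and y: "y \<in> mod_sol I q B"
  shows "y i = (y (component_root B i) + potential B i) mod int q"
proof -
  have points: "y \<in> mod_points I q" and "int q dvd y i - (y (component_root B i) + potential B i)"
    using y unfolding mod_sol_eq[OF balanced] by (auto simp: diff_diff_eq)
  then have "y i mod int q = (y (component_root B i) + potential B i) mod int q" by (simp add: mod_eq_dvd_iff)
  then show ?thesis using mod_points_bounds[OF q points, of i] by simp
qed

lemma card_mod_sol_balanced:
  assumes q: "q > 0"
  shows "card (mod_sol I q B) = q ^ card {i \<in> I. component_root B i = i}"
proof -
  let ?R = "{i \<in> I. component_root B i = i}"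
  have "bij_betw (extend_from_roots q) (mod_points ?R q) (mod_sol I q B)"
  proof (rule bij_betw_byWitness[where f' = "\<lambda>y i. if i \<in> ?R then y i else 0"])
    show "\<forall>u\<in>mod_points ?R q. (\<lambda>i. if i \<in> ?R then extend_from_roots q u i else 0) = u"
    proof (intro ballI ext)
      fix u i assume u: "u \<in> mod_points ?R q"
      show "(if i \<in> ?R then extend_from_roots q u i else 0) = u i"
      proof (cases "i \<in> ?R")
        case True
        then have "potential B i = 0" using potential_component_root[OF balanced, of i] by simp
        then show ?thesis using True mod_points_bounds[OF q u] by (simp add: extend_from_roots_def)
      qed (use mod_pointsD(2)[OF u, of i] in auto)
    qed
    show "\<forall>y\<in>mod_sol I q B. extend_from_roots q (\<lambda>i. if i \<in> ?R then y i else 0) = y"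
    proof (intro ballI ext)
      fix y i assume y: "y \<in> mod_sol I q B"
      then have "y (component_root B i) = 0" if "component_root B i \<notin> ?R"
        using that mod_pointsD(2)[of y I q] by (simp add: mod_sol_def)
      then show "extend_from_roots q (\<lambda>i. if i \<in> ?R then y i else 0) i = y i"
        using mod_sol_determined_by_roots[OF q y, of i] by (auto simp: extend_from_roots_def)
    qed
    show "extend_from_roots q ` mod_points ?R q \<subseteq> mod_sol I q B"
      using extend_from_roots_mem_mod_sol[OF q] by blast
  qed (auto simp: mod_sol_def mod_points_def)
  then show ?thesis
    using bij_betw_same_card card_mod_points[of ?R q] finite_I by fastforce
qed

end

theorem card_mod_sol:
  "\<exists>b. \<forall>q>b. card (mod_sol I q B) = (if gain_sol I B = {} then 0 else q ^ flat_dim (gain_sol I B))"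
proof (cases "balanced B")
  case True
  then show ?thesis
    using flat_dim_gain_sol card_mod_sol_balanced by (intro exI[of _ 0]) auto
next
  case False
  then obtain i d where "(i, i, d) \<in> gain_walks B" "d \<noteq> 0" by (auto simp: balanced_def)
  then show ?thesis
    using gain_sol_unbalanced mod_sol_unbalanced by (intro exI[of _ "nat \<bar>d\<bar>"]) auto
qed

end

section \<open>The finite field method\<close>

lemma sum_moebius:
  assumes L: "finite L" "V \<in> L" "\<And>Y. Y \<in> L \<Longrightarrow> Y \<subseteq> V" and X: "X \<in> L"
  shows "(\<Sum>Y\<in>{Y \<in> L. X \<subseteq> Y}. moebius L V Y) = (if X = V then 1 else 0)"
proof -
  have "{Y \<in> L. X \<subseteq> Y} = insert X {Y \<in> L. X \<subset> Y}" using X by auto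
  then have split: "(\<Sum>Y\<in>{Y \<in> L. X \<subseteq> Y}. moebius L V Y) = moebius L V X + (\<Sum>Y\<in>{Y \<in> L. X \<subset> Y}. moebius L V Y)"
    using L(1) by simp
  show ?thesis
  proof (cases "X = V")
    case True
    then have "{Y \<in> L. X \<subset> Y} = {}" using L(3) by auto
    then show ?thesis unfolding split using True L(1) by (simp only: moebius.simps[of L V V]) simp
  next
    case False
    then show ?thesis unfolding split using L(1) by (simp add: moebius.simps[of L V X])
  qed
qed

lemma sum_moebius_card:
  assumes L: "finite L" "V \<in> L" "\<And>Y. Y \<in> L \<Longrightarrow> Y \<subseteq> V" and P: "finite P" "\<And>y. y \<in> P \<Longrightarrow> X y \<in> L"
  shows "(\<Sum>Y\<in>L. moebius L V Y * int (card {y \<in> P. X y \<subseteq> Y})) = int (card {y \<in> P. X y = V})"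
proof -
  have "(\<Sum>Y\<in>L. moebius L V Y * int (card {y \<in> P. X y \<subseteq> Y}))
      = (\<Sum>Y\<in>L. \<Sum>y\<in>P. if X y \<subseteq> Y then moebius L V Y else 0)"
    using P(1) by (simp add: sum.If_cases Int_def mult.commute)
  also have "\<dots> = (\<Sum>y\<in>P. \<Sum>Y\<in>L. if X y \<subseteq> Y then moebius L V Y else 0)" by (rule sum.swap)
  also have "\<dots> = (\<Sum>y\<in>P. if X y = V then 1 else 0)"
  proof (rule sum.cong[OF refl])
    fix y assume "y \<in> P"
    then show "(\<Sum>Y\<in>L. if X y \<subseteq> Y then moebius L V Y else 0) = (if X y = V then 1 else 0)"
      using sum_moebius[of L V "X y"] L P(2) by (simp add: sum.inter_filter[symmetric])
  qed
  also have "\<dots> = int (card {y \<in> P. X y = V})" using P(1) by (simp add: sum.If_cases Int_def)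
  finally show ?thesis .
qed

lemma flats_gain_arr: "flats (gain_arr I T) = gain_sol I ` Pow T - {{}}"
proof -
  have "rspace I \<inter> \<Inter>(gain_hyp I ` B) = gain_sol I B" for B
    by (auto simp: gain_sol_def gain_hyp_def)
  then have "{rspace I \<inter> \<Inter>B | B. B \<subseteq> gain_hyp I ` T} = gain_sol I ` Pow T"
    unfolding subset_image_iff by (auto simp: image_iff)
  then show ?thesis by (simp add: flats_def)
qed

lemma gain_sol_Un: "gain_sol I (B \<union> B') = gain_sol I B \<inter> gain_sol I B'"
  by (auto simp: gain_sol_def ball_Un)

lemma mod_sol_Un: "mod_sol I q (B \<union> B') = mod_sol I q B \<inter> mod_sol I q B'"
  by (auto simp: mod_sol_def ball_Un)

context gain_graph
begin

context
  fixes q :: nat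
  assumes card_mod_sol: "B \<subseteq> T \<Longrightarrow>
    card (mod_sol I q B) = (if gain_sol I B = {} then 0 else q ^ flat_dim (gain_sol I B))"
begin

definition satisfied :: "(nat \<Rightarrow> int) \<Rightarrow> (nat \<times> nat \<times> int) set" where
  "satisfied y = {(i, j, c) \<in> T. int q dvd y i - y j - c}"

lemma satisfied_subset: "satisfied y \<subseteq> T"
  by (auto simp: satisfied_def)

lemma mem_mod_sol_iff_satisfied: "y \<in> mod_points I q \<Longrightarrow> B \<subseteq> T \<Longrightarrow> y \<in> mod_sol I q B \<longleftrightarrow> B \<subseteq> satisfied y"
  by (auto simp: mod_sol_def satisfied_def)

lemma finite_mod_sol: "finite (mod_sol I q B)"
  using finite_mod_points[OF finite_vertices] by (auto simp: mod_sol_def)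

lemma gain_sol_satisfied_flat:
  assumes "y \<in> mod_points I q"
  shows "gain_sol I (satisfied y) \<in> flats (gain_arr I T)"
proof -
  have "y \<in> mod_sol I q (satisfied y)"
    using mem_mod_sol_iff_satisfied[OF assms satisfied_subset] by simp
  then have "card (mod_sol I q (satisfied y)) \<noteq> 0" using finite_mod_sol by auto
  then have "gain_sol I (satisfied y) \<noteq> {}" using card_mod_sol[OF satisfied_subset] by auto
  then show ?thesis unfolding flats_gain_arr using satisfied_subset by auto
qed

text \<open>If \<open>B\<close> cuts out a larger flat than the gains satisfied by \<open>y\<close>, adding \<open>B\<close> to the latter does not
  change the number of solutions.\<close>

lemma mem_mod_sol_iff_subset:
  assumes y: "y \<in> mod_points I q" and B: "B \<subseteq> T"
  shows "y \<in> mod_sol I q B \<longleftrightarrow> gain_sol I (satisfied y) \<subseteq> gain_sol I B"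
proof
  assume "y \<in> mod_sol I q B"
  then show "gain_sol I (satisfied y) \<subseteq> gain_sol I B"
    using mem_mod_sol_iff_satisfied[OF y B] by (auto simp: gain_sol_def)
next
  assume "gain_sol I (satisfied y) \<subseteq> gain_sol I B"
  then have "gain_sol I (satisfied y \<union> B) = gain_sol I (satisfied y)"
    by (auto simp: gain_sol_Un)
  then have "card (mod_sol I q (satisfied y \<union> B)) = card (mod_sol I q (satisfied y))"
    using card_mod_sol satisfied_subset B by simp
  then have "mod_sol I q (satisfied y \<union> B) = mod_sol I q (satisfied y)"
    using finite_mod_sol by (intro card_subset_eq) (auto simp: mod_sol_Un)
  moreover have "y \<in> mod_sol I q (satisfied y)"
    using mem_mod_sol_iff_satisfied[OF y satisfied_subset] by simp
  ultimately show "y \<in> mod_sol I q B" by (auto simp: mod_sol_Un)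
qed

lemma gain_sol_eq_rspace_iff:
  assumes "B \<subseteq> T"
  shows "gain_sol I B = rspace I \<longleftrightarrow> B = {}"
proof
  assume whole: "gain_sol I B = rspace I"
  show "B = {}"
  proof (rule equals0I)
    fix t assume "t \<in> B"
    then obtain i j c where t: "(i, j, c) \<in> B" by (cases t) auto
    then have ij: "i \<in> I" "i \<noteq> j" using gain_ends assms by blast+
    then have "single i (of_int c + 1 :: real) \<in> gain_sol I B"
      unfolding whole by (auto simp: rspace_iff lookup_single when_def)
    then have "lookup (single i (of_int c + 1 :: real)) i - lookup (single i (of_int c + 1 :: real)) j
        = of_int c"
      using t by (auto simp: gain_sol_def)
    then show False using ij by (simp add: lookup_single when_def)
  qed
qed (simp add: gain_sol_def)

lemma char_poly_eq_card_complement: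
  "poly (arr_char_poly (gain_arr I T)) (int q) = int (card (mod_complement I q T))"
proof -
  let ?L = "flats (gain_arr I T)" and ?X = "\<lambda>y. gain_sol I (satisfied y)"
  have count: "int q ^ flat_dim Y = int (card {y \<in> mod_points I q. ?X y \<subseteq> Y})" if Y: "Y \<in> ?L" for Y
  proof -
    obtain B where B: "B \<subseteq> T" "Y = gain_sol I B" "Y \<noteq> {}" using Y unfolding flats_gain_arr by auto
    have "mod_sol I q B \<subseteq> mod_points I q" by (auto simp: mod_sol_def)
    then have "{y \<in> mod_points I q. ?X y \<subseteq> Y} = mod_sol I q B"
      using mem_mod_sol_iff_subset[OF _ B(1)] B(2) by blast
    then show ?thesis using card_mod_sol[OF B(1)] B by simp
  qed
  have "poly (arr_char_poly (gain_arr I T)) (int q) = (\<Sum>Y\<in>?L. moebius ?L (rspace I) Y * int q ^ flat_dim Y)"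
    by (simp add: arr_char_poly_def poly_sum poly_monom)
  also have "\<dots> = (\<Sum>Y\<in>?L. moebius ?L (rspace I) Y * int (card {y \<in> mod_points I q. ?X y \<subseteq> Y}))"
    by (intro sum.cong refl) (simp only: count)
  also have "\<dots> = int (card {y \<in> mod_points I q. ?X y = rspace I})"
  proof (rule sum_moebius_card)
    show "finite ?L" unfolding flats_gain_arr using finite_gains by simp
    have "0 \<in> rspace I" by (simp add: rspace_iff)
    moreover have "rspace I = gain_sol I {}" by (simp add: gain_sol_def)
    ultimately show "rspace I \<in> ?L" unfolding flats_gain_arr by blast
    show "Y \<subseteq> rspace I" if "Y \<in> ?L" for Y
      using that unfolding flats_gain_arr by (auto simp: gain_sol_def)
  qed (use finite_mod_points[OF finite_vertices] gain_sol_satisfied_flat in auto)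
  also have "{y \<in> mod_points I q. ?X y = rspace I} = mod_complement I q T"
    unfolding gain_sol_eq_rspace_iff[OF satisfied_subset] by (auto simp: satisfied_def mod_complement_def)
  finally show ?thesis .
qed

end

theorem finite_field_method:
  "\<exists>b. \<forall>q>b. poly (arr_char_poly (gain_arr I T)) (int q) = int (card (mod_complement I q T))"
proof -
  have "\<exists>b. \<forall>q>b. card (mod_sol I q B) = (if gain_sol I B = {} then 0 else q ^ flat_dim (gain_sol I B))"
    if "B \<subseteq> T" for B
    using gain_ends that by (intro card_mod_sol[OF finite_vertices ground_notin]) blast
  then obtain b where b: "\<And>B q. B \<subseteq> T \<Longrightarrow> q > b B \<Longrightarrow>
      card (mod_sol I q B) = (if gain_sol I B = {} then 0 else q ^ flat_dim (gain_sol I B))" by metis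
  define bound where "bound = Max (b ` Pow T)"
  have "b B \<le> bound" if "B \<subseteq> T" for B
    using that finite_gains by (auto simp: bound_def)
  then have "card (mod_sol I q B) = (if gain_sol I B = {} then 0 else q ^ flat_dim (gain_sol I B))"
    if "q > bound" "B \<subseteq> T" for q B
    using that b order.strict_trans1 by blast
  then show ?thesis
    using char_poly_eq_card_complement by blast
qed

end

section \<open>Counting the points off the hyperplanes\<close>

definition colors :: "nat wdigraph \<Rightarrow> nat \<Rightarrow> nat \<Rightarrow> int set" where
  "colors G q i = {snd (weight G i)<..<int q + fst (weight G i)}"

definition colorings :: "nat wdigraph \<Rightarrow> nat \<Rightarrow> (nat \<Rightarrow> int) set" where
  "colorings G q = {y. (\<forall>i. i \<notin> vertices G \<longrightarrow> y i = 0) \<and> (\<forall>i\<in>vertices G. y i \<in> colors G q i)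
     \<and> inj_on y (vertices G) \<and> (\<forall>(i, j)\<in>edges G. y i - y j \<noteq> 1)}"

lemma mem_colors [simp]: "c \<in> colors G q i \<longleftrightarrow> snd (weight G i) < c \<and> c < int q + fst (weight G i)"
  and finite_colors: "finite (colors G q i)"
  and card_colors: "card (colors G q i) = nat (int q + fst (weight G i) - snd (weight G i) - 1)"
  by (auto simp: colors_def)

lemma coloringsD:
  assumes "y \<in> colorings G q"
  shows "i \<notin> vertices G \<Longrightarrow> y i = 0"
    and "i \<in> vertices G \<Longrightarrow> y i \<in> colors G q i"
    and "inj_on y (vertices G)" and "(i, j) \<in> edges G \<Longrightarrow> y i - y j \<noteq> 1"
  using assms by (auto simp: colorings_def)

lemma not_dvd_if_abs_less:
  fixes d n :: int
  assumes "d \<noteq> 0" "\<bar>d\<bar> < n"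
  shows "\<not> n dvd d"
  using dvd_imp_le_int[OF assms(1)] assms(2) by fastforce

context loopless_wdigraph
begin

lemma mod_complement_imp_coloring:
  assumes y: "y \<in> mod_complement (vertices G) q (wdig_gains G)"
    and weight: "\<And>i. i \<in> vertices G \<Longrightarrow> fst (weight G i) \<le> 0 \<and> 0 \<le> snd (weight G i)"
  shows "y \<in> colorings G q"
proof -
  have points: "y \<in> mod_points (vertices G) q"
    using y by (simp add: mod_complement_def)
  have not_dvd: "\<not> int q dvd y i - y j - c" if "(i, j, c) \<in> wdig_gains G" for i j c
    using y that by (auto simp: mod_complement_def)
  have "y i \<in> colors G q i" if i: "i \<in> vertices G" for i
  proof -
    have y_0: "y 0 = 0" using mod_pointsD(2)[OF points zero_notin_verts] .
    have "y i \<notin> {fst (weight G i)..snd (weight G i)}"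
      using not_dvd[of i 0 "y i"] i y_0 by (auto simp: mem_wdig_gains)
    moreover have "y i - int q \<notin> {fst (weight G i)..snd (weight G i)}"
      using not_dvd[of i 0 "y i - int q"] i y_0 by (auto simp: mem_wdig_gains)
    ultimately show ?thesis
      using mod_pointsD(1)[OF points i] weight[OF i] by auto
  qed
  moreover have "inj_on y (vertices G)"
  proof (rule linorder_inj_onI)
    show "y i \<noteq> y j" if "i < j" "i \<in> vertices G" "j \<in> vertices G" for i j
      using not_dvd[of i j 0] that by (auto simp: mem_wdig_gains)
  qed auto
  moreover have "y i - y j \<noteq> 1" if "(i, j) \<in> edges G" for i j
    using not_dvd[of i j 1] that by (auto simp: mem_wdig_gains)
  ultimately show ?thesis
    using mod_pointsD(2)[OF points] unfolding colorings_def by blast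
qed

lemma coloring_imp_mod_complement:
  assumes y: "y \<in> colorings G q"
    and weight: "\<And>i. i \<in> vertices G \<Longrightarrow> fst (weight G i) \<le> 0 \<and> 0 \<le> snd (weight G i)"
  shows "y \<in> mod_complement (vertices G) q (wdig_gains G)"
proof -
  have bounds: "0 < y i \<and> y i < int q" if "i \<in> vertices G" for i
    using coloringsD(2)[OF y that] weight[OF that] by auto
  have "\<not> int q dvd y i - y j - c" if "(i, j, c) \<in> wdig_gains G" for i j c
    using that
  proof (cases rule: wdig_gains_cases)
    case equal
    then have "y i \<noteq> y j" using inj_onD[OF coloringsD(3)[OF y]] by blast
    then show ?thesis using equal bounds[of i] bounds[of j] by (intro not_dvd_if_abs_less) auto
  next
    case edge
    then have "i \<in> vertices G" "j \<in> vertices G" using edge_ends by auto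
    then show ?thesis
      using edge bounds[of i] bounds[of j] coloringsD(4)[OF y edge(2)] by (intro not_dvd_if_abs_less) auto
  next
    case weight
    then show ?thesis
      using coloringsD(1)[OF y zero_notin_verts] coloringsD(2)[OF y weight(2)]
      by (intro not_dvd_if_abs_less) auto
  qed
  then show ?thesis
    using bounds coloringsD(1)[OF y] by (fastforce simp: mod_complement_def mod_points_def)
qed

lemma mod_complement_eq_colorings:
  assumes "\<And>i. i \<in> vertices G \<Longrightarrow> fst (weight G i) \<le> 0 \<and> 0 \<le> snd (weight G i)"
  shows "mod_complement (vertices G) q (wdig_gains G) = colorings G q"
  using mod_complement_imp_coloring coloring_imp_mod_complement assms by blast

end

lemma vertices_induced [simp]: "vertices (induced G U) = U"
  and edges_induced [simp]: "edges (induced G U) = edges G \<inter> U \<times> U"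
  and weight_induced [simp]: "i \<in> U \<Longrightarrow> weight (induced G U) i = weight G i"
  by (simp_all add: induced_def)

lemma colors_induced: "i \<in> U \<Longrightarrow> colors (induced G U) q i = colors G q i"
  by (simp add: colors_def)

lemma induced_induced: "U \<subseteq> W \<Longrightarrow> induced (induced G W) U = induced G U"
  by (auto simp: induced_def Int_absorb1)

lemma (in loopless_wdigraph) colorings_induced_vertices:
  "colorings (induced G (vertices G)) q = colorings G q"
proof -
  have "edges G \<inter> vertices G \<times> vertices G = edges G" using edge_ends by auto
  then show ?thesis by (simp add: colorings_def)
qed

lemma finite_colorings:
  assumes "finite (vertices G)"
  shows "finite (colorings G q)"
proof (rule finite_subset)
  let ?C = "\<Union>i\<in>vertices G. colors G q i"
  show "colorings G q \<subseteq> {y. \<forall>i. (i \<in> vertices G \<longrightarrow> y i \<in> ?C) \<and> (i \<notin> vertices G \<longrightarrow> y i = 0)}"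
    unfolding colorings_def by blast
  show "finite {y. \<forall>i. (i \<in> vertices G \<longrightarrow> y i \<in> ?C) \<and> (i \<notin> vertices G \<longrightarrow> y i = 0)}"
    using assms finite_colors by (intro finite_set_of_finite_funs) auto
qed

context
  fixes G :: "nat wdigraph" and v :: nat
  assumes v: "isolated G v" and edges_within: "edges G \<subseteq> vertices G \<times> vertices G"
begin

lemma fun_upd_coloring_iff:
  assumes "y v = 0"
  shows "y(v := c) \<in> colorings G q
    \<longleftrightarrow> y \<in> colorings (induced G (vertices G - {v})) q \<and> c \<in> colors G q v - y ` (vertices G - {v})"
proof -
  let ?V = "vertices G - {v}"
  have V: "vertices G = insert v ?V" using v by (auto simp: isolated_def)
  have ends: "i \<in> ?V \<and> j \<in> ?V" if "(i, j) \<in> edges G" for i j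
    using that v edges_within by (auto simp: isolated_def)
  have "(\<forall>i. i \<notin> vertices G \<longrightarrow> (y(v := c)) i = 0) \<longleftrightarrow> (\<forall>i. i \<notin> ?V \<longrightarrow> y i = 0)"
    using assms V by auto
  moreover have
      "(\<forall>i\<in>vertices G. (y(v := c)) i \<in> colors G q i) \<longleftrightarrow> c \<in> colors G q v \<and> (\<forall>i\<in>?V. y i \<in> colors G q i)"
    by (subst V) auto
  moreover have "inj_on (y(v := c)) (vertices G) \<longleftrightarrow> inj_on y ?V \<and> c \<notin> y ` ?V"
    by (subst V) (auto simp: inj_on_def)
  moreover have "(\<forall>(i, j)\<in>edges G. (y(v := c)) i - (y(v := c)) j \<noteq> 1) \<longleftrightarrow> (\<forall>(i, j)\<in>edges G. y i - y j \<noteq> 1)"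
    using ends by (intro ball_cong refl) auto
  moreover have "y \<in> colorings (induced G ?V) q \<longleftrightarrow> (\<forall>i. i \<notin> ?V \<longrightarrow> y i = 0) \<and> (\<forall>i\<in>?V. y i \<in> colors G q i)
      \<and> inj_on y ?V \<and> (\<forall>(i, j)\<in>edges G. y i - y j \<noteq> 1)"
  proof -
    have "edges G \<inter> ?V \<times> ?V = edges G" using ends by auto
    then show ?thesis by (simp add: colorings_def)
  qed
  ultimately show ?thesis unfolding colorings_def[of G] mem_Collect_eq by blast
qed

lemma bij_betw_fun_upd_colorings:
  "bij_betw (\<lambda>(y, c). y(v := c))
    (SIGMA y:colorings (induced G (vertices G - {v})) q. colors G q v - y ` (vertices G - {v})) (colorings G q)"
  (is "bij_betw ?f ?P _")
proof (rule bij_betw_byWitness[where f' = "\<lambda>y. (y(v := 0), y v)"])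
  have zero: "y v = 0" if "y \<in> colorings (induced G (vertices G - {v})) q" for y
    using coloringsD(1)[OF that] by simp
  then show "\<forall>yc\<in>?P. ((?f yc)(v := 0), (?f yc) v) = yc"
    by (auto simp: fun_eq_iff)
  show "?f ` ?P \<subseteq> colorings G q"
    using fun_upd_coloring_iff zero by auto
  show "(\<lambda>y. (y(v := 0), y v)) ` colorings G q \<subseteq> ?P"
  proof (rule image_subsetI)
    fix y assume "y \<in> colorings G q"
    then show "(y(v := 0), y v) \<in> ?P"
      using fun_upd_coloring_iff[of "y(v := 0)" "y v" q] by simp
  qed
qed auto

text \<open>The color of an isolated vertex with the largest set of colors can be chosen last.\<close>

lemma card_colorings_isolated:
  assumes "finite (vertices G)" and widest: "\<And>i. i \<in> vertices G \<Longrightarrow> colors G q i \<subseteq> colors G q v"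
  shows "card (colorings G q) = (card (colors G q v) - (card (vertices G) - 1))
    * card (colorings (induced G (vertices G - {v})) q)"
proof -
  let ?V = "vertices G - {v}"
  have "card (colorings G q) = (\<Sum>y\<in>colorings (induced G ?V) q. card (colors G q v - y ` ?V))"
    using bij_betw_same_card[OF bij_betw_fun_upd_colorings, of q, symmetric] assms(1)
    by (simp add: finite_colorings finite_colors)
  also have "\<dots> = (\<Sum>y\<in>colorings (induced G ?V) q. card (colors G q v) - (card (vertices G) - 1))"
  proof (rule sum.cong[OF refl])
    fix y assume y: "y \<in> colorings (induced G ?V) q"
    have "y ` ?V \<subseteq> colors G q v"
      using coloringsD(2)[OF y] widest colors_induced[of _ ?V G q] by (simp del: mem_colors) blast
    moreover have "card (y ` ?V) = card (vertices G) - 1"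
      using coloringsD(3)[OF y] v by (simp add: card_image isolated_def card_Diff_singleton)
    ultimately show "card (colors G q v - y ` ?V) = card (colors G q v) - (card (vertices G) - 1)"
      using assms(1) by (simp add: card_Diff_subset)
  qed
  finally show ?thesis by simp
qed

end

lemma card_colorings_isolated_segment:
  fixes G :: "nat wdigraph"
  assumes "m \<le> k" "k \<le> Suc l" and isolated: "\<And>i. i \<in> {m..<k} \<Longrightarrow> isolated G i"
    and nested: "\<And>i j. i \<in> {m..<k} \<Longrightarrow> j \<in> {i..l} \<Longrightarrow> colors G q j \<subseteq> colors G q i"
  shows "card (colorings (induced G {m..l}) q)
    = (\<Prod>i = m..<k. card (colors G q i) - (l - i)) * card (colorings (induced G {k..l}) q)"
  using assms
proof (induction m rule: inc_induct)
  case (step m)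
  let ?H = "induced G {m..l}"
  have m: "m \<in> {m..<k}" "m \<in> {m..l}" using step.hyps step.prems(1) by auto
  have "card (colorings ?H q)
      = (card (colors ?H q m) - (card (vertices ?H) - 1)) * card (colorings (induced ?H (vertices ?H - {m})) q)"
  proof (rule card_colorings_isolated)
    show "isolated ?H m"
      using step.prems(2)[OF m(1)] m(2) by (simp add: isolated_def)
    show "colors ?H q i \<subseteq> colors ?H q m" if "i \<in> vertices ?H" for i
      using step.prems(3)[OF m(1)] m(2) that by (simp add: colors_induced)
  qed auto
  also have "induced ?H (vertices ?H - {m}) = induced G {Suc m..l}"
  proof -
    have "{m..l} - {m} = {Suc m..l}" by auto
    then show ?thesis using induced_induced[of "{Suc m..l}" "{m..l}" G] by simp
  qed
  also have "card (colorings (induced G {Suc m..l}) q)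
      = (\<Prod>i = Suc m..<k. card (colors G q i) - (l - i)) * card (colorings (induced G {k..l}) q)"
    using step by (intro step.IH) auto
  finally show ?case
    using m by (simp add: colors_induced prod.atLeast_Suc_lessThan mult.assoc)
qed simp

definition uniform_dig :: "nat set \<Rightarrow> nat set \<Rightarrow> int \<Rightarrow> int \<Rightarrow> nat wdigraph" where
  "uniform_dig V S a b = \<lparr> vertices = V, edges = {(i, j). i \<in> V \<and> j \<in> S \<and> i \<noteq> j},
     weight = (\<lambda>i. (- a - of_bool (i \<in> S), b)) \<rparr>"

lemma colorings_uniform_dig: "colorings (uniform_dig V S a b) q = {y. (\<forall>i. i \<notin> V \<longrightarrow> y i = 0)
     \<and> (\<forall>i\<in>V. b < y i \<and> y i < int q - a - of_bool (i \<in> S)) \<and> inj_on y V \<and> (\<forall>i\<in>V. \<forall>j\<in>S. y i - y j \<noteq> 1)}"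
proof -
  have "(\<forall>(i, j)\<in>edges (uniform_dig V S a b). y i - y j \<noteq> 1) \<longleftrightarrow> (\<forall>i\<in>V. \<forall>j\<in>S. y i - y j \<noteq> 1)"
      for y :: "nat \<Rightarrow> int"
    by (simp add: uniform_dig_def) (metis diff_self zero_neq_one)
  then show ?thesis by (simp add: colorings_def) (simp add: uniform_dig_def add_diff_eq)
qed

lemma card_spaced_le:
  fixes y :: "nat \<Rightarrow> int"
  assumes J: "finite J" "inj_on y J" and spaced: "\<And>i j. i \<in> J \<Longrightarrow> j \<in> J \<Longrightarrow> y i - y j \<noteq> 1"
    and range: "\<And>j. j \<in> J \<Longrightarrow> lo \<le> y j \<and> y j + 1 < hi" and "lo \<le> hi"
  shows "2 * int (card J) \<le> hi - lo"
proof -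
  have "y i \<noteq> y j + 1" if "i \<in> J" "j \<in> J" for i j using spaced[OF that] by auto
  then have "card (y ` J \<union> (\<lambda>j. y j + 1) ` J) = card (y ` J) + card ((\<lambda>j. y j + 1) ` J)"
    using J by (intro card_Un_disjoint) auto
  moreover have "card ((\<lambda>j. y j + 1) ` J) = card J" "card (y ` J) = card J"
    using J(2) by (auto intro!: card_image simp: inj_on_def)
  moreover have "card (y ` J \<union> (\<lambda>j. y j + 1) ` J) \<le> card {lo..<hi}"
    using range by (intro card_mono) force+
  ultimately show ?thesis using \<open>lo \<le> hi\<close> by simp
qed

text \<open>Colorings of the uniform digraph become injective maps into a shorter interval when the colors are
  lowered by the number of smaller colors in \<open>S\<close>.\<close>

context
  fixes V S :: "nat set" and a b :: int and q :: nat
  assumes finite_V: "finite V" and S: "S \<subseteq> V"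
begin

abbreviation "below z i \<equiv> int (card {j \<in> S. z j < (z i :: int)})"

definition spread :: "(nat \<Rightarrow> int) \<Rightarrow> nat \<Rightarrow> int" where
  "spread z i = (if i \<in> V then z i + below z i else 0)"

definition compress :: "(nat \<Rightarrow> int) \<Rightarrow> nat \<Rightarrow> int" where
  "compress y i = (if i \<in> V then y i - below y i else 0)"

private lemma finite_S: "finite S"
  using S finite_V by (rule finite_subset)

lemma spread_less:
  assumes "i \<in> V" "i' \<in> V" "z i < z i'"
  shows "spread z i + 1 + of_bool (i \<in> S) \<le> spread z i'"
proof -
  have "card {j \<in> S. z j < z i} + of_bool (i \<in> S) \<le> card {j \<in> S. z j < z i'}"
  proof (cases "i \<in> S")
    case True
    then have "{j \<in> S. z j < z i} \<subset> {j \<in> S. z j < z i'}" using assms by auto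
    then have "card {j \<in> S. z j < z i} < card {j \<in> S. z j < z i'}"
      by (rule psubset_card_mono[rotated]) (simp add: finite_S)
    then show ?thesis using True by simp
  next
    case False
    then show ?thesis using assms finite_S by (auto intro!: card_mono)
  qed
  then have "below z i + of_bool (i \<in> S) \<le> below z i'" by (cases "i \<in> S") auto
  then show ?thesis using assms by (simp add: spread_def)
qed

lemma spread_less_iff:
  assumes "i \<in> V" "i' \<in> V"
  shows "spread z i < spread z i' \<longleftrightarrow> z i < z i'"
proof -
  have "spread z i = spread z i'" if "z i = z i'" using that assms by (simp add: spread_def)
  then show ?thesis
    using spread_less[OF assms, of z] spread_less[OF assms(2,1), of z]
    by (cases "z i" "z i'" rule: linorder_cases) (auto simp: of_bool_def split: if_splits)
qed

lemma compress_spread: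
  assumes "z \<in> colorings (uniform_dig V S' a' b') q"
  shows "compress (spread z) = z"
proof
  fix i show "compress (spread z) i = z i"
  proof (cases "i \<in> V")
    case True
    have "{j \<in> S. spread z j < spread z i} = {j \<in> S. z j < z i}"
      using spread_less_iff[of _ i z] S True by auto
    then show ?thesis using True by (simp add: compress_def) (simp add: spread_def)
  next
    case False
    then show ?thesis using assms by (simp add: compress_def colorings_uniform_dig)
  qed
qed

lemma spread_coloring:
  assumes z: "z \<in> colorings (uniform_dig V {} (a + card S) b) q"
  shows "spread z \<in> colorings (uniform_dig V S a b) q"
proof -
  have range: "b < z i" "z i < int q - a - card S" if "i \<in> V" for i
    using z that by (auto simp: colorings_uniform_dig)
  have "spread z i < int q - a - of_bool (i \<in> S)" if i: "i \<in> V" for i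
  proof -
    have "card {j \<in> S. z j < z i} \<le> card (S - {i})" using finite_S by (intro card_mono) auto
    also have "int \<dots> = int (card S) - of_bool (i \<in> S)"
      using finite_S card_gt_0_iff[of S] by (auto simp: card_Diff_singleton_if Suc_leI)
    finally show ?thesis using range(2)[OF i] i by (simp add: spread_def)
  qed
  moreover have "inj_on (spread z) V"
  proof (rule inj_onI)
    fix i j assume ij: "i \<in> V" "j \<in> V" "spread z i = spread z j"
    then have "z i = z j" using spread_less_iff[of i j z] spread_less_iff[of j i z] by auto
    then show "i = j" using z ij by (auto simp: colorings_uniform_dig inj_on_def)
  qed
  moreover have "spread z i - spread z j \<noteq> 1" if "i \<in> V" "j \<in> S" for i j
  proof (cases "z j < z i")
    case True
    then show ?thesis using spread_less[of j i z] that S by auto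
  next
    case False
    then show ?thesis using spread_less_iff[of j i z] that S by auto
  qed
  moreover have "b < spread z i" if "i \<in> V" for i
    using range(1)[OF that] that by (simp add: spread_def)
  ultimately show ?thesis by (auto simp: colorings_uniform_dig spread_def)
qed

context
  fixes y :: "nat \<Rightarrow> int"
  assumes y: "y \<in> colorings (uniform_dig V S a b) q"
begin

lemma spaced_coloring: "i \<in> V \<Longrightarrow> j \<in> S \<Longrightarrow> y i - y j \<noteq> 1"
  and coloring_range: "i \<in> V \<Longrightarrow> b < y i \<and> y i < int q - a - of_bool (i \<in> S)"
  and inj_coloring: "inj_on y V"
  using y by (auto simp: colorings_uniform_dig)

lemma card_colors_between_le:
  assumes "J \<subseteq> S" "\<And>j. j \<in> J \<Longrightarrow> lo \<le> y j \<and> y j + 1 < hi" "lo \<le> hi"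
  shows "2 * int (card J) \<le> hi - lo"
proof (rule card_spaced_le)
  show "finite J" "inj_on y J"
    using assms(1) S finite_subset[OF _ finite_S] inj_on_subset[OF inj_coloring] by auto
  show "y i - y j \<noteq> 1" if "i \<in> J" "j \<in> J" for i j
    using that assms(1) S spaced_coloring by blast
qed (use assms in auto)

lemma compress_less:
  assumes i: "i \<in> V" "i' \<in> V" "y i < y i'"
  shows "compress y i < compress y i'"
proof -
  let ?J = "{j \<in> S. y i \<le> y j \<and> y j < y i'}"
  have "2 * int (card ?J) \<le> y i' - y i"
  proof (rule card_colors_between_le)
    show "y i \<le> y j \<and> y j + 1 < y i'" if "j \<in> ?J" for j
      using spaced_coloring[OF i(2), of j] that by auto
  qed (use i in auto)
  moreover have "card {j \<in> S. y j < y i'} = card {j \<in> S. y j < y i} + card ?J"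
  proof -
    have "{j \<in> S. y j < y i'} = {j \<in> S. y j < y i} \<union> ?J" using i by auto
    moreover have "card ({j \<in> S. y j < y i} \<union> ?J) = card {j \<in> S. y j < y i} + card ?J"
      by (rule card_Un_disjoint) (use finite_S in auto)
    ultimately show ?thesis by (simp only:)
  qed
  ultimately show ?thesis using i by (simp add: compress_def)
qed

lemma compress_less_iff:
  assumes "i \<in> V" "i' \<in> V"
  shows "compress y i < compress y i' \<longleftrightarrow> y i < y i'"
proof -
  have "compress y i = compress y i'" if "y i = y i'" using that assms by (simp add: compress_def)
  then show ?thesis
    using compress_less[OF assms] compress_less[OF assms(2,1)]
    by (cases "y i" "y i'" rule: linorder_cases) auto
qed

lemma spread_compress: "spread (compress y) = y"
proof
  fix i show "spread (compress y) i = y i"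
  proof (cases "i \<in> V")
    case True
    have "{j \<in> S. compress y j < compress y i} = {j \<in> S. y j < y i}"
      using compress_less_iff[of _ i] S True by auto
    then show ?thesis using True by (simp add: spread_def) (simp add: compress_def)
  next
    case False
    then show ?thesis using y by (simp add: spread_def colorings_uniform_dig)
  qed
qed

lemma compress_greater:
  assumes i: "i \<in> V"
  shows "b < compress y i"
proof -
  have "2 * int (card {j \<in> S. y j < y i}) \<le> y i - (b + 1)"
  proof (rule card_colors_between_le)
    show "b + 1 \<le> y j \<and> y j + 1 < y i" if "j \<in> {j \<in> S. y j < y i}" for j
      using that coloring_range[of j] spaced_coloring[OF i, of j] S by auto
  qed (use coloring_range[OF i] in auto)
  then show ?thesis using i by (simp add: compress_def)
qed

lemma compress_smaller:
  assumes i: "i \<in> V"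
  shows "compress y i < int q - a - card S"
proof -
  let ?U = "{j \<in> S. y i < y j}" and ?e = "of_bool (i \<in> S) :: int"
  have "2 * int (card ?U) \<le> (int q - a) - (y i + 1 + ?e)"
  proof (rule card_colors_between_le)
    show "y i + 1 + ?e \<le> y j \<and> y j + 1 < int q - a" if "j \<in> ?U" for j
    proof -
      have "y j - y i \<noteq> 1" if "i \<in> S" using spaced_coloring[of j i] \<open>j \<in> ?U\<close> S that by auto
      then show ?thesis using coloring_range[of j] that S by auto
    qed
  qed (use coloring_range[OF i] in auto)
  moreover have "int (card S) = below y i + int (card ?U) + ?e"
  proof -
    have "y j < y i \<or> y i < y j \<or> j = i" if "j \<in> S" for j
      using inj_onD[OF inj_coloring _ _ i, of j] that S by (metis linorder_less_linear subsetD)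
    then have "S = {j \<in> S. y j < y i} \<union> (?U \<union> {j \<in> S. j = i})" by blast
    then have "card S = card ({j \<in> S. y j < y i} \<union> (?U \<union> {j \<in> S. j = i}))" by simp
    also have "\<dots> = card {j \<in> S. y j < y i} + (card ?U + card {j \<in> S. j = i})"
      using finite_S by (subst card_Un_disjoint; (subst card_Un_disjoint)?) auto
    also have "{j \<in> S. j = i} = (if i \<in> S then {i} else {})" by auto
    finally show ?thesis by simp
  qed
  ultimately show ?thesis using i by (simp add: compress_def)
qed

lemma compress_coloring: "compress y \<in> colorings (uniform_dig V {} (a + card S) b) q"
proof -
  have "inj_on (compress y) V"
  proof (rule inj_onI)
    fix i j assume ij: "i \<in> V" "j \<in> V" "compress y i = compress y j"
    then have "y i = y j" using compress_less_iff[of i j] compress_less_iff[of j i] by auto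
    then show "i = j" using inj_coloring ij by (auto simp: inj_on_def)
  qed
  then show ?thesis
    using compress_greater compress_smaller by (auto simp: colorings_uniform_dig compress_def diff_diff_eq)
qed

end

lemma card_colorings_uniform_dig:
  "card (colorings (uniform_dig V S a b) q) = card (colorings (uniform_dig V {} (a + card S) b) q)"
proof -
  have "bij_betw spread (colorings (uniform_dig V {} (a + card S) b) q) (colorings (uniform_dig V S a b) q)"
    using compress_spread spread_compress spread_coloring compress_coloring
    by (intro bij_betw_byWitness[where f' = compress]) auto
  then show ?thesis by (simp add: bij_betw_same_card)
qed

end

lemma card_colorings_edgeless_uniform_dig:
  assumes "k \<le> Suc l"
  shows "card (colorings (uniform_dig {k..l} {} a b) q) = (\<Prod>i = k..l. nat (int q - a - b - 1) - (l - i))"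
proof -
  let ?G = "uniform_dig {k..l} {} a b"
  have "colorings (induced ?G {Suc l..l}) q = {\<lambda>_. 0}"
    by (auto simp: colorings_def)
  moreover have "colorings (induced ?G {k..l}) q = colorings ?G q"
    by (simp add: colorings_def) (simp add: uniform_dig_def)
  moreover have "{k..<Suc l} = {k..l}" by auto
  ultimately show ?thesis
    using card_colorings_isolated_segment[of k "Suc l" l ?G q] assms
    by (auto simp: card_colors colors_def isolated_def uniform_dig_def diff_diff_eq add.assoc)
qed

section \<open>The characteristic polynomials\<close>

lemma (in stage) card_colorings:
  assumes q: "q > 2 * l + 1"
  shows "card (colorings G q) = (\<Prod>i = 1..l. q - (l + 1 + i))"
proof -
  have block: "colorings (induced G {k..l}) q = colorings (uniform_dig {k..l} S a k) q"
  proof -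
    have "edges G \<inter> {k..l} \<times> {k..l} = edges (uniform_dig {k..l} S a k)"
      using S by (auto simp: uniform_dig_def)
    moreover have "weight G i = weight (uniform_dig {k..l} S a k) i" if "i \<in> {k..l}" for i
      using that k by (simp add: weight_stage_dig uniform_dig_def)
    ultimately show ?thesis
      by (simp add: colorings_def del: edges_stage_dig) (simp add: uniform_dig_def)
  qed
  have "card (colorings (induced G {1..l}) q)
      = (\<Prod>i = 1..<k. card (colors G q i) - (l - i)) * card (colorings (induced G {k..l}) q)"
  proof (rule card_colorings_isolated_segment)
    fix i assume i: "i \<in> {1..<k}"
    show "isolated G i" using i k S by (auto simp: isolated_def)
    fix j assume "j \<in> {i..l}"
    then show "colors G q j \<subseteq> colors G q i"
      using i k k_le by (auto simp: colors_def weight_stage_dig)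
  qed (use k in auto)
  also have "(\<Prod>i = 1..<k. card (colors G q i) - (l - i)) = (\<Prod>i = 1..<k. q - (l + 1 + i))"
    using k q by (intro prod.cong refl) (auto simp: card_colors weight_stage_dig)
  also have "card (colorings (induced G {k..l}) q) = (\<Prod>i = k..l. nat (int q - l - k - 1) - (l - i))"
    using card_colorings_uniform_dig[OF _ S, of a k q] card_colorings_edgeless_uniform_dig[of k l "int a + card S" k q] k a
    by (simp add: block flip: of_nat_add)
  also have "\<dots> = (\<Prod>i = k..l. q - (l + 1 + i))"
    using k q by (intro prod.reindex_bij_witness[of _ "\<lambda>i. l + k - i" "\<lambda>i. l + k - i"]) auto
  also have "(\<Prod>i = 1..<k. q - (l + 1 + i)) * (\<Prod>i = k..l. q - (l + 1 + i)) = (\<Prod>i = 1..l. q - (l + 1 + i))"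
    using k by (subst prod.union_disjoint[symmetric]) (auto intro: prod.cong)
  finally show ?thesis using colorings_induced_vertices by simp
qed

lemma poly_eqI_eventually:
  fixes p r :: "int poly"
  assumes "\<And>q :: nat. q > b \<Longrightarrow> poly p (int q) = poly r (int q)"
  shows "p = r"
proof (rule ccontr)
  assume "p \<noteq> r"
  then have "finite {x. poly (p - r) x = 0}" by (intro poly_roots_finite) simp
  moreover have "int ` {b<..} \<subseteq> {x. poly (p - r) x = 0}" using assms by auto
  ultimately have "finite (int ` {b<..})" by (rule finite_subset[rotated])
  then have "finite {b<..}" by (rule finite_imageD) simp
  then show False by (simp add: infinite_Ioi)
qed

theorem (in stage) char_poly_stage: "arr_char_poly (wdig_arr G) = (\<Prod>i = 1..l. [:- int (l + 1 + i), 1:])"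
proof -
  have "mod_complement {1..l} q (wdig_gains G) = colorings G q" for q
    using mod_complement_eq_colorings[of q] k_le by (force simp: weight_stage_dig)
  then obtain b where b: "\<forall>q>b. poly (arr_char_poly (wdig_arr G)) (int q) = int (card (colorings G q))"
    using finite_field_method by (auto simp: wdig_arr_eq_gain_arr)
  show ?thesis
  proof (rule poly_eqI_eventually[of "max b (2 * l + 1)"])
    fix q assume q: "q > max b (2 * l + 1)"
    then have "poly (arr_char_poly (wdig_arr G)) (int q) = (\<Prod>i = 1..l. int (q - (l + 1 + i)))"
      using b card_colorings[of q] by simp
    also have "\<dots> = (\<Prod>i = 1..l. int q - int (l + 1 + i))"
      using q by (intro prod.cong refl of_nat_diff) auto
    finally show
        "poly (arr_char_poly (wdig_arr G)) (int q) = poly (\<Prod>i = 1..l. [:- int (l + 1 + i), 1:]) (int q)"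
      by (simp add: poly_prod algebra_simps)
  qed
qed

section \<open>Supersolvability\<close>

lemma modular_flat_if_sum_closed:
  fixes L :: "'a::real_vector set set"
  assumes X: "X \<in> L" and subspace: "\<And>Y. Y \<in> L \<Longrightarrow> subspace Y"
    and int: "\<And>Y Z. Y \<in> L \<Longrightarrow> Z \<in> L \<Longrightarrow> Y \<inter> Z \<in> L" and sum: "\<And>Y. Y \<in> L \<Longrightarrow> X + Y \<in> L"
  shows "modular_flat L X"
  unfolding modular_flat_def
proof (intro conjI ballI impI X)
  fix Y Z assume Y: "Y \<in> L" and Z: "Z \<in> L" and YZ: "Y \<subseteq> Z"
  have zero: "0 \<in> W" and add: "u \<in> W \<Longrightarrow> v \<in> W \<Longrightarrow> u + v \<in> W" and diff: "u \<in> W \<Longrightarrow> v \<in> W \<Longrightarrow> u - v \<in> W"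
    if "W \<in> L" for W u v
    using subspace[OF that] by (auto intro: subspace_0 subspace_add subspace_diff)
  have upper: "X \<subseteq> X + Y" "Y \<subseteq> X + Y"
    using zero[OF X] zero[OF Y] by (force simp: set_plus_def)+
  have "flat_meet L X Y = X + Y"
    unfolding flat_meet_def
  proof (intro subset_antisym Inter_lower Inter_greatest)
    show "X + Y \<in> {W \<in> L. X \<union> Y \<subseteq> W}" using sum[OF Y] upper by blast
    show "X + Y \<subseteq> W" if W: "W \<in> {W \<in> L. X \<union> Y \<subseteq> W}" for W
    proof
      fix v assume "v \<in> X + Y"
      then obtain x y where "v = x + y" "x \<in> X" "y \<in> Y" by (elim set_plus_elim)
      then show "v \<in> W" using W add[of W x y] by blast
    qed
  qed
  moreover have "flat_meet L (Z \<inter> X) Y = Z \<inter> (X + Y)"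
    unfolding flat_meet_def
  proof (intro subset_antisym Inter_lower Inter_greatest)
    show "Z \<inter> (X + Y) \<in> {W \<in> L. Z \<inter> X \<union> Y \<subseteq> W}" using int[OF Z sum[OF Y]] upper YZ by blast
    show "Z \<inter> (X + Y) \<subseteq> W" if W: "W \<in> {W \<in> L. Z \<inter> X \<union> Y \<subseteq> W}" for W
    proof
      fix v assume "v \<in> Z \<inter> (X + Y)"
      then obtain x y where v: "v = x + y" "v \<in> Z" "x \<in> X" "y \<in> Y" by (auto elim: set_plus_elim)
      then have "x \<in> Z" using diff[OF Z v(2), of y] YZ by auto
      then show "v \<in> W" using v W add[of W x y] by blast
    qed
  qed
  ultimately show "Z \<inter> flat_meet L X Y = flat_meet L (Z \<inter> X) Y" by simp
qed

lemma rspace_empty [simp]: "rspace {} = {0}"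
  by (auto simp: rspace_iff intro: poly_mapping_eqI)

lemma rspace_mono: "U \<subseteq> W \<Longrightarrow> rspace U \<subseteq> rspace W"
  by (auto simp: rspace_def)

lemma single_in_rspace: "u \<in> U \<Longrightarrow> single u s \<in> rspace U" for s :: real
  by (auto simp: rspace_iff lookup_single when_def)

lemma mem_rspace_single_plus: "v \<in> rspace {u} + Y \<longleftrightarrow> (\<exists>s. v + single u s \<in> Y)"
proof
  assume "v \<in> rspace {u} + Y"
  then obtain x y where v: "v = x + y" "x \<in> rspace {u}" "y \<in> Y" by (elim set_plus_elim)
  then have "v + single u (- lookup x u) = y"
    by (intro poly_mapping_eqI) (auto simp: rspace_iff lookup_add lookup_single when_def)
  then show "\<exists>s. v + single u s \<in> Y" using v(3) by metis
next
  assume "\<exists>s. v + single u s \<in> Y"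
  then obtain s where "v + single u s \<in> Y" by blast
  moreover have "v = single u (- s) + (v + single u s)" by (simp add: single_uminus)
  ultimately show "v \<in> rspace {u} + Y" by (metis insertI1 set_plus_intro single_in_rspace)
qed

lemma rspace_insert: "rspace (insert u U) = rspace {u} + rspace U"
proof (intro subset_antisym subsetI)
  fix v assume "v \<in> rspace (insert u U)"
  then have "v + single u (- lookup v u) \<in> rspace U"
    by (auto simp: rspace_iff lookup_add lookup_single when_def)
  then show "v \<in> rspace {u} + rspace U" unfolding mem_rspace_single_plus by blast
next
  fix v assume "v \<in> rspace {u} + rspace U"
  then show "v \<in> rspace (insert u U)"
    by (elim set_plus_elim) (auto simp: rspace_iff lookup_add)
qed

lemma subspace_eq_rspace_insert:
  assumes Y: "subspace Y" "rspace U \<subseteq> Y" "Y \<subseteq> rspace (insert u U)" "\<not> Y \<subseteq> rspace U"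
  shows "Y = rspace (insert u U)"
proof (intro subset_antisym Y(3) subsetI)
  fix v assume v: "v \<in> rspace (insert u U)"
  obtain y where y: "y \<in> Y" "y \<notin> rspace U" using Y(4) by blast
  then have "y \<in> rspace (insert u U)" using Y(3) by blast
  then have y_u: "lookup y u \<noteq> 0" using y(2) by (auto simp: rspace_iff)
  let ?r = "lookup v u / lookup y u"
  have "lookup v i = ?r * lookup y i" if "i \<notin> U" for i
    using that v y_u \<open>y \<in> rspace (insert u U)\<close> by (cases "i = u") (auto simp: rspace_iff)
  then have "v - ?r *\<^sub>R y \<in> rspace U"
    by (simp add: rspace_iff lookup_minus lookup_scaleR)
  then have "(v - ?r *\<^sub>R y) + ?r *\<^sub>R y \<in> Y"
    using Y(1,2) y(1) by (intro subspace_add subspace_scale) auto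
  then show "v \<in> Y" by simp
qed

lemma comparable_subspace_in_rspace_chain:
  fixes U :: "nat \<Rightarrow> 'v set"
  assumes U: "U 0 = {}" "\<And>m. m < n \<Longrightarrow> \<exists>u. U (Suc m) = insert u (U m)"
    and Y: "subspace Y" "Y \<subseteq> rspace (U n)"
    and comparable: "\<And>m. m \<le> n \<Longrightarrow> Y \<subseteq> rspace (U m) \<or> rspace (U m) \<subseteq> Y"
  shows "\<exists>m\<le>n. Y = rspace (U m)"
proof -
  define m where "m = (LEAST m. Y \<subseteq> rspace (U m))"
  have Ym: "Y \<subseteq> rspace (U m)" unfolding m_def by (rule LeastI) (rule Y(2))
  have mn: "m \<le> n" unfolding m_def by (rule Least_le) (rule Y(2))
  have "Y = rspace (U m)"
  proof (cases m)
    case 0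
    then show ?thesis using Ym U(1) subspace_0[OF Y(1)] by auto
  next
    case (Suc p)
    then have not_p: "\<not> Y \<subseteq> rspace (U p)"
      using not_less_Least[of p "\<lambda>m. Y \<subseteq> rspace (U m)"] unfolding m_def by simp
    then have "rspace (U p) \<subseteq> Y" using comparable[of p] Suc mn by auto
    moreover obtain u where "U m = insert u (U p)" using U(2)[of p] Suc mn by auto
    ultimately show ?thesis using subspace_eq_rspace_insert[OF Y(1)] Ym not_p by metis
  qed
  then show ?thesis using mn by blast
qed

text \<open>The gains incident with the smallest vertex can be eliminated: two of them prescribe the same value for its
  coordinate on a hyperplane that belongs to the remaining arrangement.\<close>

locale elimination_ordered = gain_graph "{1..l}" T for l :: nat and T +
  assumes oriented: "(i, j, c) \<in> T \<Longrightarrow> j = 0 \<or> i < j"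
    and triangle: "(m, j, c) \<in> T \<Longrightarrow> (m, j', c') \<in> T \<Longrightarrow> j \<noteq> j' \<Longrightarrow> (j, j', c' - c) \<in> T \<or> (j', j, c - c') \<in> T"
    and origin: "i \<in> {1..l} \<Longrightarrow> (i, 0, 0) \<in> T"
begin

abbreviation "J \<equiv> cone_coords {1..l}"
abbreviation "A \<equiv> arr_cone (gain_arr {1..l} T)"

definition hyps_from :: "nat \<Rightarrow> (nat option \<Rightarrow>\<^sub>0 real) set set" where
  "hyps_from m = insert (infinity_hyp {1..l}) (cone_hyp {1..l} ` {t \<in> T. m \<le> fst t})"

definition flats_from :: "nat \<Rightarrow> (nat option \<Rightarrow>\<^sub>0 real) set set" where
  "flats_from m = {rspace J \<inter> \<Inter>B | B. B \<subseteq> hyps_from m}"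

lemma hyps_A: "hyps A = hyps_from 1"
proof -
  have "{t \<in> T. 1 \<le> fst t} = T" using gain_source_nonzero by (fastforce simp: Suc_le_eq)
  then show ?thesis by (simp add: hyps_cone hyps_from_def del: One_nat_def)
qed

lemma hyps_from_subset_rspace: "H \<in> hyps_from m \<Longrightarrow> H \<subseteq> rspace J"
  by (auto simp: hyps_from_def infinity_hyp_def cone_hyp_def)

lemma subspace_hyp:
  assumes "H \<in> hyps_from m"
  shows "subspace H"
  using assms subspace_rspace[of J]
  unfolding hyps_from_def infinity_hyp_def cone_hyp_def subspace_def
  by (auto simp: lookup_add lookup_scaleR algebra_simps)

lemma flats_from_subset_rspace: "Y \<in> flats_from m \<Longrightarrow> Y \<subseteq> rspace J"
  by (auto simp: flats_from_def)

lemma subspace_flat: "Y \<in> flats_from m \<Longrightarrow> subspace Y"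
  unfolding flats_from_def
  by (auto intro!: subspace_inter subspace_rspace subspace_Inter dest: subspace_hyp)

lemma flats_A: "flats A = flats_from 1"
proof -
  have "flats A = flats_from 1 - {{}}"
    unfolding flats_def flats_from_def hyps_A coords_cone ..
  moreover have "{} \<notin> flats_from 1" using subspace_flat[of "{}" 1] subspace_0 by blast
  ultimately show ?thesis by simp
qed

lemma flats_from_mono: "m \<le> n \<Longrightarrow> flats_from n \<subseteq> flats_from m"
proof -
  assume "m \<le> n"
  then have "hyps_from n \<subseteq> hyps_from m" by (auto simp: hyps_from_def)
  then show ?thesis unfolding flats_from_def by blast
qed

lemma flats_from_Inter:
  assumes "\<A> \<subseteq> flats_from m"
  shows "rspace J \<inter> \<Inter>\<A> \<in> flats_from m"
proof -
  have "\<forall>Y\<in>\<A>. \<exists>B. B \<subseteq> hyps_from m \<and> Y = rspace J \<inter> \<Inter>B" using assms by (auto simp: flats_from_def)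
  then obtain B where B: "\<And>Y. Y \<in> \<A> \<Longrightarrow> B Y \<subseteq> hyps_from m" "\<And>Y. Y \<in> \<A> \<Longrightarrow> Y = rspace J \<inter> \<Inter>(B Y)"
    by metis
  have "rspace J \<inter> \<Inter>\<A> = rspace J \<inter> \<Inter>(\<Union>(B ` \<A>))"
    using B(2) by auto
  moreover have "\<Union>(B ` \<A>) \<subseteq> hyps_from m" using B(1) by blast
  ultimately show ?thesis unfolding flats_from_def by blast
qed

lemma flats_from_Int: "Y \<in> flats_from m \<Longrightarrow> Z \<in> flats_from m \<Longrightarrow> Y \<inter> Z \<in> flats_from m"
  using flats_from_Inter[of "{Y, Z}" m] flats_from_subset_rspace[of Y m]
  by (simp add: Int_absorb1 inf.coboundedI1)

lemma hyps_from_flat: "H \<in> hyps_from m \<Longrightarrow> H \<in> flats_from m"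
  using hyps_from_subset_rspace[of H m] unfolding flats_from_def by (intro CollectI exI[of _ "{H}"]) auto

lemma rspace_flat: "rspace J \<in> flats_from m"
  using flats_from_Inter[of "{}" m] by simp

definition prescribed :: "nat \<times> nat \<times> int \<Rightarrow> (nat option \<Rightarrow>\<^sub>0 real) \<Rightarrow> real" where
  "prescribed = (\<lambda>(m, j, c) y. lookup y (Some j) + of_int c * lookup y None)"

lemma cone_hyp_prescribed: "y \<in> cone_hyp {1..l} t \<longleftrightarrow> y \<in> rspace J \<and> lookup y (Some (fst t)) = prescribed t y"
  by (auto simp: cone_hyp_def prescribed_def split: prod.splits)

lemma prescribed_eq_flat:
  assumes t: "(m, j, c) \<in> T" "(m, j', c') \<in> T"
  shows "{y \<in> rspace J. prescribed (m, j, c) y = prescribed (m, j', c') y} \<in> flats_from (Suc m)" (is "?K \<in> _")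
proof -
  have hyp: "cone_hyp {1..l} (i, k, d) \<in> flats_from (Suc m)" if "(i, k, d) \<in> T" "m < i" for i k d
    using that by (intro hyps_from_flat) (auto simp: hyps_from_def)
  consider (same) "j = j'" "c = c'" | (parallel) "j = j'" "c \<noteq> c'"
    | (forward) "(j, j', c' - c) \<in> T" | (backward) "(j', j, c - c') \<in> T"
    using triangle[OF t] by blast
  then show ?thesis
  proof cases
    case same
    then show ?thesis using rspace_flat by simp
  next
    case parallel
    then have "?K = infinity_hyp {1..l}" by (auto simp: prescribed_def infinity_hyp_def)
    then show ?thesis using hyps_from_flat by (simp add: hyps_from_def)
  next
    case forward
    then have "?K = cone_hyp {1..l} (j, j', c' - c)" by (auto simp: prescribed_def cone_hyp_def algebra_simps)
    then show ?thesis using forward hyp oriented[OF t(1)] gain_source_nonzero by auto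
  next
    case backward
    then have "?K = cone_hyp {1..l} (j', j, c - c')" by (auto simp: prescribed_def cone_hyp_def algebra_simps)
    then show ?thesis using backward hyp oriented[OF t(2)] gain_source_nonzero by auto
  qed
qed

lemma shift_mem_rspace: "m \<in> {1..l} \<Longrightarrow> v + single (Some m) s \<in> rspace J \<longleftrightarrow> v \<in> rspace J"
  using rspace_add rspace_diff[of "v + single (Some m) s" J "single (Some m) s"] single_in_rspace[of "Some m" J s]
  by (auto simp: cone_coords_def)

lemma shift_mem_later_hyp:
  assumes H: "H \<in> hyps_from (Suc m)" and m: "m \<in> {1..l}"
  shows "v + single (Some m) s \<in> H \<longleftrightarrow> v \<in> H"
proof -
  consider (infinity) "H = infinity_hyp {1..l}"
    | (cone) i j c where "H = cone_hyp {1..l} (i, j, c)" "(i, j, c) \<in> T" "m < i"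
    using H by (auto simp: hyps_from_def)
  then show ?thesis
  proof cases
    case infinity
    then show ?thesis using shift_mem_rspace[OF m] by (simp add: infinity_hyp_def lookup_add lookup_single)
  next
    case (cone i j c)
    then have "i \<noteq> m" "j \<noteq> m" using oriented[of i j c] m by auto
    then show ?thesis using cone(1) shift_mem_rspace[OF m]
      by (simp add: cone_hyp_def lookup_add lookup_single)
  qed
qed

lemma shift_mem_cone_hyp:
  assumes t: "t \<in> T" "fst t = m"
  shows "v + single (Some m) s \<in> cone_hyp {1..l} t \<longleftrightarrow> v \<in> rspace J \<and> lookup v (Some m) + s = prescribed t v"
proof -
  obtain j c where t_eq: "t = (m, j, c)" using t(2) by (cases t) auto
  then have "m \<in> {1..l}" "m \<noteq> j" using gain_ends[of m j c] t(1) by auto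
  then show ?thesis
    using shift_mem_rspace[of m]
    by (simp add: t_eq cone_hyp_prescribed prescribed_def lookup_add lookup_single del: One_nat_def)
qed

lemma eliminate_coordinate_flat:
  assumes Y: "Y \<in> flats_from m" and m: "m \<in> {1..l}"
  shows "rspace {Some m} + Y \<in> flats_from (Suc m)"
proof -
  obtain B where B: "B \<subseteq> hyps_from m" "Y = rspace J \<inter> \<Inter>B" using Y by (auto simp: flats_from_def)
  define T\<^sub>m where "T\<^sub>m = {t \<in> T. fst t = m \<and> cone_hyp {1..l} t \<in> B}"
  define B' where "B' = B \<inter> hyps_from (Suc m)"
  have "hyps_from m \<subseteq> hyps_from (Suc m) \<union> cone_hyp {1..l} ` {t \<in> T. fst t = m}"
    by (auto simp: hyps_from_def le_eq_less_or_eq Suc_le_eq)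
  then have B_eq: "B = cone_hyp {1..l} ` T\<^sub>m \<union> B'"
    using B(1) unfolding T\<^sub>m_def B'_def by blast
  have shift_mem: "v + single (Some m) s \<in> Y
      \<longleftrightarrow> v \<in> rspace J \<and> (\<forall>H\<in>B'. v \<in> H) \<and> (\<forall>t\<in>T\<^sub>m. lookup v (Some m) + s = prescribed t v)" for v s
  proof -
    have "v + single (Some m) s \<in> Y \<longleftrightarrow> v + single (Some m) s \<in> rspace J
        \<and> (\<forall>H\<in>B'. v + single (Some m) s \<in> H) \<and> (\<forall>t\<in>T\<^sub>m. v + single (Some m) s \<in> cone_hyp {1..l} t)"
      unfolding B(2) by (subst B_eq) blast
    also have "\<dots> \<longleftrightarrow> v \<in> rspace J \<and> (\<forall>H\<in>B'. v \<in> H) \<and> (\<forall>t\<in>T\<^sub>m. lookup v (Some m) + s = prescribed t v)"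
      using shift_mem_rspace[OF m, of v s] shift_mem_later_hyp[of _ m v s] shift_mem_cone_hyp[of _ m v s] m
      unfolding B'_def T\<^sub>m_def by blast
    finally show ?thesis .
  qed
  have "(\<exists>s. \<forall>t\<in>T\<^sub>m. lookup v (Some m) + s = prescribed t v)
      \<longleftrightarrow> (\<forall>t\<in>T\<^sub>m. \<forall>t'\<in>T\<^sub>m. prescribed t v = prescribed t' v)"
    for v
  proof
    assume "\<forall>t\<in>T\<^sub>m. \<forall>t'\<in>T\<^sub>m. prescribed t v = prescribed t' v"
    then obtain p where "\<forall>t\<in>T\<^sub>m. prescribed t v = p" by blast
    then show "\<exists>s. \<forall>t\<in>T\<^sub>m. lookup v (Some m) + s = prescribed t v"
      by (intro exI[of _ "p - lookup v (Some m)"]) simp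
  qed metis
  then have "rspace {Some m} + Y
      = rspace J \<inter> \<Inter>(B' \<union> (\<Union>t\<in>T\<^sub>m. (\<lambda>t'. {y \<in> rspace J. prescribed t y = prescribed t' y}) ` T\<^sub>m))"
    unfolding set_eq_iff mem_rspace_single_plus shift_mem by (auto simp: ball_Un)
  also have "\<dots> \<in> flats_from (Suc m)"
    using hyps_from_flat prescribed_eq_flat by (intro flats_from_Inter) (auto simp: B'_def T\<^sub>m_def)
  finally show ?thesis .
qed

lemma sum_coordinate_subspace_flat:
  assumes Y: "Y \<in> flats_from 1" and "m \<le> l"
  shows "rspace (Some ` {1..m}) + Y \<in> flats_from (Suc m)"
  using assms(2)
proof (induction m)
  case 0
  then show ?case using Y by simp
next
  case (Suc m)
  have "Some ` {1..Suc m} = insert (Some (Suc m)) (Some ` {1..m})" by auto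
  then have "rspace (Some ` {1..Suc m}) + Y = rspace {Some (Suc m)} + (rspace (Some ` {1..m}) + Y)"
    by (metis rspace_insert add.assoc)
  then show ?case using Suc by (simp add: eliminate_coordinate_flat)
qed

lemma zero_flat: "{0} \<in> flats_from 1"
proof -
  have "y = 0" if y: "y \<in> rspace J \<inter> \<Inter>(hyps_from 1)" for y
  proof (rule poly_mapping_eqI)
    fix v
    have "lookup y (Some i) = 0" if i: "i \<in> {1..l}" for i
    proof -
      have "y \<in> cone_hyp {1..l} (i, 0, 0)" using y origin[OF i] i by (auto simp: hyps_from_def)
      then show ?thesis by (auto simp: cone_hyp_def cone_coords_def intro: lookup_rspace_0)
    qed
    moreover have "lookup y None = 0" using y by (simp add: hyps_from_def infinity_hyp_def)
    ultimately show "lookup y v = lookup 0 v"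
      using y lookup_rspace_0[of y J v] by (cases v) auto
  qed
  moreover have "0 \<in> rspace J \<inter> \<Inter>(hyps_from 1)"
    by (intro IntI InterI subspace_0 subspace_rspace subspace_hyp)
  ultimately have "rspace J \<inter> \<Inter>(hyps_from 1) = {0}" by blast
  then show ?thesis unfolding flats_from_def by blast
qed

definition initial_coords :: "nat \<Rightarrow> nat option set" where
  "initial_coords m = (if m \<le> l then Some ` {1..m} else J)"

lemma initial_coords_0: "initial_coords 0 = {}"
  and initial_coords_top: "initial_coords (Suc l) = J"
  by (simp_all add: initial_coords_def)

lemma initial_coords_Suc:
  "m \<le> l \<Longrightarrow> initial_coords (Suc m) = insert (if m = l then None else Some (Suc m)) (initial_coords m)"
  by (auto simp: initial_coords_def cone_coords_def)

lemma initial_coords_mono: "m \<le> n \<Longrightarrow> initial_coords m \<subseteq> initial_coords n"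
  by (auto simp: initial_coords_def cone_coords_def)

lemma sum_chain_flat:
  assumes "Y \<in> flats_from 1"
  shows "rspace (initial_coords m) + Y \<in> flats_from 1"
proof (cases "m \<le> l")
  case True
  then show ?thesis
    using sum_coordinate_subspace_flat[OF assms] flats_from_mono[of 1 "Suc m"]
    by (auto simp: initial_coords_def)
next
  case False
  have "rspace J + Y = rspace J"
  proof (intro subset_antisym subsetI)
    fix v assume "v \<in> rspace J"
    then have "v + 0 \<in> rspace J + Y"
      using subspace_0[OF subspace_flat[OF assms]] by (intro set_plus_intro)
    then show "v \<in> rspace J + Y" by simp
  next
    fix v assume "v \<in> rspace J + Y"
    then show "v \<in> rspace J"
      using flats_from_subset_rspace[OF assms] by (elim set_plus_elim) (auto intro: rspace_add)
  qed
  then show ?thesis using False rspace_flat by (simp add: initial_coords_def)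
qed

lemma chain_flat: "rspace (initial_coords m) \<in> flats_from 1"
  using sum_chain_flat[OF zero_flat] by simp

lemma chain_flat_modular: "modular_flat (flats A) (rspace (initial_coords m))"
  unfolding flats_A
  by (rule modular_flat_if_sum_closed[OF chain_flat subspace_flat flats_from_Int sum_chain_flat])

theorem supersolvable_cone: "supersolvable A"
  unfolding supersolvable_def
proof (intro conjI exI ballI)
  let ?C = "(\<lambda>m. rspace (initial_coords m)) ` {..Suc l}"
  show "central A" by (rule cone.central)
  show "modular_flat (flats A) X" if "X \<in> ?C" for X
    using that chain_flat_modular by auto
  have "subset.chain (flats A) ?C"
    unfolding subset_chain_def flats_A
  proof (intro conjI ballI)
    show "?C \<subseteq> flats_from 1" using chain_flat by auto
    fix X Y assume "X \<in> ?C" "Y \<in> ?C"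
    then obtain m n where "X = rspace (initial_coords m)" "Y = rspace (initial_coords n)" by blast
    then show "X \<subseteq> Y \<or> Y \<subseteq> X"
      using rspace_mono initial_coords_mono nat_le_linear by metis
  qed
  moreover have "S = ?C" if S: "subset.chain (flats A) S" "?C \<subseteq> S" for S
  proof (intro subset_antisym S(2) subsetI)
    fix Y assume YS: "Y \<in> S"
    then have Y: "Y \<in> flats_from 1" using S(1) unfolding subset_chain_def flats_A by blast
    have "\<exists>m\<le>Suc l. Y = rspace (initial_coords m)"
    proof (rule comparable_subspace_in_rspace_chain)
      show "Y \<subseteq> rspace (initial_coords m) \<or> rspace (initial_coords m) \<subseteq> Y" if "m \<le> Suc l" for m
        using S YS that unfolding subset_chain_def by blast
    qed (use initial_coords_0 initial_coords_top initial_coords_Suc subspace_flat[OF Y] flats_from_subset_rspace[OF Y] in auto)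
    then show "Y \<in> ?C" by blast
  qed
  ultimately show "subset.maxchain (flats A) ?C"
    unfolding subset.maxchain_def by blast
qed

end

section \<open>The Catalan arrangement\<close>

definition shear :: "nat \<Rightarrow> (nat + unit \<Rightarrow>\<^sub>0 real) \<Rightarrow> nat \<Rightarrow>\<^sub>0 real" where
  "shear l x = (\<Sum>i\<in>{1..l + 1}. single i ((if i = l + 1 then 0 else lookup x (Inl i)) + lookup x (Inr ())))"

definition unshear :: "nat \<Rightarrow> (nat \<Rightarrow>\<^sub>0 real) \<Rightarrow> nat + unit \<Rightarrow>\<^sub>0 real" where
  "unshear l y = (\<Sum>u\<in>{1..l} <+> UNIV. single u
     (case u of Inl i \<Rightarrow> lookup y i - lookup y (l + 1) | Inr _ \<Rightarrow> lookup y (l + 1)))"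

lemma lookup_shear: "lookup (shear l x) i = (if i \<in> {1..l + 1}
    then (if i = l + 1 then 0 else lookup x (Inl i)) + lookup x (Inr ()) else 0)"
  unfolding shear_def by (rule lookup_sum_single) simp

lemma lookup_unshear: "lookup (unshear l y) u = (if u \<in> {1..l} <+> UNIV
    then (case u of Inl i \<Rightarrow> lookup y i - lookup y (l + 1) | Inr _ \<Rightarrow> lookup y (l + 1)) else 0)"
  unfolding unshear_def by (rule lookup_sum_single) simp

lemma linear_shear: "linear (shear l)"
  by (rule linearI; rule poly_mapping_eqI) (simp_all add: lookup_shear lookup_add lookup_scaleR algebra_simps)

lemma shear_in_rspace: "shear l x \<in> rspace {1..l + 1}"
  by (auto simp: rspace_iff lookup_shear simp del: One_nat_def)

lemma unshear_in_rspace: "unshear l y \<in> rspace ({1..l} <+> UNIV)"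
  by (simp add: rspace_iff lookup_unshear)

lemma bij_betw_shear: "bij_betw (shear l) (rspace ({1..l} <+> UNIV)) (rspace {1..l + 1})"
proof (rule bij_betw_byWitness[where f' = "unshear l"])
  show "\<forall>x\<in>rspace ({1..l} <+> UNIV). unshear l (shear l x) = x"
  proof (intro ballI poly_mapping_eqI)
    fix x :: "nat + unit \<Rightarrow>\<^sub>0 real" and u assume "x \<in> rspace ({1..l} <+> UNIV)"
    then show "lookup (unshear l (shear l x)) u = lookup x u"
      using lookup_rspace_0[of x "{1..l} <+> UNIV" u]
      by (cases u) (auto simp: lookup_unshear lookup_shear)
  qed
  show "\<forall>y\<in>rspace {1..l + 1}. shear l (unshear l y) = y"
  proof (intro ballI poly_mapping_eqI)
    fix y i assume "y \<in> rspace {1..l + 1}"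
    then show "lookup (shear l (unshear l y)) i = lookup y i"
      using lookup_rspace_0[of y "{1..l + 1}" i] by (auto simp: lookup_unshear lookup_shear)
  qed
qed (use shear_in_rspace unshear_in_rspace in blast)+

text \<open>The coordinate of \<open>\<Phi>\<^sub>1\<close> becomes \<open>x\<^bsub>l+1\<^esub>\<close>, which takes the place of the index \<open>0\<close>.\<close>

definition ground_to_vertex :: "nat \<Rightarrow> nat \<times> nat \<times> int \<Rightarrow> nat \<times> nat \<times> int" where
  "ground_to_vertex l = (\<lambda>(i, j, c). (i, if j = 0 then l + 1 else j, c))"

lemma shear_image_gain_hyp:
  assumes ij: "i \<in> {1..l}" "j \<in> insert 0 {1..l}"
  shows "shear l ` {x \<in> rspace ({1..l} <+> UNIV). Poly_Mapping.map_key Inl x \<in> gain_hyp {1..l} (i, j, c)}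
    = gain_hyp {1..l + 1} (ground_to_vertex l (i, j, c))" (is "shear l ` ?H = ?H'")
proof -
  have "Poly_Mapping.map_key Inl x \<in> gain_hyp {1..l} (i, j, c) \<longleftrightarrow> shear l x \<in> ?H'"
    if x: "x \<in> rspace ({1..l} <+> UNIV)" for x
  proof -
    have lookup_Inl: "lookup (Poly_Mapping.map_key Inl x) m = lookup x (Inl m)" for m
      by (simp add: map_key.rep_eq)
    then have "Poly_Mapping.map_key Inl x \<in> rspace {1..l}"
      unfolding rspace_iff lookup_Inl using lookup_rspace_0[OF x] by blast
    moreover have "lookup x (Inl 0) = 0" using x by (rule lookup_rspace_0) auto
    ultimately show ?thesis
      using ij shear_in_rspace[of l x]
      by (auto simp: ground_to_vertex_def gain_hyp_def lookup_Inl lookup_shear)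
  qed
  moreover have "?H' \<subseteq> shear l ` rspace ({1..l} <+> UNIV)"
    using bij_betw_shear[of l] by (auto simp: bij_betw_def gain_hyp_def ground_to_vertex_def)
  ultimately show ?thesis by blast
qed

lemma gain_hyp_swap: "gain_hyp I (i, j, c) = gain_hyp I (j, i, - c)"
  by (auto simp: gain_hyp_def)

lemma gain_hyps_ground_to_vertex:
  "gain_hyp {1..l + 1} ` ground_to_vertex l ` wdig_gains (stage_dig l 1 0 {1..l})
    = gain_hyp {1..l + 1} ` wdig_gains (complete_dig (l + 1))" (is "?h ` ground_to_vertex l ` ?T = ?h ` ?T'")
proof (intro subset_antisym image_subsetI)
  fix t assume "t \<in> ground_to_vertex l ` ?T"
  then obtain i j c where "(i, j, c) \<in> ?T" and t: "t = ground_to_vertex l (i, j, c)" by auto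
  then have "t \<in> ?T' \<or> t = (i, l + 1, -1) \<and> i \<in> {1..l}"
    by (auto simp: mem_wdig_gains ground_to_vertex_def weight_stage_dig)
  then show "?h t \<in> ?h ` ?T'"
  proof
    assume "t = (i, l + 1, -1) \<and> i \<in> {1..l}"
    then have "?h t = ?h (l + 1, i, 1)" "(l + 1, i, 1) \<in> ?T'"
      using gain_hyp_swap by (auto simp: mem_wdig_gains)
    then show ?thesis by blast
  qed blast
next
  fix t assume "t \<in> ?T'"
  then obtain i j c where t: "t = (i, j, c)" "(i, j, c) \<in> ?T'" by (cases t) auto
  have mem: "?h s \<in> ?h ` ground_to_vertex l ` ?T" if "s' \<in> ?T" "s = ground_to_vertex l s'" for s s'
    using that by blast
  consider (to_new) "j = l + 1" "i \<in> {1..l}" "c = 0 \<or> c = 1" | (from_new) "i = l + 1" "j \<in> {1..l}" "c = 1"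
    | (old) "i \<in> {1..l}" "j \<in> {1..l}"
    using t(2) by (auto simp: mem_wdig_gains le_Suc_eq)
  then show "?h t \<in> ?h ` ground_to_vertex l ` ?T"
  proof cases
    case to_new
    then show ?thesis
      using t by (intro mem[of "(i, 0, c)"]) (auto simp: mem_wdig_gains ground_to_vertex_def weight_stage_dig)
  next
    case from_new
    then have "?h t = ?h (j, l + 1, -1)" using t gain_hyp_swap by simp
    also have "\<dots> \<in> ?h ` ground_to_vertex l ` ?T"
      using from_new
      by (intro mem[of "(j, 0, -1)"]) (auto simp: mem_wdig_gains ground_to_vertex_def weight_stage_dig)
    finally show ?thesis .
  next
    case old
    then show ?thesis
      using t by (intro mem[of "(i, j, c)"]) (auto simp: mem_wdig_gains ground_to_vertex_def)
  qed
qed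

theorem affinely_equivalent_Cat:
  assumes "1 \<le> l"
  shows "affinely_equivalent (arr_prod (wdig_arr (stage_dig l 1 0 {1..l})) Phi1) (Cat (l + 1))"
  unfolding affinely_equivalent_def
proof (intro exI conjI)
  interpret stage l 1 0 "{1..l}" using assms by unfold_locales auto
  let ?A = "arr_prod (wdig_arr G) Phi1"
  have A: "coords ?A = {1..l} <+> UNIV"
    "hyps ?A = (\<lambda>t. {x \<in> rspace ({1..l} <+> UNIV). Poly_Mapping.map_key Inl x \<in> gain_hyp {1..l} t}) ` wdig_gains G"
    unfolding wdig_arr_eq_gain_arr[OF zero_notin_verts] by (auto simp: arr_prod_def Phi1_def)
  have Cat: "coords (Cat (l + 1)) = {1..l + 1}"
      "hyps (Cat (l + 1)) = gain_hyp {1..l + 1} ` wdig_gains (complete_dig (l + 1))"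
    by (simp_all add: Cat_eq_wdig_arr wdig_arr_eq_gain_arr)
  show "linear (shear l)" by (rule linear_shear)
  show "bij_betw (\<lambda>x. shear l x + 0) (ambient ?A) (ambient (Cat (l + 1)))"
    unfolding A Cat using bij_betw_shear by simp
  have "(\<lambda>H. (\<lambda>x. shear l x + 0) ` H) ` hyps ?A = gain_hyp {1..l + 1} ` ground_to_vertex l ` wdig_gains G"
    unfolding A image_image
  proof (rule image_cong[OF refl])
    fix t assume t: "t \<in> wdig_gains G"
    obtain i j c where ijc: "t = (i, j, c)" by (cases t)
    then have "i \<in> {1..l}" "j \<in> insert 0 {1..l}" using gain_ends[of i j c] t by auto
    then show "(\<lambda>x. shear l x + 0) ` {x \<in> rspace ({1..l} <+> UNIV). Poly_Mapping.map_key Inl x \<in> gain_hyp {1..l} t}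
        = gain_hyp {1..l + 1} (ground_to_vertex l t)"
      unfolding ijc add_0_right by (rule shear_image_gain_hyp)
  qed
  then show "(\<lambda>H. (\<lambda>x. shear l x + 0) ` H) ` hyps ?A = hyps (Cat (l + 1))"
    unfolding Cat gain_hyps_ground_to_vertex .
qed

section \<open>The eliminations\<close>

lemma C_dig_eq_stage_dig: "1 \<le> k \<Longrightarrow> C_dig l k = stage_dig l k (k - 1) {k..l}"
  by (auto simp: C_dig_def stage_dig_def fun_eq_iff)

lemma D_dig_eq_stage_dig: "k \<le> l \<Longrightarrow> D_dig l k = stage_dig l k k {k+1..l}"
  by (auto simp: D_dig_def stage_dig_def fun_eq_iff)

lemma stage_C: "1 \<le> k \<Longrightarrow> k \<le> l \<Longrightarrow> stage l k (k - 1) {k..l}"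
  and stage_D: "1 \<le> k \<Longrightarrow> k \<le> l \<Longrightarrow> stage l k k {k+1..l}"
  by (unfold_locales; auto)+

lemma char_poly_C:
  "1 \<le> k \<Longrightarrow> k \<le> l \<Longrightarrow> arr_char_poly (wdig_arr (C_dig l k)) = (\<Prod>i = 1..l. [:- int (l + 1 + i), 1:])"
  and char_poly_D:
    "1 \<le> k \<Longrightarrow> k \<le> l \<Longrightarrow> arr_char_poly (wdig_arr (D_dig l k)) = (\<Prod>i = 1..l. [:- int (l + 1 + i), 1:])"
  using stage.char_poly_stage[OF stage_C] stage.char_poly_stage[OF stage_D]
  by (simp_all only: C_dig_eq_stage_dig D_dig_eq_stage_dig)

lemma free_cone_C: "1 \<le> k \<Longrightarrow> k \<le> l \<Longrightarrow> free_arrangement (arr_cone (wdig_arr (C_dig l k)))"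
  and free_cone_D: "1 \<le> k \<Longrightarrow> k \<le> l \<Longrightarrow> free_arrangement (arr_cone (wdig_arr (D_dig l k)))"
  using stage.free_cone_stage[OF stage_C] stage.free_cone_stage[OF stage_D]
  unfolding free_arrangement_def by (metis C_dig_eq_stage_dig, metis D_dig_eq_stage_dig)

lemma supersolvable_cone_C:
  assumes "1 \<le> l"
  shows "supersolvable (arr_cone (wdig_arr (C_dig l l)))"
proof -
  interpret stage l l "l - 1" "{l..l}" using assms by (intro stage_C) auto
  have gains: "(i, j, c) \<in> wdig_gains G \<longleftrightarrow> c = 0 \<and> 1 \<le> i \<and> i < j \<and> j \<le> l
      \<or> j = 0 \<and> 1 \<le> i \<and> i \<le> l \<and> - int i \<le> c \<and> c \<le> int i" for i j c
    using assms by (auto simp: mem_wdig_gains weight_stage_dig split: if_splits)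
  have "gain_graph {1..l} (wdig_gains G)"
    using gain_graph_axioms by (simp only: vertices_stage_dig)
  then have "elimination_ordered l (wdig_gains G)"
    by (intro elimination_ordered.intro elimination_ordered_axioms.intro) (unfold gains, auto)
  then show ?thesis
    using elimination_ordered.supersolvable_cone assms by (simp add: C_dig_eq_stage_dig wdig_arr_eq_gain_arr)
qed

lemma coking_elim_C:
  assumes "1 \<le> k" "k < l"
  shows "apply_on {k..l} (coking_elim k) (C_dig l k) = D_dig l k"
proof -
  let ?f = "coking_elim k (induced (C_dig l k) {k..l})"
  have "edges ?f \<union> (edges (C_dig l k) - {k..l} \<times> {k..l}) = edges (D_dig l k)"
    using assms by (auto simp: coking_elim_def C_dig_def D_dig_def)
  moreover have "(\<lambda>i. if i \<in> {k..l} then weight ?f i else weight (C_dig l k) i) = weight (D_dig l k)"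
    using assms by (auto simp: fun_eq_iff coking_elim_def C_dig_def D_dig_def min_def)
  ultimately show ?thesis
    unfolding apply_on_def by (simp add: C_dig_def D_dig_def)
qed

lemma king_elim_D:
  assumes "1 \<le> k" "k < l"
  shows "apply_on {k..l} (king_elim k) (D_dig l k) = C_dig l (k + 1)"
proof -
  let ?f = "king_elim k (induced (D_dig l k) {k..l})"
  have "edges ?f \<union> (edges (D_dig l k) - {k..l} \<times> {k..l}) = edges (C_dig l (k + 1))"
    using assms by (auto simp: king_elim_def C_dig_def D_dig_def)
  moreover have "(\<lambda>i. if i \<in> {k..l} then weight ?f i else weight (D_dig l k) i) = weight (C_dig l (k + 1))"
    using assms by (auto simp: fun_eq_iff king_elim_def C_dig_def D_dig_def min_def)
  ultimately show ?thesis
    unfolding apply_on_def by (simp add: C_dig_def D_dig_def)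
qed

lemma fold_eliminations:
  assumes "1 \<le> m" "m \<le> l"
  shows "fold (\<lambda>k G. apply_on {k..l} (king_elim k) (apply_on {k..l} (coking_elim k) G)) [1..<m] (C_dig l 1)
      = C_dig l m"
  using assms
proof (induction m rule: nat_induct_at_least)
  case (Suc m)
  then show ?case using coking_elim_C[of m l] king_elim_D[of m l] by simp
qed simp

lemma coking_C: "k \<le> l \<Longrightarrow> coking (induced (C_dig l k) {k..l}) k"
  and king_D: "k \<le> l \<Longrightarrow> king (induced (D_dig l k) {k..l}) k"
  by (auto simp: coking_def king_def C_dig_def D_dig_def)

lemma isolated_C: "i \<in> {1..k - 1} \<Longrightarrow> k \<le> l \<Longrightarrow> isolated (C_dig l k) i"
  and isolated_D: "i \<in> {1..k - 1} \<Longrightarrow> k \<le> l \<Longrightarrow> isolated (D_dig l k) i"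
  by (auto simp: isolated_def C_dig_def D_dig_def)

theorem theorem4p18:
  shows
    "(\<forall>l::nat. 1 \<le> l \<longrightarrow>
        (\<forall>k\<in>{1..l-1}.
            coking (induced (C_dig l k) {k..l}) k
          \<and> (\<forall>i\<in>{1..k-1}. isolated (C_dig l k) i)
          \<and> apply_on {k..l} (coking_elim k) (C_dig l k) = D_dig l k
          \<and> king (induced (D_dig l k) {k..l}) k
          \<and> (\<forall>i\<in>{1..k-1}. isolated (D_dig l k) i)
          \<and> apply_on {k..l} (king_elim k) (D_dig l k) = C_dig l (k+1)
          \<and> arr_char_poly (wdig_arr (C_dig l k)) = arr_char_poly (wdig_arr (D_dig l k))
          \<and> arr_char_poly (wdig_arr (D_dig l k)) = arr_char_poly (wdig_arr (C_dig l (k+1)))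
          \<and> (free_arrangement (arr_cone (wdig_arr (C_dig l k)))
               \<longleftrightarrow> free_arrangement (arr_cone (wdig_arr (D_dig l k))))
          \<and> (free_arrangement (arr_cone (wdig_arr (D_dig l k)))
               \<longleftrightarrow> free_arrangement (arr_cone (wdig_arr (C_dig l (k+1))))))
      \<and> affinely_equivalent (arr_prod (wdig_arr (C_dig l 1)) Phi1) (Cat (l+1))
      \<and> fold (\<lambda>k G. apply_on {k..l} (king_elim k) (apply_on {k..l} (coking_elim k) G)) [1..<l]
          (C_dig l 1) = C_dig l l
      \<and> edges (C_dig l l) = {}
      \<and> supersolvable (arr_cone (wdig_arr (C_dig l l))))
    \<and> (\<forall>n::nat. 2 \<le> n \<longrightarrow>
        free_with_exponents (arr_cone (Cat n)) ({#0, 1#} + mset_set {n+1..2*n-1}))"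
    (is "(\<forall>l. 1 \<le> l \<longrightarrow> (\<forall>k\<in>{1..l-1}. ?eliminations l k) \<and> ?start l \<and> ?sequence l \<and> ?edgeless l \<and> ?supersolvable l)
      \<and> ?catalan")
proof (intro conjI allI impI)
  fix l :: nat assume l: "1 \<le> l"
  show "\<forall>k\<in>{1..l-1}. ?eliminations l k"
  proof
    fix k assume "k \<in> {1..l-1}"
    then have k: "1 \<le> k" "k < l" "k \<le> l" "1 \<le> k + 1" "k + 1 \<le> l" by auto
    show "?eliminations l k"
      using coking_C[OF k(3)] isolated_C[OF _ k(3)] coking_elim_C[OF k(1,2)]
        king_D[OF k(3)] isolated_D[OF _ k(3)] king_elim_D[OF k(1,2)]
        char_poly_C[OF k(1,3)] char_poly_D[OF k(1,3)] char_poly_C[OF k(4,5)]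
        free_cone_C[OF k(1,3)] free_cone_D[OF k(1,3)] free_cone_C[OF k(4,5)]
      by (simp only:) blast
  qed
  show "?start l" using affinely_equivalent_Cat[OF l] by (simp add: C_dig_eq_stage_dig)
  show "?sequence l" using l by (rule fold_eliminations) simp
  show "?edgeless l" by (auto simp: C_dig_def)
  show "?supersolvable l" using l by (rule supersolvable_cone_C)
next
  fix n :: nat assume "2 \<le> n"
  then show "free_with_exponents (arr_cone (Cat n)) ({#0, 1#} + mset_set {n+1..2*n-1})"
    by (intro free_cone_Cat) simp
qed

end
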